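(* Let $M$ be a finite rectangular monoid and let $k$ be a field which is a splitting field for $M$ and whose characteristic does not divide the order of any maximal subgroup of $M$. Then the vertex set of the quiver $Q(kM)$ is $\coprod_{X\in \Lambda(M)}\mathrm{Irr}(G_X)$. For $X,Y\in\Lambda(M)$, $U\in \mathrm{Irr}(G_X)$ and $V\in\mathrm{Irr}(G_Y)$, the number of arrows from $U$ to $V$ in $Q(kM)$ equals the multiplicity of the simple $k[G_Y\times G_X]$-module $V\otimes_k U^*$ as an irreducible constituent of the $k[G_Y\times G_X]$-module $V_{X,Y}$ defined below.
   Context: Let $M$ be a finite monoid with idempotent set $E(M)$; for $m\in M$, $m^\omega$ is the unique idempotent power of $m$. For $A,B\subseteq M$, $AB=\{ab: a\in A, b\in B\}$. $M$ is rectangular if for every $e\in E(M)$ the set $\{f\in E(M): MfM=MeM\}$ is closed under multiplication. $\Lambda(M)$ is the set of ideals $MeM$, $e\in E(M)$, ordered by inclusion ($X\le Y$ means $X\subseteq Y$); $\sigma(m)=Mm^\omega M$. For $X\in\Lambda(M)$, $M_X=\{m: X\subseteq MmM\}$ (so $m\in M_X$ iff $\sigma(m)\ge X$) and $\nabla X=M\setminus M_X$. Fix for each $X$ an idempotent $e_X$ with $Me_XM=X$; $G_X$ is the group of units of $e_XMe_X$. $\rho_X\colon kM\to kG_X$ is the algebra map with $\rho_X(m)=e_Xme_X$ if $\sigma(m)\ge X$ and $0$ otherwise; a $kG_X$-module is a $kM$-module via $\rho_X$, and $\mathrm{Irr}(G_X)$ denotes the simple $kG_X$-modules. $k$ is a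 splitting field for $M$ if $kM/\mathrm{rad}(kM)$ is a product of full matrix algebras over $k$. The quiver $Q(A)$ of such an algebra has vertices the isomorphism classes of simple modules and $\dim \mathrm{Ext}^1_A(S,T)$ arrows from $S$ to $T$. $U^*$ is the contragredient module. In all cases below, $G_Y\times G_X$ acts on classes by $(g,h)[a]=[gah^{-1}]$. Definition of $V_{X,Y}$. (i) If $X,Y$ are incomparable: $V_{X,Y}=k[e_YMe_X]/W$, where $W$ is spanned by the elements of $e_YMe_X\cap \nabla Y\nabla X$ and all elements $e_Ymne_X+e_Yme_Ye_Xne_X-e_Yme_Yne_X-e_Yme_Xne_X$ ($m,n\in M$). (ii) If $X=Y$: let $I_X=e_XMe_X\setminus G_X$ and let $\sim$ be the least equivalence relation on $I_X$ with $e_Xmne_X\sim e_Xme_Xne_X$ whenever $m,n\in M$ and $\sigma(mn)\not\ge X$, and $z\sim z'$ for all $z,z'\in (\nabla X)(\nabla X)\cap I_X$; $V_{X,X}=kI_X/W$ where $W$ is spanned by $(\nabla X)(\nabla X)\cap I_X$ and all $m-n$ with $m\sim n$. (iii) If $X<Y$: choose $e_X,e_Y$ with $e_X<e_Y$ (i.e. $e_Xe_Y=e_X=e_Ye_X$). Let $\sim$ be the least equivalence relation on $e_YMe_X$ with: $e_Ymne_X\sim e_Yme_Yne_X$ for all $m,n$; $e_Ymne_X\sim e_Yme_Xne_X$ for all $n$ whenever $\sigma(m)\not\ge Y$; $z\sim z'$ for all $z,z'\in\nabla Y\nabla X\cap e_YMe_X$. Let $W_{X,Y}=k[e_YMe_X]/Z$,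 $Z$ spanned by $\nabla Y\nabla X\cap e_YMe_X$ and differences $m-n$ with $m\sim n$; $a\mapsto \rho_X(a)$ induces a well-defined surjection $W_{X,Y}\to kG_X$, and $V_{X,Y}$ is its kernel (spanned by the $[a]-[e_Xa]$, $a\in e_YMe_X$). (iv) If $Y<X$: choose $e_Y<e_X$, let $\sim$ be the least equivalence relation on $e_YMe_X$ with: $e_Ymne_X\sim e_Yme_Xne_X$ for all $m,n$; $e_Ymne_X\sim e_Yme_Yne_X$ for all $m$ whenever $\sigma(n)\not\ge X$; $z\sim z'$ for $z,z'\in\nabla Y\nabla X\cap e_YMe_X$; form $W_{X,Y}$ as in (iii) and let $V_{X,Y}$ be the kernel of the map $W_{X,Y}\to kG_Y$ induced by $a\mapsto \rho_Y(a)$ (spanned by the $[a]-[ae_Y]$). *)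

theory Defs
  imports Main
begin

definition idems :: "'m::monoid_mult set" where
  "idems = {e. e * e = e}"

definition ideal_of :: "'m::monoid_mult \<Rightarrow> 'm set" where
  "ideal_of m = {a * m * b | a b. True}"

definition omega :: "'m::monoid_mult \<Rightarrow> 'm" where
  "omega m = (THE e. e * e = e \<and> (\<exists>n>0. e = m ^ n))"

definition rectangular :: "'m::monoid_mult itself \<Rightarrow> bool" where
  "rectangular _ \<longleftrightarrow>
     (\<forall>e\<in>(idems::'m set). \<forall>f\<in>idems. \<forall>g\<in>idems.
        ideal_of f = ideal_of e \<and> ideal_of g = ideal_of e \<longrightarrow> ideal_of (f * g) = ideal_of e \<and> f * g \<in> idems)"

definition Lam :: "'m::monoid_mult set set" where
  "Lam = {ideal_of e | e. e \<in> idems}"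

definition sigma :: "'m::monoid_mult \<Rightarrow> 'm set" where
  "sigma m = ideal_of (omega m)"

definition MX :: "'m::monoid_mult set \<Rightarrow> 'm set" where
  "MX X = {m. X \<subseteq> ideal_of m}"

definition nabla :: "'m::monoid_mult set \<Rightarrow> 'm set" where
  "nabla X = - MX X"

definition setmul :: "'m::monoid_mult set \<Rightarrow> 'm set \<Rightarrow> 'm set" where
  "setmul A B = {a * b | a b. a \<in> A \<and> b \<in> B}"

definition corner :: "'m::monoid_mult \<Rightarrow> 'm \<Rightarrow> 'm set" where
  "corner e f = {e * m * f | m. True}"

text \<open>G_e: group of units of e M e (a maximal subgroup when e is idempotent)\<close>
definition Gunits :: "'m::monoid_mult \<Rightarrow> 'm set" where
  "Gunits e = {g \<in> corner e e. \<exists>h\<in>corner e e. g * h = e \<and> h * g = e}"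

definition ginv :: "'m::monoid_mult \<Rightarrow> 'm \<Rightarrow> 'm" where
  "ginv e g = (THE h. h \<in> corner e e \<and> g * h = e \<and> h * g = e)"

definition vsp :: "'i set \<Rightarrow> ('i \<Rightarrow> 'k::field) set" where
  "vsp I = {v. \<forall>i. i \<notin> I \<longrightarrow> v i = 0}"

definition vadd :: "('i \<Rightarrow> 'k::field) \<Rightarrow> ('i \<Rightarrow> 'k) \<Rightarrow> ('i \<Rightarrow> 'k)" where
  "vadd v w = (\<lambda>i. v i + w i)"

definition vsub :: "('i \<Rightarrow> 'k::field) \<Rightarrow> ('i \<Rightarrow> 'k) \<Rightarrow> ('i \<Rightarrow> 'k)" where
  "vsub v w = (\<lambda>i. v i - w i)"

definition vsmul :: "'k::field \<Rightarrow> ('i \<Rightarrow> 'k) \<Rightarrow> ('i \<Rightarrow> 'k)" where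
  "vsmul c v = (\<lambda>i. c * v i)"

definition vzero :: "'i \<Rightarrow> 'k::field" where
  "vzero = (\<lambda>i. 0)"

definition delta :: "'i \<Rightarrow> ('i \<Rightarrow> 'k::field)" where
  "delta a = (\<lambda>b. if b = a then 1 else 0)"

definition lspan :: "('i \<Rightarrow> 'k::field) set \<Rightarrow> ('i \<Rightarrow> 'k) set" where
  "lspan S = {v. \<exists>B c. finite B \<and> B \<subseteq> S \<and> v = (\<lambda>x. \<Sum>b\<in>B. c b * b x)}"

definition lsubspace :: "'i set \<Rightarrow> ('i \<Rightarrow> 'k::field) set \<Rightarrow> bool" where
  "lsubspace I S \<longleftrightarrow> S \<subseteq> vsp I \<and> vzero \<in> S \<and>
     (\<forall>v\<in>S. \<forall>w\<in>S. vadd v w \<in> S) \<and> (\<forall>c. \<forall>v\<in>S. vsmul c v \<in> S)"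

text \<open>Dimension of the quotient space Z/B (B \<subseteq> Z): least size of a set C \<subseteq> Z with Z = span C + B.\<close>
definition qdim :: "('i \<Rightarrow> 'k::field) set \<Rightarrow> ('i \<Rightarrow> 'k) set \<Rightarrow> nat" where
  "qdim Z B = (LEAST n. \<exists>C. finite C \<and> card C = n \<and> C \<subseteq> Z \<and>
                        (\<forall>z\<in>Z. \<exists>b\<in>B. vsub z b \<in> lspan C))"

definition mact :: "'i set \<Rightarrow> ('g \<Rightarrow> 'i \<Rightarrow> 'i \<Rightarrow> 'k::field) \<Rightarrow> 'g \<Rightarrow> ('i \<Rightarrow> 'k) \<Rightarrow> ('i \<Rightarrow> 'k)" where
  "mact I \<rho> g v = (\<lambda>i. if i \<in> I then (\<Sum>j\<in>I. \<rho> g i j * v j) else 0)"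

definition is_rep :: "'g set \<Rightarrow> ('g \<Rightarrow> 'g \<Rightarrow> 'g) \<Rightarrow> 'g \<Rightarrow> 'i set \<Rightarrow> ('g \<Rightarrow> 'i \<Rightarrow> 'i \<Rightarrow> 'k::field) \<Rightarrow> bool" where
  "is_rep C mul u I \<rho> \<longleftrightarrow> finite I \<and>
     (\<forall>i\<in>I. \<forall>j\<in>I. \<rho> u i j = (if i = j then 1 else 0)) \<and>
     (\<forall>g\<in>C. \<forall>h\<in>C. \<forall>i\<in>I. \<forall>j\<in>I. \<rho> (mul g h) i j = (\<Sum>l\<in>I. \<rho> g i l * \<rho> h l j))"

definition invariant :: "'g set \<Rightarrow> 'i set \<Rightarrow> ('g \<Rightarrow> 'i \<Rightarrow> 'i \<Rightarrow> 'k::field) \<Rightarrow> ('i \<Rightarrow> 'k) set \<Rightarrow> bool" where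
  "invariant C I \<rho> S \<longleftrightarrow> (\<forall>g\<in>C. \<forall>v\<in>S. mact I \<rho> g v \<in> S)"

text \<open>The subquotient module U/W of the representation k^I, with W \<subseteq> U invariant subspaces.\<close>
definition section_ok :: "'g set \<Rightarrow> ('g \<Rightarrow> 'g \<Rightarrow> 'g) \<Rightarrow> 'g \<Rightarrow> 'i set \<Rightarrow> ('g \<Rightarrow> 'i \<Rightarrow> 'i \<Rightarrow> 'k::field)
    \<Rightarrow> ('i \<Rightarrow> 'k) set \<Rightarrow> ('i \<Rightarrow> 'k) set \<Rightarrow> bool" where
  "section_ok C mul u I \<rho> U W \<longleftrightarrow> is_rep C mul u I \<rho> \<and> lsubspace I U \<and> lsubspace I W \<and> W \<subseteq> U \<and>
     invariant C I \<rho> U \<and> invariant C I \<rho> W"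

definition simple_sec :: "'g set \<Rightarrow> ('g \<Rightarrow> 'g \<Rightarrow> 'g) \<Rightarrow> 'g \<Rightarrow> 'i set \<Rightarrow> ('g \<Rightarrow> 'i \<Rightarrow> 'i \<Rightarrow> 'k::field)
    \<Rightarrow> ('i \<Rightarrow> 'k) set \<Rightarrow> ('i \<Rightarrow> 'k) set \<Rightarrow> bool" where
  "simple_sec C mul u I \<rho> U W \<longleftrightarrow> section_ok C mul u I \<rho> U W \<and> W \<noteq> U \<and>
     (\<forall>S. lsubspace I S \<and> invariant C I \<rho> S \<and> W \<subseteq> S \<and> S \<subseteq> U \<longrightarrow> S = W \<or> S = U)"

definition simple_mod :: "'g set \<Rightarrow> ('g \<Rightarrow> 'g \<Rightarrow> 'g) \<Rightarrow> 'g \<Rightarrow> 'i set \<Rightarrow> ('g \<Rightarrow> 'i \<Rightarrow> 'i \<Rightarrow> 'k::field) \<Rightarrow> bool" where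
  "simple_mod C mul u I \<rho> \<longleftrightarrow> simple_sec C mul u I \<rho> (vsp I) {vzero}"

text \<open>Isomorphism of subquotient modules U1/W1 and U2/W2: a linear map f on U1 inducing
  a C-equivariant bijection U1/W1 \<rightarrow> U2/W2.\<close>
definition iso_sec :: "'g set \<Rightarrow> 'i set \<Rightarrow> ('g \<Rightarrow> 'i \<Rightarrow> 'i \<Rightarrow> 'k::field) \<Rightarrow> ('i \<Rightarrow> 'k) set \<Rightarrow> ('i \<Rightarrow> 'k) set
    \<Rightarrow> 'j set \<Rightarrow> ('g \<Rightarrow> 'j \<Rightarrow> 'j \<Rightarrow> 'k) \<Rightarrow> ('j \<Rightarrow> 'k) set \<Rightarrow> ('j \<Rightarrow> 'k) set \<Rightarrow> bool" where
  "iso_sec C I1 \<rho>1 U1 W1 I2 \<rho>2 U2 W2 \<longleftrightarrow> (\<exists>f.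
     (\<forall>x\<in>U1. \<forall>y\<in>U1. f (vadd x y) = vadd (f x) (f y)) \<and>
     (\<forall>c. \<forall>x\<in>U1. f (vsmul c x) = vsmul c (f x)) \<and>
     f ` U1 \<subseteq> U2 \<and>
     (\<forall>x\<in>U1. f x \<in> W2 \<longleftrightarrow> x \<in> W1) \<and>
     (\<forall>y\<in>U2. \<exists>x\<in>U1. vsub y (f x) \<in> W2) \<and>
     (\<forall>g\<in>C. \<forall>x\<in>U1. vsub (f (mact I1 \<rho>1 g x)) (mact I2 \<rho>2 g (f x)) \<in> W2))"

definition iso_mod :: "'g set \<Rightarrow> 'i set \<Rightarrow> ('g \<Rightarrow> 'i \<Rightarrow> 'i \<Rightarrow> 'k::field) \<Rightarrow> 'j set \<Rightarrow> ('g \<Rightarrow> 'j \<Rightarrow> 'j \<Rightarrow> 'k) \<Rightarrow> bool" where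
  "iso_mod C I1 \<rho>1 I2 \<rho>2 \<longleftrightarrow> iso_sec C I1 \<rho>1 (vsp I1) {vzero} I2 \<rho>2 (vsp I2) {vzero}"

definition comp_series :: "'g set \<Rightarrow> ('g \<Rightarrow> 'g \<Rightarrow> 'g) \<Rightarrow> 'g \<Rightarrow> 'i set \<Rightarrow> ('g \<Rightarrow> 'i \<Rightarrow> 'i \<Rightarrow> 'k::field)
    \<Rightarrow> ('i \<Rightarrow> 'k) set \<Rightarrow> ('i \<Rightarrow> 'k) set \<Rightarrow> ('i \<Rightarrow> 'k) set list \<Rightarrow> bool" where
  "comp_series C mul u I \<rho> U W Ws \<longleftrightarrow> Ws \<noteq> [] \<and> hd Ws = W \<and> last Ws = U \<and>
     section_ok C mul u I \<rho> U W \<and>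
     (\<forall>i. Suc i < length Ws \<longrightarrow> simple_sec C mul u I \<rho> (Ws ! Suc i) (Ws ! i))"

definition has_mult :: "'g set \<Rightarrow> ('g \<Rightarrow> 'g \<Rightarrow> 'g) \<Rightarrow> 'g \<Rightarrow> 'i set \<Rightarrow> ('g \<Rightarrow> 'i \<Rightarrow> 'i \<Rightarrow> 'k::field)
    \<Rightarrow> ('i \<Rightarrow> 'k) set \<Rightarrow> ('i \<Rightarrow> 'k) set \<Rightarrow> 'j set \<Rightarrow> ('g \<Rightarrow> 'j \<Rightarrow> 'j \<Rightarrow> 'k) \<Rightarrow> nat \<Rightarrow> bool" where
  "has_mult C mul u I \<rho> U W J \<sigma> m \<longleftrightarrow>
     (\<exists>Ws. comp_series C mul u I \<rho> U W Ws) \<and>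
     (\<forall>Ws. comp_series C mul u I \<rho> U W Ws \<longrightarrow>
        card {i. Suc i < length Ws \<and> iso_sec C I \<rho> (Ws ! Suc i) (Ws ! i) J \<sigma> (vsp J) {vzero}} = m)"

section \<open>Ext^1 between kM-modules (Yoneda extensions 0 \<rightarrow> T \<rightarrow> E \<rightarrow> S \<rightarrow> 0 as cocycles modulo coboundaries)\<close>

text \<open>An extension of S = (I, rhoS) by T = (J, rhoT) is k^J \<oplus> k^I with m acting by the block
  matrix [[rhoT m, c m], [0, rhoS m]]; this is a kM-module iff c is a cocycle, and the extension
  is split iff c is a coboundary.\<close>
definition cocycles :: "'i set \<Rightarrow> ('m::monoid_mult \<Rightarrow> 'i \<Rightarrow> 'i \<Rightarrow> 'k::field) \<Rightarrow> 'j set \<Rightarrow> ('m \<Rightarrow> 'j \<Rightarrow> 'j \<Rightarrow> 'k)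
    \<Rightarrow> ('m \<times> 'j \<times> 'i \<Rightarrow> 'k) set" where
  "cocycles I \<rho>S J \<rho>T = {c. (\<forall>m t s. t \<notin> J \<or> s \<notin> I \<longrightarrow> c (m, t, s) = 0) \<and>
     (\<forall>m n. \<forall>t\<in>J. \<forall>s\<in>I. c (m * n, t, s) =
         (\<Sum>t'\<in>J. \<rho>T m t t' * c (n, t', s)) + (\<Sum>s'\<in>I. c (m, t, s') * \<rho>S n s' s))}"

definition coboundaries :: "'i set \<Rightarrow> ('m::monoid_mult \<Rightarrow> 'i \<Rightarrow> 'i \<Rightarrow> 'k::field) \<Rightarrow> 'j set \<Rightarrow> ('m \<Rightarrow> 'j \<Rightarrow> 'j \<Rightarrow> 'k)
    \<Rightarrow> ('m \<times> 'j \<times> 'i \<Rightarrow> 'k) set" where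
  "coboundaries I \<rho>S J \<rho>T = {c. \<exists>X :: 'j \<Rightarrow> 'i \<Rightarrow> 'k. c = (\<lambda>(m, t, s).
      if t \<in> J \<and> s \<in> I then (\<Sum>t'\<in>J. \<rho>T m t t' * X t' s) - (\<Sum>s'\<in>I. X t s' * \<rho>S m s' s) else 0)}"

definition ext1_dim :: "'i set \<Rightarrow> ('m::monoid_mult \<Rightarrow> 'i \<Rightarrow> 'i \<Rightarrow> 'k::field) \<Rightarrow> 'j set \<Rightarrow> ('m \<Rightarrow> 'j \<Rightarrow> 'j \<Rightarrow> 'k) \<Rightarrow> nat" where
  "ext1_dim I \<rho>S J \<rho>T = qdim (cocycles I \<rho>S J \<rho>T) (coboundaries I \<rho>S J \<rho>T)"

definition conv :: "('m::{monoid_mult,finite} \<Rightarrow> 'k::field) \<Rightarrow> ('m \<Rightarrow> 'k) \<Rightarrow> ('m \<Rightarrow> 'k)" where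
  "conv a b = (\<lambda>z. \<Sum>p\<in>{(x, y). x * y = z}. a (fst p) * b (snd p))"

definition alg_one :: "'m::monoid_mult \<Rightarrow> 'k::field" where
  "alg_one = delta 1"

definition jrad :: "('m::{monoid_mult,finite} \<Rightarrow> 'k::field) set" where
  "jrad = {a. \<forall>x. \<exists>y. conv y (vsub alg_one (conv x a)) = alg_one}"

text \<open>kM / rad(kM) is isomorphic to a product of full matrix algebras M_{n_i}(k), i < r:
  there is a surjective unital algebra map onto the product with kernel rad(kM).\<close>
definition splitting_field :: "'m::{monoid_mult,finite} itself \<Rightarrow> 'k::field itself \<Rightarrow> bool" where
  "splitting_field _ _ \<longleftrightarrow> (\<exists>(r::nat) (n::nat \<Rightarrow> nat) (\<phi>::('m \<Rightarrow> 'k) \<Rightarrow> nat \<Rightarrow> nat \<Rightarrow> nat \<Rightarrow> 'k).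
     (\<forall>i<r. n i > 0) \<and>
     (\<forall>a b. \<forall>i<r. \<forall>p<n i. \<forall>q<n i. \<phi> (vadd a b) i p q = \<phi> a i p q + \<phi> b i p q) \<and>
     (\<forall>c a. \<forall>i<r. \<forall>p<n i. \<forall>q<n i. \<phi> (vsmul c a) i p q = c * \<phi> a i p q) \<and>
     (\<forall>a b. \<forall>i<r. \<forall>p<n i. \<forall>q<n i. \<phi> (conv a b) i p q = (\<Sum>l<n i. \<phi> a i p l * \<phi> b i l q)) \<and>
     (\<forall>i<r. \<forall>p<n i. \<forall>q<n i. \<phi> alg_one i p q = (if p = q then 1 else 0)) \<and>
     (\<forall>B::nat \<Rightarrow> nat \<Rightarrow> nat \<Rightarrow> 'k. \<exists>a. \<forall>i<r. \<forall>p<n i. \<forall>q<n i. \<phi> a i p q = B i p q) \<and>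
     (\<forall>a. a \<in> jrad \<longleftrightarrow> (\<forall>i<r. \<forall>p<n i. \<forall>q<n i. \<phi> a i p q = 0)))"

text \<open>A kG_e-module regarded as a kM-module via rho_X (X = MeM).\<close>
definition infl :: "'m::monoid_mult \<Rightarrow> ('m \<Rightarrow> 'i \<Rightarrow> 'i \<Rightarrow> 'k::field) \<Rightarrow> ('m \<Rightarrow> 'i \<Rightarrow> 'i \<Rightarrow> 'k)" where
  "infl e \<rho> = (\<lambda>m i j. if ideal_of e \<subseteq> sigma m then \<rho> (e * m * e) i j else 0)"

definition GG :: "'m::monoid_mult \<Rightarrow> 'm \<Rightarrow> ('m \<times> 'm) set" where
  "GG f e = Gunits f \<times> Gunits e"

definition pmul :: "'m::monoid_mult \<times> 'm \<Rightarrow> 'm \<times> 'm \<Rightarrow> 'm \<times> 'm" where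
  "pmul p q = (fst p * fst q, snd p * snd q)"

text \<open>G_Y x G_X acting on k[e_Y M e_X] by (g,h)[a] = [g a h^{-1}].\<close>
definition prep :: "'m::monoid_mult \<Rightarrow> 'm \<times> 'm \<Rightarrow> 'm \<Rightarrow> 'm \<Rightarrow> 'k::field" where
  "prep e gh a b = (if a = fst gh * b * ginv e (snd gh) then 1 else 0)"

text \<open>V \<otimes>_k U^* as a k[G_Y x G_X]-module.\<close>
definition tens :: "'m::monoid_mult \<Rightarrow> ('m \<Rightarrow> 'v \<Rightarrow> 'v \<Rightarrow> 'k::field) \<Rightarrow> ('m \<Rightarrow> 'u \<Rightarrow> 'u \<Rightarrow> 'k)
    \<Rightarrow> 'm \<times> 'm \<Rightarrow> 'v \<times> 'u \<Rightarrow> 'v \<times> 'u \<Rightarrow> 'k" where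
  "tens e \<rho>V \<rho>U gh x y = \<rho>V (fst gh) (fst x) (fst y) * \<rho>U (ginv e (snd gh)) (snd y) (snd x)"

definition eqcl :: "'a set \<Rightarrow> ('a \<times> 'a) set \<Rightarrow> ('a \<times> 'a) set" where
  "eqcl A R = (Id_on A \<union> R \<union> R\<inverse>)\<^sup>*"

text \<open>Case (i): X, Y incomparable. Returns (U, W) with V_{X,Y} = U/W inside k^{e_Y M e_X}.\<close>
definition Vinc :: "'m::monoid_mult \<Rightarrow> 'm \<Rightarrow> ('m \<Rightarrow> 'k::field) set \<times> ('m \<Rightarrow> 'k) set" where
  "Vinc e f = (let X = ideal_of e; Y = ideal_of f; I = corner f e in
     (vsp I,
      lspan ({delta z | z. z \<in> I \<inter> setmul (nabla Y) (nabla X)} \<union>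
             {(\<lambda>x. delta (f*m*n*e) x + delta (f*m*f*e*n*e) x - delta (f*m*f*n*e) x - delta (f*m*e*n*e) x)
               | m n. True})))"

definition Vdiag :: "'m::monoid_mult \<Rightarrow> ('m \<Rightarrow> 'k::field) set \<times> ('m \<Rightarrow> 'k) set" where
  "Vdiag e = (let X = ideal_of e; IX = corner e e - Gunits e;
      NN = setmul (nabla X) (nabla X) \<inter> IX;
      R = eqcl IX (({(e*m*n*e, e*m*e*n*e) | m n. \<not> X \<subseteq> sigma (m * n)} \<inter> (IX \<times> IX)) \<union> (NN \<times> NN)) in
     ({v. \<forall>a. a \<notin> IX \<longrightarrow> v a = 0},
      lspan ({delta z | z. z \<in> NN} \<union> {vsub (delta a) (delta b) | a b. (a, b) \<in> R})))"

text \<open>The subspace Z of k[e_Y M e_X] (so W_{X,Y} = k[e_Y M e_X]/Z) for a generating relation R.\<close>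
definition Zsp :: "'m::monoid_mult \<Rightarrow> 'm \<Rightarrow> ('m \<times> 'm) set \<Rightarrow> ('m \<Rightarrow> 'k::field) set" where
  "Zsp e f R = (let I = corner f e; NN = setmul (nabla (ideal_of f)) (nabla (ideal_of e)) \<inter> I;
      S = eqcl I (R \<union> (NN \<times> NN)) in
     lspan ({delta z | z. z \<in> NN} \<union> {vsub (delta a) (delta b) | a b. (a, b) \<in> S}))"

text \<open>Case (iii): X < Y, e = e_X < f = e_Y. V_{X,Y} = kernel of W_{X,Y} \<rightarrow> kG_X, [a] \<mapsto> rho_X(a).\<close>
definition Vlt :: "'m::monoid_mult \<Rightarrow> 'm \<Rightarrow> ('m \<Rightarrow> 'k::field) set \<times> ('m \<Rightarrow> 'k) set" where
  "Vlt e f = (let X = ideal_of e; Y = ideal_of f; I = corner f e;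
      R = {(f*m*n*e, f*m*f*n*e) | m n. True} \<union> {(f*m*n*e, f*m*e*n*e) | m n. \<not> Y \<subseteq> sigma m} in
     ({v \<in> vsp I. \<forall>g\<in>Gunits e. (\<Sum>a\<in>{a \<in> I. X \<subseteq> sigma a \<and> e * a * e = g}. v a) = 0},
      Zsp e f R))"

text \<open>Case (iv): Y < X, f = e_Y < e = e_X. V_{X,Y} = kernel of W_{X,Y} \<rightarrow> kG_Y, [a] \<mapsto> rho_Y(a).\<close>
definition Vgt :: "'m::monoid_mult \<Rightarrow> 'm \<Rightarrow> ('m \<Rightarrow> 'k::field) set \<times> ('m \<Rightarrow> 'k) set" where
  "Vgt e f = (let X = ideal_of e; Y = ideal_of f; I = corner f e;
      R = {(f*m*n*e, f*m*e*n*e) | m n. True} \<union> {(f*m*n*e, f*m*f*n*e) | m n. \<not> X \<subseteq> sigma n} in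
     ({v \<in> vsp I. \<forall>g\<in>Gunits f. (\<Sum>a\<in>{a \<in> I. Y \<subseteq> sigma a \<and> f * a * f = g}. v a) = 0},
      Zsp e f R))"

text \<open>V_{X,Y} for X = MeM, Y = MfM (e = e_X, f = e_Y), as a pair (U, W) with V_{X,Y} = U/W.\<close>
definition VXY :: "'m::monoid_mult \<Rightarrow> 'm \<Rightarrow> ('m \<Rightarrow> 'k::field) set \<times> ('m \<Rightarrow> 'k) set" where
  "VXY e f = (if ideal_of e = ideal_of f then Vdiag e
              else if ideal_of e \<subset> ideal_of f then Vlt e f
              else if ideal_of f \<subset> ideal_of e then Vgt e f
              else Vinc e f)"

end

(*
  An extension of U by V is a cocycle on M with values in the M-bimodule Hom(U, V), where M acts
  through rho_X and rho_Y; it is split iff the cocycle is a coboundary. The identity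
  c(m) = c(fme) - m c(e) - c(f) m, with e = e_X and f = e_Y, shows that a cocycle is determined
  modulo coboundaries by its restriction to fMe. This restriction, extended linearly and restricted
  to the subspace U_0 with V_{X,Y} = U_0/W_0, is (G_Y x G_X)-equivariant, kills W_0, and vanishes
  exactly when c is a coboundary; conversely each equivariant map killing W_0 arises in this way.
  Hence Ext^1(U, V) is isomorphic to the space of (G_Y x G_X)-maps from V_{X,Y} to Hom(U, V).
  By Maschke's theorem and Schur's lemma its dimension is the multiplicity of V tensor U^*, which is
  absolutely simple because kM, and hence each kG_X, acts on its simple modules by full matrix algebras.
*)
theory Submission
  imports Defs "HOL-Library.Function_Algebras" "HOL.Vector_Spaces"
begin

section \<open>Quotient dimensions\<close>

text \<open>The obstacle is to compare functions on M with maps defined on a subquotient. Both are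
  placed in one function space: a cocycle and a linear map on k[fMe] are functions on pairs from M
  and the index set of Hom(U, V), and equivariance is imposed on U_0 only. Restriction to U_0 is
  then the quotient by the maps that vanish on U_0, the coboundaries are the cocycles in that
  subspace, and the comparison is the second isomorphism theorem for \<open>qdim\<close>. The
  subspace U_0 is needed because a coboundary m |-> m x - x m need not vanish on fMe; on U_0 both of
  its terms do. Surjectivity needs an explicit cocycle; its formula is what the identity for c
  leaves once the class is normalised by c(e) = 0 (X, Y incomparable, or X < Y), by c(f) = 0 (Y <
  X), or by c = 0 on M_X (X = Y). Rectangularity acts through emne = (eme)(ene) on M_X, which makes
  \<rho>_X multiplicative. The characteristic matters twice: for Maschke averaging, and to remove a
  cocycle on G_X when X = Y.\<close>

lemma vadd_eq: "vadd v w = v + w" and vsub_eq: "vsub v w = v - w" and vzero_eq: "vzero = 0"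
  by (auto simp: vadd_def vsub_def vzero_def fun_eq_iff)

interpretation fv: vector_space "vsmul :: 'k::field \<Rightarrow> ('i \<Rightarrow> 'k) \<Rightarrow> ('i \<Rightarrow> 'k)"
  by unfold_locales (auto simp: vsmul_def fun_eq_iff algebra_simps)

interpretation fvp: vector_space_pair "vsmul :: 'k::field \<Rightarrow> ('i \<Rightarrow> 'k) \<Rightarrow> ('i \<Rightarrow> 'k)" "vsmul :: 'k::field \<Rightarrow> ('j \<Rightarrow> 'k) \<Rightarrow> ('j \<Rightarrow> 'k)"
  by unfold_locales

abbreviation flin :: "(('i \<Rightarrow> 'k::field) \<Rightarrow> ('j \<Rightarrow> 'k)) \<Rightarrow> bool" where
  "flin \<equiv> Vector_Spaces.linear vsmul vsmul"

lemma sum_fun_apply: "(\<Sum>a\<in>A. f a) x = (\<Sum>a\<in>A. f a x)"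
  by (induction A rule: infinite_finite_induct) auto

lemma vsmul_apply [simp]: "vsmul c v i = c * v i"
  by (simp add: vsmul_def)

lemma add_diff_add_eq: "a + b - (c + d) = (a - c) + (b - (d::'a::ab_group_add))"
  by simp

lemma flinI:
  assumes "\<And>x y. f (x + y) = f x + f y" "\<And>c x. f (vsmul c x) = vsmul c (f x)"
  shows "flin f"
  using assms by unfold_locales auto

lemma lspan_eq_span: "lspan S = fv.span S"
proof -
  have "(\<lambda>x. \<Sum>b\<in>B. c b * b x) = (\<Sum>b\<in>B. vsmul (c b) b)" for B :: "('a \<Rightarrow> 'b) set" and c
    by (rule ext) (simp add: sum_fun_apply)
  then show ?thesis unfolding lspan_def fv.span_explicit by auto
qed

lemma lsubspace_iff: "lsubspace I S \<longleftrightarrow> S \<subseteq> vsp I \<and> fv.subspace S"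
  by (auto simp: lsubspace_def fv.subspace_def vadd_eq vzero_eq)

lemma subspace_vsp: "fv.subspace (vsp I)"
  by (auto simp: fv.subspace_def vsp_def)

lemma vsp_expand:
  assumes "finite I" "v \<in> vsp I" shows "v = (\<Sum>i\<in>I. vsmul (v i) (delta i))"
proof
  fix x
  have "(\<Sum>i\<in>I. vsmul (v i) (delta i) x) = (\<Sum>i\<in>I. if i = x then v i else 0)"
    by (rule sum.cong) (auto simp: delta_def)
  then show "v x = (\<Sum>i\<in>I. vsmul (v i) (delta i)) x"
    using assms by (auto simp: sum_fun_apply vsp_def)
qed

text \<open>A lift to \<open>Z\<close> of a basis of \<open>Z/B\<close>. As \<open>qdim\<close> is
  only a least size of a spanning set, its value is certified by exhibiting such a family.\<close>

definition qbasis :: "('i \<Rightarrow> 'k::field) set \<Rightarrow> ('i \<Rightarrow> 'k) set \<Rightarrow> ('i \<Rightarrow> 'k) set \<Rightarrow> bool" where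
  "qbasis Z B C \<longleftrightarrow> finite C \<and> C \<subseteq> Z \<and>
     (\<forall>c. (\<Sum>b\<in>C. vsmul (c b) b) \<in> B \<longrightarrow> (\<forall>b\<in>C. c b = 0)) \<and> (\<forall>z\<in>Z. \<exists>b\<in>B. z - b \<in> fv.span C)"

lemma qbasis_refl: "fv.subspace B \<Longrightarrow> qbasis B B {}"
  unfolding qbasis_def by auto

text \<open>\<open>Z/Z'\<close> is a line spanned by \<open>z0\<close>, so a basis of
  \<open>Z'/D\<close> grows by exactly one vector. This is the contribution of one composition
  factor.\<close>

lemma qbasis_step:
  assumes q: "qbasis Z' D C" and s: "fv.subspace Z'" and sub: "Z' \<subseteq> Z" "D \<subseteq> Z'"
    and z0: "z0 \<in> Z" "z0 \<notin> Z'" and ex: "\<And>z. z \<in> Z \<Longrightarrow> \<exists>l. z - vsmul l z0 \<in> Z'"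
  shows "qbasis Z D (insert z0 C)" "z0 \<notin> C"
proof -
  from q have C: "finite C" "C \<subseteq> Z'" by (auto simp: qbasis_def)
  show n: "z0 \<notin> C" using C z0 by auto
  have ind: "\<forall>b\<in>insert z0 C. c b = 0" if h: "(\<Sum>b\<in>insert z0 C. vsmul (c b) b) \<in> D" for c
  proof -
    have S: "(\<Sum>b\<in>C. vsmul (c b) b) \<in> Z'"
      using C s by (intro fv.subspace_sum) (auto intro: fv.subspace_scale)
    have e: "(\<Sum>b\<in>insert z0 C. vsmul (c b) b) = vsmul (c z0) z0 + (\<Sum>b\<in>C. vsmul (c b) b)"
      using C n by simp
    have z: "vsmul (c z0) z0 \<in> Z'" using fv.subspace_diff[OF s _ S, of "vsmul (c z0) z0 + (\<Sum>b\<in>C. vsmul (c b) b)"] h e sub by auto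
    have "c z0 = 0"
    proof (rule ccontr)
      assume "c z0 \<noteq> 0"
      then have "z0 = vsmul (inverse (c z0)) (vsmul (c z0) z0)" by simp
      then show False using z0 fv.subspace_scale[OF s z] by metis
    qed
    then show ?thesis using h e q by (auto simp: qbasis_def)
  qed
  have sp: "\<exists>b\<in>D. z - b \<in> fv.span (insert z0 C)" if "z \<in> Z" for z
  proof -
    obtain l where "z - vsmul l z0 \<in> Z'" using ex[OF \<open>z \<in> Z\<close>] by blast
    then obtain b where b: "b \<in> D" "z - vsmul l z0 - b \<in> fv.span C" using q by (auto simp: qbasis_def)
    have "z - b = vsmul l z0 + (z - vsmul l z0 - b)" by simp
    also have "\<dots> \<in> fv.span (insert z0 C)"
    proof (rule fv.span_add)
      show "vsmul l z0 \<in> fv.span (insert z0 C)" by (intro fv.span_scale fv.span_base) simp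
      show "z - vsmul l z0 - b \<in> fv.span (insert z0 C)" using b fv.span_mono[of C "insert z0 C"] by blast
    qed
    finally show ?thesis using b by auto
  qed
  show "qbasis Z D (insert z0 C)" unfolding qbasis_def using C sub z0 ind sp by auto
qed

text \<open>A competing spanning set \<open>C'\<close> is compared with \<open>C\<close> by shifting
  each element of \<open>C\<close> by an element of \<open>B\<close> into the span of
  \<open>C'\<close>. Independence of \<open>C\<close> modulo \<open>B\<close> makes the shifted
  vectors independent, so the exchange bound applies.\<close>

lemma qbasis_qdim:
  assumes q: "qbasis Z B C" and s: "fv.subspace B"
  shows "qdim Z B = card C"
  unfolding qdim_def lspan_eq_span vsub_eq
proof (rule Least_equality)
  show "\<exists>C'. finite C' \<and> card C' = card C \<and> C' \<subseteq> Z \<and> (\<forall>z\<in>Z. \<exists>b\<in>B. z - b \<in> fv.span C')"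
    using q unfolding qbasis_def by blast
next
  fix n assume "\<exists>C'. finite C' \<and> card C' = n \<and> C' \<subseteq> Z \<and> (\<forall>z\<in>Z. \<exists>b\<in>B. z - b \<in> fv.span C')"
  then obtain C' where C': "finite C'" "card C' = n" "C' \<subseteq> Z" "\<And>z. z \<in> Z \<Longrightarrow> \<exists>b\<in>B. z - b \<in> fv.span C'" by blast
  from q have C: "finite C" "C \<subseteq> Z" and ind: "\<And>c. (\<Sum>b\<in>C. vsmul (c b) b) \<in> B \<Longrightarrow> (\<forall>b\<in>C. c b = 0)"
    unfolding qbasis_def by blast+
  have "\<forall>c\<in>C. \<exists>y. y \<in> B \<and> c - y \<in> fv.span C'" using C C'(4) by blast
  from bchoice[OF this] obtain b where b: "\<And>c. c \<in> C \<Longrightarrow> b c \<in> B" "\<And>c. c \<in> C \<Longrightarrow> c - b c \<in> fv.span C'" by blast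
  define s where "s c = c - b c" for c
  have zero: "\<forall>c\<in>C. r c = 0" if h: "(\<Sum>c\<in>C. vsmul (r c) (s c)) = 0" for r
  proof -
    have "(\<Sum>c\<in>C. vsmul (r c) (s c)) = (\<Sum>c\<in>C. vsmul (r c) c) - (\<Sum>c\<in>C. vsmul (r c) (b c))"
      unfolding s_def by (simp add: fv.scale_right_diff_distrib sum_subtractf)
    then have "(\<Sum>c\<in>C. vsmul (r c) c) = (\<Sum>c\<in>C. vsmul (r c) (b c))" using h by simp
    also have "\<dots> \<in> B" using b \<open>fv.subspace B\<close> by (intro fv.subspace_sum) (auto intro: fv.subspace_scale)
    finally show ?thesis by (rule ind)
  qed
  have inj: "inj_on s C"
  proof (rule inj_onI, rule ccontr)
    fix x y assume xy: "x \<in> C" "y \<in> C" "s x = s y" "x \<noteq> y"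
    \<comment> \<open>A coincidence \<open>s x = s y\<close> would be a relation with coefficients 1
      and -1.\<close>
    define r where "r c = (if c = x then 1 else if c = y then -1 else (0::'b))" for c
    have "(\<Sum>c\<in>C. vsmul (r c) (s c)) = (\<Sum>c\<in>{x,y}. vsmul (r c) (s c))"
      using xy C by (intro sum.mono_neutral_right) (auto simp: r_def)
    also have "\<dots> = 0" using xy by (simp add: r_def)
    finally have "r x = 0" using zero xy by blast
    then show False by (simp add: r_def)
  qed
  have indep: "fv.independent (s ` C)"
  proof (rule fv.independent_if_scalars_zero)
    show "finite (s ` C)" using C by simp
    fix f x assume h: "(\<Sum>x\<in>s ` C. vsmul (f x) x) = 0" and x: "x \<in> s ` C"
    have "(\<Sum>c\<in>C. vsmul (f (s c)) (s c)) = 0" using h inj by (simp add: sum.reindex)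
    from zero[OF this] show "f x = 0" using x by auto
  qed
  have "card (s ` C) \<le> card C'"
    using fv.independent_span_bound[OF C'(1) indep] b by (auto simp: s_def)
  then show "card C \<le> n" using C' card_image[OF inj] by simp
qed

text \<open>The second isomorphism theorem, with \<open>B\<close> the intersection of
  \<open>Z\<close> and \<open>B'\<close>, and \<open>Z'\<close> the sum of \<open>Z\<close> and
  \<open>B'\<close> up to elements of \<open>B'\<close>. Spanning sets are carried across in both
  directions instead of bases, so no finiteness of the quotients has to be known in advance.\<close>

lemma qdim_second_iso:
  assumes sub: "fv.subspace B'" and Z: "Z \<subseteq> Z'" and B: "\<And>z. z \<in> Z \<Longrightarrow> z \<in> B \<longleftrightarrow> z \<in> B'" and BZ: "B \<subseteq> Z"
    and ex: "\<And>z. z \<in> Z' \<Longrightarrow> \<exists>y\<in>Z. z - y \<in> B'" and subZ: "fv.subspace Z"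
  shows "qdim Z B = qdim Z' B'"
proof -
  let ?P = "\<lambda>Z B C. finite C \<and> C \<subseteq> Z \<and> (\<forall>z\<in>Z. \<exists>b\<in>B. z - b \<in> fv.span C)"
  have 1: "?P Z' B' C" if "?P Z B C" for C
  proof -
    have "\<exists>b\<in>B'. z - b \<in> fv.span C" if "z \<in> Z'" for z
    proof -
      obtain y where y: "y \<in> Z" "z - y \<in> B'" using ex[OF \<open>z \<in> Z'\<close>] by blast
      then obtain b where b: "b \<in> B" "y - b \<in> fv.span C" using \<open>?P Z B C\<close> by blast
      have "(z - y) + b \<in> B'" using y b B BZ sub by (auto intro: fv.subspace_add)
      moreover have "z - ((z - y) + b) \<in> fv.span C" using b(2) by simp
      ultimately show ?thesis by blast
    qed
    then show ?thesis using that Z by auto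
  qed
  have 2: "\<exists>D. ?P Z B D \<and> card D \<le> card C" if C: "?P Z' B' C" for C
  proof -
    \<comment> \<open>Each element of \<open>C\<close> is replaced by a representative in
      \<open>Z\<close> modulo \<open>B'\<close>. Representatives may coincide, hence only an
      inequality of cardinalities.\<close>
    have "\<forall>c\<in>C. \<exists>y. y \<in> Z \<and> c - y \<in> B'" using C ex by blast
    from bchoice[OF this] obtain h where h: "\<And>c. c \<in> C \<Longrightarrow> h c \<in> Z \<and> c - h c \<in> B'" by blast
    have sp: "\<exists>d\<in>fv.span (h ` C). x - d \<in> B'" if "x \<in> fv.span C" for x
      using that
    proof (induction rule: fv.span_induct_alt)
      case base
      have "0 - 0 \<in> B'" using fv.subspace_0[OF sub] by (simp only: diff_self)
      then show ?case using fv.span_zero by blast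
    next
      case (step c x y)
      then obtain d where d: "d \<in> fv.span (h ` C)" "y - d \<in> B'" by blast
      have "vsmul c (h x) \<in> fv.span (h ` C)" by (rule fv.span_scale[OF fv.span_base]) (use step in blast)
      then have 1: "vsmul c (h x) + d \<in> fv.span (h ` C)" using d(1) by (rule fv.span_add)
      have 2: "vsmul c x + y - (vsmul c (h x) + d) = vsmul c (x - h x) + (y - d)"
        unfolding fv.scale_right_diff_distrib by (rule add_diff_add_eq)
      have "vsmul c (x - h x) + (y - d) \<in> B'" using h[OF step(1)] d(2) fv.subspace_add[OF sub] fv.subspace_scale[OF sub] by blast
      with 1 2 show ?case by (intro bexI[of _ "vsmul c (h x) + d"]) (simp only:)
    qed
    have "\<exists>b\<in>B. z - b \<in> fv.span (h ` C)" if z: "z \<in> Z" for z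
    proof -
      obtain b where b: "b \<in> B'" "z - b \<in> fv.span C" using C Z z by blast
      then obtain d where d: "d \<in> fv.span (h ` C)" "z - b - d \<in> B'" using sp by blast
      have "d \<in> Z" using d(1) h subZ fv.span_minimal[of "h ` C" Z] by auto
      then have "z - d \<in> Z" using z subZ fv.subspace_diff by blast
      moreover have "z - d \<in> B'" using fv.subspace_add[OF sub d(2) b(1)] by (simp add: algebra_simps)
      ultimately have "z - d \<in> B" using B by blast
      then show ?thesis using d by (intro bexI[of _ "z - d"]) auto
    qed
    then have "?P Z B (h ` C)" using C h by auto
    moreover have "card (h ` C) \<le> card C" using C card_image_le by auto
    ultimately show ?thesis by blast
  qed
  let ?Q = "\<lambda>Z B n. \<exists>C. finite C \<and> card C = n \<and> C \<subseteq> Z \<and> (\<forall>z\<in>Z. \<exists>b\<in>B. z - b \<in> fv.span C)"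
  show ?thesis
  proof (cases "\<exists>n. ?Q Z B n")
    case True
    then have "\<exists>n. ?Q Z' B' n" using 1 by blast
    have a: "?Q Z B (Least (?Q Z B))" using True by (rule LeastI_ex)
    have b: "?Q Z' B' (Least (?Q Z' B'))" using \<open>\<exists>n. ?Q Z' B' n\<close> by (rule LeastI_ex)
    from a have "?Q Z' B' (Least (?Q Z B))" using 1 by blast
    then have l: "Least (?Q Z' B') \<le> Least (?Q Z B)" by (rule Least_le)
    from b obtain C' where C': "?P Z' B' C'" "card C' = Least (?Q Z' B')" by blast
    obtain D where D: "?P Z B D" "card D \<le> Least (?Q Z' B')" using 2[OF C'(1)] unfolding C'(2) by blast
    then have "Least (?Q Z B) \<le> card D" by (intro Least_le) blast
    then show ?thesis using l D unfolding qdim_def lspan_eq_span vsub_eq by linarith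
  next
    case False
    \<comment> \<open>Without finite spanning sets \<open>LEAST\<close> is unspecified, yet both
      predicates are identically false, hence equal, and so are the two values.\<close>
    have "\<not> ?Q Z' B' n" for n
    proof
      assume "?Q Z' B' n"
      then obtain C where "?P Z' B' C" by blast
      from 2[OF this] False show False by blast
    qed
    moreover have "\<not> ?Q Z B n" for n using False by blast
    ultimately have "?Q Z B = ?Q Z' B'" by (intro ext) (simp only:)
    then show ?thesis unfolding qdim_def lspan_eq_span vsub_eq by (rule arg_cong)
  qed
qed

section \<open>Equivariant maps and multiplicities\<close>

lemma mact_add: "mact I \<rho> g (v + w) = mact I \<rho> g v + mact I \<rho> g w"
  by (rule ext) (simp add: mact_def distrib_left sum.distrib)

lemma mact_scale: "mact I \<rho> g (vsmul c v) = vsmul c (mact I \<rho> g v)"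
  by (rule ext) (simp add: mact_def sum_distrib_left mult.left_commute)

lemma flin_mact: "flin (mact I \<rho> g)"
  by (rule flinI) (rule mact_add, rule mact_scale)

lemma mact_in_vsp: "mact I \<rho> g v \<in> vsp I"
  by (simp add: vsp_def mact_def)

lemma mact_mul:
  assumes r: "is_rep C mul u I \<rho>" and "g \<in> C" "h \<in> C"
  shows "mact I \<rho> (mul g h) v = mact I \<rho> g (mact I \<rho> h v)"
proof
  fix i
  show "mact I \<rho> (mul g h) v i = mact I \<rho> g (mact I \<rho> h v) i"
  proof (cases "i \<in> I")
    case True
    have "(\<Sum>j\<in>I. \<rho> (mul g h) i j * v j) = (\<Sum>j\<in>I. \<Sum>l\<in>I. \<rho> g i l * \<rho> h l j * v j)"
      using r assms True by (intro sum.cong) (auto simp: is_rep_def sum_distrib_right)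
    also have "\<dots> = (\<Sum>l\<in>I. \<rho> g i l * (\<Sum>j\<in>I. \<rho> h l j * v j))"
      by (subst sum.swap) (simp add: sum_distrib_left mult.assoc)
    finally show ?thesis using True by (simp add: mact_def)
  qed (simp add: mact_def)
qed

lemma mact_one:
  assumes r: "is_rep C mul u I \<rho>" and v: "v \<in> vsp I" shows "mact I \<rho> u v = v"
proof
  fix i
  have f: "finite I" using r by (simp add: is_rep_def)
  have "(\<Sum>j\<in>I. \<rho> u i j * v j) = (\<Sum>j\<in>I. if i = j then v j else 0)" if "i \<in> I"
    using r that by (intro sum.cong) (auto simp: is_rep_def)
  then show "mact I \<rho> u v i = v i" using v f by (auto simp: mact_def vsp_def)
qed

text \<open>A linear map is stored as a matrix on pairs, so that maps form a function space to which
  \<open>qdim\<close> applies and which can share the type of the cocycles.\<close>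

definition app :: "'i set \<Rightarrow> ('i \<times> 'j \<Rightarrow> 'k::field) \<Rightarrow> ('i \<Rightarrow> 'k) \<Rightarrow> 'j \<Rightarrow> 'k" where
  "app I \<theta> v = (\<lambda>j. \<Sum>a\<in>I. v a * \<theta> (a, j))"

text \<open>Equivariance is only required on \<open>U\<close>, so \<open>Hm C I \<rho> J \<sigma> U U\<close> is the space of all maps that vanish on
  \<open>U\<close>, and \<open>Hm C I \<rho> J \<sigma> U A\<close> modulo this space is \<open>Hom(U/A, k^J)\<close>.\<close>

definition Hm :: "'g set \<Rightarrow> 'i set \<Rightarrow> ('g \<Rightarrow> 'i \<Rightarrow> 'i \<Rightarrow> 'k::field) \<Rightarrow> 'j set \<Rightarrow> ('g \<Rightarrow> 'j \<Rightarrow> 'j \<Rightarrow> 'k)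
    \<Rightarrow> ('i \<Rightarrow> 'k) set \<Rightarrow> ('i \<Rightarrow> 'k) set \<Rightarrow> ('i \<times> 'j \<Rightarrow> 'k) set" where
  "Hm C I \<rho> J \<sigma> U A = {\<theta>. (\<forall>a j. j \<notin> J \<longrightarrow> \<theta> (a, j) = 0) \<and>
     (\<forall>g\<in>C. \<forall>v\<in>U. app I \<theta> (mact I \<rho> g v) = mact J \<sigma> g (app I \<theta> v)) \<and> (\<forall>v\<in>A. app I \<theta> v = 0)}"

lemma app_add: "app I \<theta> (v + w) = app I \<theta> v + app I \<theta> w"
  by (rule ext) (simp add: app_def distrib_right sum.distrib)

lemma app_scale: "app I \<theta> (vsmul c v) = vsmul c (app I \<theta> v)"
  by (rule ext) (simp add: app_def sum_distrib_left mult.assoc)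

lemma app_diff: "app I \<theta> (v - w) = app I \<theta> v - app I \<theta> w"
  by (rule ext) (simp add: app_def left_diff_distrib sum_subtractf)

lemma app_zero: "app I \<theta> 0 = 0"
  by (rule ext) (simp add: app_def)

lemma app_add_left: "app I (\<theta> + \<eta>) v = app I \<theta> v + app I \<eta> v"
  by (rule ext) (simp add: app_def distrib_left sum.distrib)

lemma app_diff_left: "app I (\<theta> - \<eta>) v = app I \<theta> v - app I \<eta> v"
  by (rule ext) (simp add: app_def right_diff_distrib sum_subtractf)

lemma app_scale_left: "app I (vsmul c \<theta>) v = vsmul c (app I \<theta> v)"
  by (rule ext) (simp add: app_def sum_distrib_left mult.left_commute)

lemma flin_app: "flin (app I \<theta>)"
  by (rule flinI) (rule app_add, rule app_scale)

lemma app_in_vsp: "(\<And>a j. j \<notin> J \<Longrightarrow> \<theta> (a, j) = 0) \<Longrightarrow> app I \<theta> v \<in> vsp J"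
  by (simp add: vsp_def app_def)

lemma mact_diff: "mact I \<rho> g (v - w) = mact I \<rho> g v - mact I \<rho> g w"
  by (rule ext) (simp add: mact_def right_diff_distrib sum_subtractf)

lemma mact_zero: "mact I \<rho> g 0 = 0"
  by (rule ext) (simp add: mact_def)

lemma subspace_Hm: "fv.subspace (Hm C I \<rho> J \<sigma> U A)"
  unfolding fv.subspace_def Hm_def
  by (auto simp: app_add_left app_scale_left mact_add mact_scale) (auto simp: fun_eq_iff app_def mact_def)

lemma Hm_mono: "A \<subseteq> B \<Longrightarrow> Hm C I \<rho> J \<sigma> U B \<subseteq> Hm C I \<rho> J \<sigma> U A"
  unfolding Hm_def by auto

lemma app_delta:
  assumes "finite I" "flin F" "\<And>a. a \<in> I \<Longrightarrow> F (delta a) \<in> vsp J" "v \<in> vsp I"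
  shows "app I (\<lambda>(a, j). if j \<in> J then F (delta a) j else 0) v = F v"
proof
  fix j
  interpret F: Vector_Spaces.linear vsmul vsmul F by (rule assms(2))
  have F: "F v = (\<Sum>a\<in>I. vsmul (v a) (F (delta a)))"
    by (subst vsp_expand[OF assms(1,4)]) (simp only: F.sum F.scale)
  show "app I (\<lambda>(a, j). if j \<in> J then F (delta a) j else 0) v j = F v j"
    unfolding F using assms(3) by (auto simp: app_def sum_fun_apply vsp_def intro!: sum.cong)
qed

text \<open>A map between subquotients is an arbitrary function outside \<open>U\<close>.
  Prescribing a linear map on a basis of \<open>U\<close> repairs this without changing the values
  on \<open>U\<close>.\<close>

lemma linear_extend_from_subspace:
  assumes U: "fv.subspace U"
    and f: "\<And>x y. x \<in> U \<Longrightarrow> y \<in> U \<Longrightarrow> f (x + y) = f x + f y" "\<And>c x. x \<in> U \<Longrightarrow> f (vsmul c x) = vsmul c (f x)"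
  obtains F where "flin F" "\<And>x. x \<in> U \<Longrightarrow> F x = f x"
proof -
  obtain B where B: "B \<subseteq> U" "fv.independent B" "U \<subseteq> fv.span B"
    using fv.maximal_independent_subset[of U] by blast
  obtain F where F: "flin F" "\<And>x. x \<in> B \<Longrightarrow> F x = f x"
    using fvp.linear_independent_extend[OF B(2), of f] by blast
  interpret F: Vector_Spaces.linear vsmul vsmul F by (rule F(1))
  have f0: "f 0 = 0" using f(1)[of 0 0] fv.subspace_0[OF U] by (metis add.right_neutral add_cancel_right_right)
  have "x \<in> U \<and> F x = f x" if "x \<in> fv.span B" for x
    using that
  proof (induction rule: fv.span_induct_alt)
    case base
    have "F 0 = f 0" using f0 F.zero by (rule trans[OF _ sym, rotated])
    then show ?case using fv.subspace_0[OF U] by blast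
  next
    case (step c x y)
    have x: "x \<in> U" using B step by blast
    then have "F (vsmul c x + y) = f (vsmul c x + y)"
      using F(2)[OF step(1)] step f fv.subspace_scale[OF U] by (metis F.add F.scale)
    then show ?case using x step fv.subspace_add[OF U] fv.subspace_scale[OF U] by blast
  qed
  then show thesis using that F(1) B(3) by blast
qed

section \<open>Finite groups on a carrier set, and Maschke averaging\<close>

locale fin_group =
  fixes C :: "'g set" and mul :: "'g \<Rightarrow> 'g \<Rightarrow> 'g" and u :: 'g and inv :: "'g \<Rightarrow> 'g"
  assumes fin: "finite C" and u: "u \<in> C" and mul: "g \<in> C \<Longrightarrow> h \<in> C \<Longrightarrow> mul g h \<in> C"
    and inv: "g \<in> C \<Longrightarrow> inv g \<in> C"
    and assoc: "g \<in> C \<Longrightarrow> h \<in> C \<Longrightarrow> k \<in> C \<Longrightarrow> mul (mul g h) k = mul g (mul h k)"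
    and unit: "g \<in> C \<Longrightarrow> mul u g = g" "g \<in> C \<Longrightarrow> mul g u = g"
    and inv_mul: "g \<in> C \<Longrightarrow> mul (inv g) g = u" "g \<in> C \<Longrightarrow> mul g (inv g) = u"
begin

lemma inv_unique: "g \<in> C \<Longrightarrow> h \<in> C \<Longrightarrow> mul h g = u \<Longrightarrow> inv g = h"
  by (metis assoc inv inv_mul unit)

lemma inv_inv: "g \<in> C \<Longrightarrow> inv (inv g) = g"
  by (rule inv_unique) (auto simp: inv inv_mul)

lemma bij_right: assumes h: "h \<in> C" shows "bij_betw (\<lambda>g. mul g h) C C"
proof (rule bij_betw_byWitness[where f' = "\<lambda>g. mul g (inv h)"])
  show "\<forall>g\<in>C. mul (mul g h) (inv h) = g" "\<forall>g\<in>C. mul (mul g (inv h)) h = g"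
    using h by (auto simp: assoc inv inv_mul unit)
qed (use h in \<open>auto simp: mul inv\<close>)

lemma bij_inv: "bij_betw inv C C"
  by (rule bij_betw_byWitness[where f' = inv]) (auto simp: inv inv_inv)

text \<open>Maschke's argument: extend \<open>f\<close> to any linear map and average its conjugates
  under the group. The average is equivariant on the whole space and still equals \<open>f\<close>
  on \<open>U\<close>, where every conjugate already agrees with \<open>f\<close>.\<close>

lemma averaged_map:
  fixes \<rho> :: "'g \<Rightarrow> 'i \<Rightarrow> 'i \<Rightarrow> 'k::field" and \<sigma> :: "'g \<Rightarrow> 'j \<Rightarrow> 'j \<Rightarrow> 'k"
  assumes \<rho>: "is_rep C mul u I \<rho>" and \<sigma>: "is_rep C mul u J \<sigma>"
    and card: "(of_nat (card C) :: 'k) \<noteq> 0"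
    and U: "lsubspace I U" "invariant C I \<rho> U"
    and f: "\<And>x y. x \<in> U \<Longrightarrow> y \<in> U \<Longrightarrow> f (x + y) = f x + f y" "\<And>c x. x \<in> U \<Longrightarrow> f (vsmul c x) = vsmul c (f x)"
    and fJ: "f ` U \<subseteq> vsp J"
    and eq: "\<And>g x. g \<in> C \<Longrightarrow> x \<in> U \<Longrightarrow> f (mact I \<rho> g x) = mact J \<sigma> g (f x)"
  obtains \<theta> :: "'i \<times> 'j \<Rightarrow> 'k" where
    "\<And>a j. j \<notin> J \<Longrightarrow> \<theta> (a, j) = 0" "\<And>x. x \<in> U \<Longrightarrow> app I \<theta> x = f x"
    "\<And>g v. g \<in> C \<Longrightarrow> v \<in> vsp I \<Longrightarrow> app I \<theta> (mact I \<rho> g v) = mact J \<sigma> g (app I \<theta> v)"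
proof -
  have finI: "finite I" using \<rho> by (simp add: is_rep_def)
  have UI: "U \<subseteq> vsp I" and sU: "fv.subspace U" using U by (auto simp: lsubspace_iff)
  obtain F0 where F0: "flin F0" "\<And>x. x \<in> U \<Longrightarrow> F0 x = f x"
    using linear_extend_from_subspace[OF sU f] by blast
  interpret F0: Vector_Spaces.linear vsmul vsmul F0 by (rule F0(1))
  define F where "F v = vsmul (inverse (of_nat (card C))) (\<Sum>g\<in>C. mact J \<sigma> (inv g) (F0 (mact I \<rho> g v)))" for v
  have linF: "flin F"
    by (rule flinI) (simp_all only: F_def mact_add mact_scale F0.add F0.scale sum.distrib fv.scale_right_distrib
        fv.scale_sum_right[symmetric] fv.scale_left_commute)
  have FJ: "F v \<in> vsp J" for v
    unfolding F_def by (intro fv.subspace_scale[OF subspace_vsp] fv.subspace_sum[OF subspace_vsp] mact_in_vsp)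
  have FU: "F x = f x" if x: "x \<in> U" for x
  proof -
    have "mact J \<sigma> (inv g) (F0 (mact I \<rho> g x)) = f x" if g: "g \<in> C" for g
    proof -
      have "mact I \<rho> g x \<in> U" using U g x by (auto simp: invariant_def)
      then have "mact J \<sigma> (inv g) (F0 (mact I \<rho> g x)) = mact J \<sigma> (inv g) (mact J \<sigma> g (f x))"
        using F0 eq g x by metis
      also have "\<dots> = mact J \<sigma> (mul (inv g) g) (f x)" using mact_mul[OF \<sigma>] g inv by metis
      also have "\<dots> = f x" using mact_one[OF \<sigma>] inv_mul g fJ x by auto
      finally show ?thesis .
    qed
    then have "F x = vsmul (inverse (of_nat (card C))) (\<Sum>g\<in>C. f x)" unfolding F_def by (metis (no_types, lifting) sum.cong)
    also have "\<dots> = f x" using card by (auto simp: fun_eq_iff sum_fun_apply)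
    finally show ?thesis .
  qed
  have Feq: "F (mact I \<rho> h v) = mact J \<sigma> h (F v)" if h: "h \<in> C" and v: "v \<in> vsp I" for h v
  proof -
    interpret L: Vector_Spaces.linear vsmul vsmul "mact J \<sigma> h" by (rule flin_mact)
    \<comment> \<open>The inverse of \<open>g\<close> is \<open>h\<close> times the inverse of
      \<open>mul g h\<close>, so each summand is a function of \<open>mul g h\<close> and the sum
      can be reindexed.\<close>
    have "(\<Sum>g\<in>C. mact J \<sigma> (inv g) (F0 (mact I \<rho> g (mact I \<rho> h v))))
        = (\<Sum>g\<in>C. mact J \<sigma> (mul h (inv (mul g h))) (F0 (mact I \<rho> (mul g h) v)))"
    proof (rule sum.cong[OF refl])
      fix g assume g: "g \<in> C"
      have "inv (mul g h) = mul (inv h) (inv g)"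
        by (rule inv_unique) (use g h in \<open>simp_all add: assoc mul inv inv_mul unit\<close>, metis assoc inv inv_mul mul unit)
      then have "mul h (inv (mul g h)) = inv g" using g h by (metis assoc inv inv_mul unit)
      then show "mact J \<sigma> (inv g) (F0 (mact I \<rho> g (mact I \<rho> h v))) = mact J \<sigma> (mul h (inv (mul g h))) (F0 (mact I \<rho> (mul g h) v))"
        using mact_mul[OF \<rho> g h] by metis
    qed
    also have "\<dots> = (\<Sum>g\<in>C. mact J \<sigma> (mul h (inv g)) (F0 (mact I \<rho> g v)))"
      by (rule sum.reindex_bij_betw[OF bij_right[OF h]])
    also have "\<dots> = (\<Sum>g\<in>C. mact J \<sigma> h (mact J \<sigma> (inv g) (F0 (mact I \<rho> g v))))"
      using mact_mul[OF \<sigma>] h inv by (intro sum.cong) auto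
    finally show ?thesis unfolding F_def L.scale L.sum by (rule arg_cong)
  qed
  define \<theta> where "\<theta> = (\<lambda>(a, j). if j \<in> J then F (delta a) j else 0)"
  have ap: "app I \<theta> v = F v" if "v \<in> vsp I" for v
    unfolding \<theta>_def by (rule app_delta[OF finI linF FJ that])
  show thesis
  proof (rule that[of \<theta>])
    show "app I \<theta> x = f x" if "x \<in> U" for x using ap FU UI that by auto
    show "app I \<theta> (mact I \<rho> g v) = mact J \<sigma> g (app I \<theta> v)" if "g \<in> C" "v \<in> vsp I" for g v
      using ap[OF that(2)] ap[OF mact_in_vsp] Feq[OF that] by metis
  qed (simp add: \<theta>_def)
qed

end

text \<open>The conclusion of Schur's lemma over a splitting field. Only values on
  \<open>vsp J\<close> are constrained, since module maps are total functions here.\<close>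

definition scalar_end :: "'g set \<Rightarrow> 'j set \<Rightarrow> ('g \<Rightarrow> 'j \<Rightarrow> 'j \<Rightarrow> 'k::field) \<Rightarrow> bool" where
  "scalar_end C J \<sigma> \<longleftrightarrow> (\<forall>f. (\<forall>x\<in>vsp J. \<forall>y\<in>vsp J. f (x + y) = f x + f y) \<and>
     (\<forall>c. \<forall>x\<in>vsp J. f (vsmul c x) = vsmul c (f x)) \<and> f ` vsp J \<subseteq> vsp J \<and>
     (\<forall>g\<in>C. \<forall>x\<in>vsp J. f (mact J \<sigma> g x) = mact J \<sigma> g (f x)) \<longrightarrow> (\<exists>l. \<forall>x\<in>vsp J. f x = vsmul l x))"

lemma simple_modD:
  fixes \<sigma> :: "'g \<Rightarrow> 'j \<Rightarrow> 'j \<Rightarrow> 'k::field"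
  assumes "simple_mod C mul u J \<sigma>"
  shows "is_rep C mul u J \<sigma>" "(vsp J :: ('j \<Rightarrow> 'k) set) \<noteq> {0}"
    "\<And>S :: ('j \<Rightarrow> 'k) set. S \<subseteq> vsp J \<Longrightarrow> fv.subspace S \<Longrightarrow> invariant C J \<sigma> S \<Longrightarrow> S = {0} \<or> S = vsp J"
proof -
  note a = assms[unfolded simple_mod_def simple_sec_def section_ok_def vzero_eq]
  note s = a[THEN conjunct1, THEN conjunct1] a[THEN conjunct2, THEN conjunct1]
    and m = a[THEN conjunct2, THEN conjunct2, THEN spec, THEN mp]
  show "is_rep C mul u J \<sigma>" by (rule s)
  show "(vsp J :: ('j \<Rightarrow> 'k) set) \<noteq> {0}" using s(2)[symmetric] .
  fix S :: "('j \<Rightarrow> 'k) set" assume S: "S \<subseteq> vsp J" "fv.subspace S" "invariant C J \<sigma> S"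
  show "S = {0} \<or> S = vsp J" using S fv.subspace_0[OF S(2)] by (intro m) (simp add: lsubspace_iff)
qed

section \<open>One composition factor: Schur's lemma for a map that kills \<open>W\<close> but not
  \<open>W'\<close>\<close>

context
  fixes C :: "'g set" and mul u and I :: "'i set" and \<rho> :: "'g \<Rightarrow> 'i \<Rightarrow> 'i \<Rightarrow> 'k::field"
    and J :: "'j set" and \<sigma> :: "'g \<Rightarrow> 'j \<Rightarrow> 'j \<Rightarrow> 'k" and U W W' \<theta>
  assumes simp_sec: "simple_sec C mul u I \<rho> W' W" and simp_mod: "simple_mod C mul u J \<sigma>"
    and WU: "W' \<subseteq> U" and \<theta>: "\<theta> \<in> Hm C I \<rho> J \<sigma> U W" "\<theta> \<notin> Hm C I \<rho> J \<sigma> U W'"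
begin

lemma factor_facts: "fv.subspace W'" "fv.subspace W" "W \<subseteq> W'" "W' \<subseteq> vsp I" "W \<noteq> W'"
    "\<And>g x. g \<in> C \<Longrightarrow> x \<in> W' \<Longrightarrow> mact I \<rho> g x \<in> W'"
  using simp_sec unfolding simple_sec_def section_ok_def lsubspace_iff invariant_def by auto

lemma theta_facts: "\<And>x. app I \<theta> x \<in> vsp J" "\<And>x. x \<in> W \<Longrightarrow> app I \<theta> x = 0"
    "\<And>g x. g \<in> C \<Longrightarrow> x \<in> U \<Longrightarrow> app I \<theta> (mact I \<rho> g x) = mact J \<sigma> g (app I \<theta> x)"
  using \<theta> app_in_vsp[of J \<theta> I] unfolding Hm_def by auto

text \<open>The kernel of \<theta> in \<open>W'\<close> is an invariant space between
  \<open>W\<close> and \<open>W'\<close>. It is not \<open>W'\<close> by the choice of \<theta>, so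
  simplicity of the factor leaves only \<open>W\<close>.\<close>

lemma kernel_factor: assumes x: "x \<in> W'" shows "app I \<theta> x = 0 \<longleftrightarrow> x \<in> W"
proof -
  define K where "K = {v \<in> W'. app I \<theta> v = 0}"
  have sK: "fv.subspace K" using factor_facts(1) unfolding K_def fv.subspace_def
    by (simp add: app_add app_scale app_zero)
  have "invariant C I \<rho> K" using WU factor_facts(6) theta_facts(3) mact_zero
    unfolding invariant_def K_def by (smt (verit, best) mem_Collect_eq subset_eq)
  moreover have "W \<subseteq> K" "K \<subseteq> W'" using factor_facts theta_facts by (auto simp: K_def)
  moreover have "lsubspace I K" using sK factor_facts \<open>K \<subseteq> W'\<close> by (auto simp: lsubspace_iff)
  ultimately have "K = W \<or> K = W'" using simp_sec unfolding simple_sec_def by blast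
  moreover have "K \<noteq> W'"
  proof
    assume "K = W'"
    then have "\<forall>v\<in>W'. app I \<theta> v = 0" by (auto simp: K_def)
    then show False using \<theta> unfolding Hm_def by blast
  qed
  ultimately have "K = W" by simp
  then show ?thesis using x unfolding K_def by blast
qed

text \<open>The image is an invariant subspace of a simple module, and it is nonzero because the
  kernel is the proper subspace \<open>W\<close>.\<close>

lemma image_factor: "app I \<theta> ` W' = vsp J"
proof -
  interpret L: Vector_Spaces.linear vsmul vsmul "app I \<theta>" by (rule flin_app)
  let ?T = "app I \<theta> ` W'"
  have "fv.subspace ?T" by (rule L.subspace_image[OF factor_facts(1)])
  moreover have "?T \<subseteq> vsp J" using theta_facts by auto
  moreover have "invariant C J \<sigma> ?T" unfolding invariant_def
  proof (intro ballI)
    fix g v assume "g \<in> C" "v \<in> ?T"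
    then obtain x where x: "x \<in> W'" "v = app I \<theta> x" by blast
    have "mact J \<sigma> g v = app I \<theta> (mact I \<rho> g x)" using theta_facts(3)[OF \<open>g \<in> C\<close>, of x] WU x by auto
    then show "mact J \<sigma> g v \<in> ?T" using factor_facts(6)[OF \<open>g \<in> C\<close> x(1)] by blast
  qed
  ultimately have "?T = {0} \<or> ?T = vsp J" using simple_modD(3)[OF simp_mod] by blast
  moreover have "?T \<noteq> {0}"
  proof
    assume h: "?T = {0}"
    have "x \<in> W" if "x \<in> W'" for x
    proof -
      have "app I \<theta> x \<in> ?T" using that by blast
      then show ?thesis using h kernel_factor[OF that] by simp
    qed
    then show False using factor_facts by blast
  qed
  ultimately show ?thesis by simp
qed

lemma iso_factor: "iso_sec C I \<rho> W' W J \<sigma> (vsp J) {vzero}"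
  unfolding iso_sec_def vadd_eq vsub_eq vzero_eq
proof (intro exI[of _ "app I \<theta>"] conjI ballI allI)
  show "\<exists>x\<in>W'. y - app I \<theta> x \<in> {0}" if "y \<in> vsp J" for y
    using that unfolding image_factor[symmetric] by auto
  show "app I \<theta> (mact I \<rho> g x) - mact J \<sigma> g (app I \<theta> x) \<in> {0}" if "g \<in> C" "x \<in> W'" for g x
    using theta_facts(3)[OF that(1)] WU that(2) by auto
qed (use theta_facts kernel_factor app_add app_scale in auto)

text \<open>Both maps factor through \<open>W'/W\<close>, and \<theta> does so bijectively. Hence
  \<eta> after the inverse of \<theta> is an endomorphism of the simple module, that is, a scalar.
  This bounds the contribution of the factor by one dimension.\<close>

lemma proportional_factor:
  assumes schur: "scalar_end C J \<sigma>" and \<eta>: "\<eta> \<in> Hm C I \<rho> J \<sigma> U W"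
  shows "\<exists>l. \<eta> - vsmul l \<theta> \<in> Hm C I \<rho> J \<sigma> U W'"
proof -
  have \<eta>s: "app I \<eta> x \<in> vsp J" for x using \<eta> app_in_vsp[of J \<eta> I] unfolding Hm_def by auto
  have \<eta>W: "app I \<eta> x = 0" if "x \<in> W" for x using \<eta> that unfolding Hm_def by auto
  have \<eta>e: "app I \<eta> (mact I \<rho> g x) = mact J \<sigma> g (app I \<eta> x)" if "g \<in> C" "x \<in> U" for g x
    using \<eta> that unfolding Hm_def by auto
  \<comment> \<open>This is \<eta> composed with the inverse of \<theta>. The choice of preimage is
    immaterial: two preimages differ by an element of \<open>W\<close>, which \<eta> kills.\<close>
  define f where "f y = app I \<eta> (SOME x. x \<in> W' \<and> app I \<theta> x = y)" for y
  have f: "f (app I \<theta> x) = app I \<eta> x" if x: "x \<in> W'" for x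
  proof -
    define x' where "x' = (SOME z. z \<in> W' \<and> app I \<theta> z = app I \<theta> x)"
    have x': "x' \<in> W' \<and> app I \<theta> x' = app I \<theta> x"
      unfolding x'_def by (rule someI[of _ x]) (use x in auto)
    have "x' - x \<in> W'" using x x' fv.subspace_diff[OF factor_facts(1)] by blast
    moreover have "app I \<theta> (x' - x) = 0" using x' unfolding app_diff by simp
    ultimately have "x' - x \<in> W" using kernel_factor by blast
    then have "app I \<eta> x' - app I \<eta> x = 0" using \<eta>W app_diff by metis
    then show ?thesis unfolding f_def x'_def[symmetric] by simp
  qed
  have fadd: "f (y + y') = f y + f y'" if y: "y \<in> vsp J" "y' \<in> vsp J" for y y'
  proof -
    obtain x x' where x: "x \<in> W'" "x' \<in> W'" "y = app I \<theta> x" "y' = app I \<theta> x'"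
      using y unfolding image_factor[symmetric] by blast
    then show ?thesis using f fv.subspace_add[OF factor_facts(1)] app_add by metis
  qed
  have fscale: "f (vsmul c y) = vsmul c (f y)" if y: "y \<in> vsp J" for c y
  proof -
    obtain x where x: "x \<in> W'" "y = app I \<theta> x"
      using y unfolding image_factor[symmetric] by blast
    then show ?thesis using f fv.subspace_scale[OF factor_facts(1)] app_scale by metis
  qed
  have feq: "f (mact J \<sigma> g y) = mact J \<sigma> g (f y)" if g: "g \<in> C" and y: "y \<in> vsp J" for g y
  proof -
    obtain x where x: "x \<in> W'" "y = app I \<theta> x"
      using y unfolding image_factor[symmetric] by blast
    then have "f (mact J \<sigma> g y) = f (app I \<theta> (mact I \<rho> g x))" using theta_facts(3) WU g by auto
    also have "\<dots> = mact J \<sigma> g (f y)" using f factor_facts(6) \<eta>e x WU g by (metis subsetD)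
    finally show ?thesis .
  qed
  have fJ: "f y \<in> vsp J" for y unfolding f_def by (rule \<eta>s)
  have "\<exists>l. \<forall>y\<in>vsp J. f y = vsmul l y"
  proof (rule schur[unfolded scalar_end_def, THEN spec, THEN mp], intro conjI)
    show "\<forall>x\<in>vsp J. \<forall>y\<in>vsp J. f (x + y) = f x + f y" using fadd by blast
    show "\<forall>c. \<forall>x\<in>vsp J. f (vsmul c x) = vsmul c (f x)" using fscale by blast
    show "f ` vsp J \<subseteq> vsp J" using fJ by blast
    show "\<forall>g\<in>C. \<forall>x\<in>vsp J. f (mact J \<sigma> g x) = mact J \<sigma> g (f x)" using feq by blast
  qed
  then obtain l where l: "\<And>y. y \<in> vsp J \<Longrightarrow> f y = vsmul l y" by blast
  have m: "\<eta> - vsmul l \<theta> \<in> Hm C I \<rho> J \<sigma> U W"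
    using fv.subspace_diff[OF subspace_Hm] fv.subspace_scale[OF subspace_Hm] \<eta> \<theta>(1) by blast
  have "app I (\<eta> - vsmul l \<theta>) x = 0" if "x \<in> W'" for x
    using f[OF that] l[OF theta_facts(1)] unfolding app_diff_left app_scale_left by (simp only: right_minus_eq)
  then show ?thesis using m unfolding Hm_def by blast
qed

end

context fin_group begin

text \<open>The isomorphism is an equivariant map on \<open>W'\<close> that kills exactly
  \<open>W\<close>, and averaging extends it beyond \<open>W'\<close>. Without this extension a
  factor isomorphic to the simple module might contribute nothing to the Hom space.\<close>

lemma Hm_lift_iso:
  fixes \<rho> :: "'g \<Rightarrow> 'i \<Rightarrow> 'i \<Rightarrow> 'k::field" and \<sigma> :: "'g \<Rightarrow> 'j \<Rightarrow> 'j \<Rightarrow> 'k"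
  assumes card: "(of_nat (card C) :: 'k) \<noteq> 0"
    and sec: "simple_sec C mul u I \<rho> W' W" and \<sigma>: "is_rep C mul u J \<sigma>" and U: "U \<subseteq> vsp I" "W' \<subseteq> U"
    and iso: "iso_sec C I \<rho> W' W J \<sigma> (vsp J) {vzero}"
  shows "\<exists>\<theta>\<in>Hm C I \<rho> J \<sigma> U W. \<theta> \<notin> Hm C I \<rho> J \<sigma> U W'"
proof -
  obtain f where f: "\<And>x y. x \<in> W' \<Longrightarrow> y \<in> W' \<Longrightarrow> f (x + y) = f x + f y"
      "\<And>c x. x \<in> W' \<Longrightarrow> f (vsmul c x) = vsmul c (f x)" "f ` W' \<subseteq> vsp J"
      "\<And>x. x \<in> W' \<Longrightarrow> f x = 0 \<longleftrightarrow> x \<in> W"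
      "\<And>g x. g \<in> C \<Longrightarrow> x \<in> W' \<Longrightarrow> f (mact I \<rho> g x) = mact J \<sigma> g (f x)"
    using iso unfolding iso_sec_def vadd_eq vsub_eq vzero_eq right_minus_eq singleton_iff by (elim exE conjE) (metis (no_types, lifting))
  have s: "is_rep C mul u I \<rho>" "lsubspace I W'" "invariant C I \<rho> W'" "W \<subseteq> W'" "W \<noteq> W'"
    using sec unfolding simple_sec_def section_ok_def by auto
  obtain \<theta> where \<theta>: "\<And>a j. j \<notin> J \<Longrightarrow> \<theta> (a, j) = 0" "\<And>x. x \<in> W' \<Longrightarrow> app I \<theta> x = f x"
    "\<And>g v. g \<in> C \<Longrightarrow> v \<in> vsp I \<Longrightarrow> app I \<theta> (mact I \<rho> g v) = mact J \<sigma> g (app I \<theta> v)"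
    using averaged_map[OF s(1) \<sigma> card s(2,3) f(1,2,3,5)] by blast
  have "\<theta> \<in> Hm C I \<rho> J \<sigma> U W" unfolding Hm_def using \<theta> f(4) s(4) U by auto
  moreover have "\<theta> \<notin> Hm C I \<rho> J \<sigma> U W'"
  proof
    assume "\<theta> \<in> Hm C I \<rho> J \<sigma> U W'"
    then have "\<forall>x\<in>W'. f x = 0" using \<theta>(2) unfolding Hm_def by auto
    then show False using f(4) s(4,5) by blast
  qed
  ultimately show ?thesis by blast
qed

text \<open>Going down the series, the space \<open>Hm\<close> grows by one dimension at each factor
  isomorphic to the simple module and stays the same at any other. The induction starts at the top,
  where the quotient is zero.\<close>

lemma chain_qbasis:
  fixes \<rho> :: "'g \<Rightarrow> 'i \<Rightarrow> 'i \<Rightarrow> 'k::field" and \<sigma> :: "'g \<Rightarrow> 'j \<Rightarrow> 'j \<Rightarrow> 'k"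
  assumes card: "(of_nat (card C) :: 'k) \<noteq> 0"
    and S: "simple_mod C mul u J \<sigma>" "scalar_end C J \<sigma>" and U: "U \<subseteq> vsp I"
  shows "Ws \<noteq> [] \<Longrightarrow> last Ws = U \<Longrightarrow>
     (\<forall>i. Suc i < length Ws \<longrightarrow> simple_sec C mul u I \<rho> (Ws ! Suc i) (Ws ! i)) \<Longrightarrow>
     hd Ws \<subseteq> U \<and> (\<exists>B. qbasis (Hm C I \<rho> J \<sigma> U (hd Ws)) (Hm C I \<rho> J \<sigma> U U) B \<and>
        card B = card {i. Suc i < length Ws \<and> iso_sec C I \<rho> (Ws ! Suc i) (Ws ! i) J \<sigma> (vsp J) {vzero}})"
proof (induction Ws)
  case Nil
  then show ?case by simp
next
  case (Cons W Ws)
  show ?case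
  proof (cases Ws)
    case Nil
    then show ?thesis using Cons.prems qbasis_refl[OF subspace_Hm, of C I \<rho> J \<sigma> U U] by (auto intro!: exI[of _ "{}"])
  next
    case (Cons W' rest)
    let ?P = "\<lambda>Ws i. Suc i < length Ws \<and> iso_sec C I \<rho> (Ws ! Suc i) (Ws ! i) J \<sigma> (vsp J) {vzero}"
    have sec: "simple_sec C mul u I \<rho> W' W" using Cons.prems(3)[rule_format, of 0] Cons by simp
    have ch: "\<forall>i. Suc i < length Ws \<longrightarrow> simple_sec C mul u I \<rho> (Ws ! Suc i) (Ws ! i)"
      using Cons.prems(3) by (metis Suc_less_eq length_Cons nth_Cons_Suc)
    obtain B where B: "hd Ws \<subseteq> U" "qbasis (Hm C I \<rho> J \<sigma> U (hd Ws)) (Hm C I \<rho> J \<sigma> U U) B" "card B = card {i. ?P Ws i}"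
      using Cons.IH[OF _ _ ch] Cons.prems Cons by auto
    have W': "hd Ws = W'" using Cons by simp
    have WW: "W \<subseteq> W'" using sec unfolding simple_sec_def section_ok_def by auto
    have fin: "finite {i. ?P Ws i}" by (rule finite_subset[of _ "{..<length Ws}"]) auto
    have set: "{i. ?P (W # Ws) i} = (if iso_sec C I \<rho> W' W J \<sigma> (vsp J) {vzero} then {0} else {}) \<union> Suc ` {i. ?P Ws i}"
    proof (rule set_eqI)
      fix i show "i \<in> {i. ?P (W # Ws) i} \<longleftrightarrow> i \<in> (if iso_sec C I \<rho> W' W J \<sigma> (vsp J) {vzero} then {0} else {}) \<union> Suc ` {i. ?P Ws i}"
        using Cons by (cases i) auto
    qed
    have sub: "Hm C I \<rho> J \<sigma> U W' \<subseteq> Hm C I \<rho> J \<sigma> U W" "Hm C I \<rho> J \<sigma> U U \<subseteq> Hm C I \<rho> J \<sigma> U W'"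
      using Hm_mono WW B W' by metis+
    have "\<exists>B. qbasis (Hm C I \<rho> J \<sigma> U W) (Hm C I \<rho> J \<sigma> U U) B \<and> card B = card {i. ?P (W # Ws) i}"
    proof (cases "iso_sec C I \<rho> W' W J \<sigma> (vsp J) {vzero}")
      case True
      obtain \<theta> where \<theta>: "\<theta> \<in> Hm C I \<rho> J \<sigma> U W" "\<theta> \<notin> Hm C I \<rho> J \<sigma> U W'"
        using Hm_lift_iso[OF card sec simple_modD(1)[OF S(1)] U _ True] B W' by blast
      have WU: "W' \<subseteq> U" using B W' by simp
      have q: "qbasis (Hm C I \<rho> J \<sigma> U W') (Hm C I \<rho> J \<sigma> U U) B" using B W' by simp
      have "qbasis (Hm C I \<rho> J \<sigma> U W) (Hm C I \<rho> J \<sigma> U U) (insert \<theta> B)" "\<theta> \<notin> B"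
        using qbasis_step[OF q subspace_Hm sub \<theta>] proportional_factor[OF sec S(1) WU \<theta> S(2)] by blast+
      moreover have "finite B" using B unfolding qbasis_def by blast
      moreover have "card {i. ?P (W # Ws) i} = Suc (card {i. ?P Ws i})"
      proof -
        have "{i. ?P (W # Ws) i} = insert 0 (Suc ` {i. ?P Ws i})" unfolding set using True by simp
        then show ?thesis using fin by (simp add: card_image card_insert_disjoint del: length_Cons)
      qed
      ultimately show ?thesis using B by (intro exI[of _ "insert \<theta> B"]) (simp add: card_insert_disjoint)
    next
      case False
      have "Hm C I \<rho> J \<sigma> U W' = Hm C I \<rho> J \<sigma> U W"
        using sub(1) iso_factor[OF sec S(1)] B(1) W' False by blast
      moreover have "card {i. ?P (W # Ws) i} = card {i. ?P Ws i}"
      proof -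
        have "{i. ?P (W # Ws) i} = Suc ` {i. ?P Ws i}" unfolding set using False by simp
        then show ?thesis by (simp add: card_image)
      qed
      ultimately show ?thesis using B W' by auto
    qed
    then show ?thesis using B W' WW by auto
  qed
qed

end

section \<open>Composition series exist in finite-dimensional spaces\<close>

lemma span_range_delta: "fv.span (range (delta :: 'i::finite \<Rightarrow> 'i \<Rightarrow> 'k::field)) = UNIV"
proof -
  have "v \<in> fv.span (range delta)" for v :: "'i \<Rightarrow> 'k"
    using vsp_expand[of UNIV v] by (simp add: vsp_def) (metis (no_types, lifting) fv.span_base fv.span_scale fv.span_sum rangeI)
  then show ?thesis by blast
qed

lemma independent_range_delta: "fv.independent (range (delta :: 'i::finite \<Rightarrow> 'i \<Rightarrow> 'k::field))"
proof (rule fv.independent_if_scalars_zero)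
  have inj: "inj (delta :: 'i \<Rightarrow> 'i \<Rightarrow> 'k)" by (rule injI) (metis delta_def zero_neq_one)
  fix f :: "('i \<Rightarrow> 'k) \<Rightarrow> 'k" and x :: "'i \<Rightarrow> 'k" assume h: "(\<Sum>x\<in>range delta. vsmul (f x) x) = 0" and "x \<in> range delta"
  then obtain i where i: "x = delta i" by blast
  have "(\<Sum>x\<in>range delta. vsmul (f x) x) = (\<Sum>j\<in>UNIV. vsmul (f (delta j)) (delta j))"
    using inj by (simp add: sum.reindex)
  then have "0 = (\<Sum>j\<in>UNIV. vsmul (f (delta j)) (delta j) i)" using h by (metis sum_fun_apply zero_fun_apply)
  also have "\<dots> = (\<Sum>j\<in>UNIV. if j = i then f (delta j) else 0)" by (rule sum.cong) (auto simp: delta_def)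
  finally show "f x = 0" using i by simp
qed simp

interpretation fvf: finite_dimensional_vector_space
  "vsmul :: 'k::field \<Rightarrow> ('i::finite \<Rightarrow> 'k) \<Rightarrow> ('i \<Rightarrow> 'k)" "range delta"
  by unfold_locales (simp_all add: span_range_delta independent_range_delta)

text \<open>Induction on the codimension of \<open>W\<close> in \<open>U\<close>: an invariant space
  of least dimension strictly above \<open>W\<close> gives a simple bottom factor.\<close>

lemma comp_series_exists:
  fixes I :: "'i::finite set" and \<rho> :: "'g \<Rightarrow> 'i \<Rightarrow> 'i \<Rightarrow> 'k::field"
  assumes "section_ok C mul u I \<rho> U W"
  shows "\<exists>Ws. comp_series C mul u I \<rho> U W Ws"
  using assms
proof (induction "fv.dim U - fv.dim W" arbitrary: W rule: less_induct)
  case less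
  show ?case
  proof (cases "W = U")
    case True
    then show ?thesis using less.prems by (intro exI[of _ "[W]"]) (simp add: comp_series_def)
  next
    case False
    have sU: "lsubspace I U" "lsubspace I W" "W \<subseteq> U" "invariant C I \<rho> U" "invariant C I \<rho> W" "is_rep C mul u I \<rho>"
      using less.prems by (auto simp: section_ok_def)
    have strict: "fv.dim S < fv.dim T" if "lsubspace I S" "lsubspace I T" "S \<subset> T" for S T :: "('i \<Rightarrow> 'k) set"
      using that fvf.dim_psubset[of S T] by (simp add: lsubspace_iff fv.span_eq_iff[THEN iffD2])
    define Q where "Q S \<longleftrightarrow> lsubspace I S \<and> invariant C I \<rho> S \<and> W \<subset> S \<and> S \<subseteq> U" for S
    have "Q U" using sU False by (auto simp: Q_def)
    then obtain S where S: "Q S" "\<And>T. Q T \<Longrightarrow> fv.dim S \<le> fv.dim T"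
      using ex_has_least_nat[of Q U fv.dim] by blast
    have s: "section_ok C mul u I \<rho> S W" "section_ok C mul u I \<rho> U S"
      using S(1) sU by (auto simp: section_ok_def Q_def)
    have "T = W \<or> T = S" if T: "lsubspace I T" "invariant C I \<rho> T" "W \<subseteq> T" "T \<subseteq> S" for T
    proof (rule ccontr)
      assume "\<not> (T = W \<or> T = S)"
      then have "Q T" "T \<subset> S" using T S(1) by (auto simp: Q_def)
      then show False using S(2)[of T] strict[of T S] T S(1) by (auto simp: Q_def)
    qed
    then have simp: "simple_sec C mul u I \<rho> S W" using s S(1) by (auto simp: simple_sec_def Q_def)
    have "fv.dim W < fv.dim S" using strict S(1) sU by (auto simp: Q_def)
    moreover have "fv.dim S \<le> fv.dim U" using S(2) \<open>Q U\<close> by blast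
    ultimately have "fv.dim U - fv.dim S < fv.dim U - fv.dim W" by linarith
    then obtain Ws where Ws: "comp_series C mul u I \<rho> U S Ws" using less.hyps s(2) by blast
    have "comp_series C mul u I \<rho> U W (W # Ws)"
      unfolding comp_series_def
    proof (intro conjI allI impI)
      fix i assume i: "Suc i < length (W # Ws)"
      show "simple_sec C mul u I \<rho> ((W # Ws) ! Suc i) ((W # Ws) ! i)"
      proof (cases i)
        case 0
        then show ?thesis using Ws simp by (simp add: comp_series_def hd_conv_nth[symmetric])
      next
        case (Suc j)
        then show ?thesis using Ws i by (simp add: comp_series_def)
      qed
    qed (use Ws less.prems in \<open>auto simp: comp_series_def\<close>)
    then show ?thesis by blast
  qed
qed

text \<open>The count along a series equals a dimension in which no series occurs. So all
  composition series give the same number, as \<open>has_mult\<close> demands.\<close>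

lemma (in fin_group) has_mult_qdim:
  fixes I :: "'i::finite set" and \<rho> :: "'g \<Rightarrow> 'i \<Rightarrow> 'i \<Rightarrow> 'k::field" and \<sigma> :: "'g \<Rightarrow> 'j \<Rightarrow> 'j \<Rightarrow> 'k"
  assumes card: "(of_nat (card C) :: 'k) \<noteq> 0"
    and S: "simple_mod C mul u J \<sigma>" "scalar_end C J \<sigma>" and sec: "section_ok C mul u I \<rho> U W"
  shows "has_mult C mul u I \<rho> U W J \<sigma> (qdim (Hm C I \<rho> J \<sigma> U W) (Hm C I \<rho> J \<sigma> U U))"
  unfolding has_mult_def
proof (intro conjI allI impI)
  show "\<exists>Ws. comp_series C mul u I \<rho> U W Ws" by (rule comp_series_exists[OF sec])
  have U: "U \<subseteq> vsp I" using sec by (simp add: section_ok_def lsubspace_def)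
  fix Ws assume Ws: "comp_series C mul u I \<rho> U W Ws"
  then obtain B where "qbasis (Hm C I \<rho> J \<sigma> U W) (Hm C I \<rho> J \<sigma> U U) B"
      "card B = card {i. Suc i < length Ws \<and> iso_sec C I \<rho> (Ws ! Suc i) (Ws ! i) J \<sigma> (vsp J) {vzero}}"
    using chain_qbasis[OF card S U, of Ws] unfolding comp_series_def by blast
  then show "card {i. Suc i < length Ws \<and> iso_sec C I \<rho> (Ws ! Suc i) (Ws ! i) J \<sigma> (vsp J) {vzero}}
      = qdim (Hm C I \<rho> J \<sigma> U W) (Hm C I \<rho> J \<sigma> U U)"
    using qbasis_qdim[OF _ subspace_Hm] by metis
qed

section \<open>Rectangular monoids\<close>

lemma idem_power: "e * e = (e::'m::monoid_mult) \<Longrightarrow> n > 0 \<Longrightarrow> e ^ n = e"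
proof (induction n)
  case (Suc n)
  then show ?case by (cases n) auto
qed simp

lemma exists_idem_power:
  fixes m :: "'m::{monoid_mult,finite}"
  shows "\<exists>n>0. m ^ n * m ^ n = m ^ n"
proof -
  have "\<not> inj (\<lambda>n::nat. m ^ n)" using finite_imageD[of "\<lambda>n::nat. m ^ n" UNIV] by auto
  then obtain i j where "i < j" "m ^ i = m ^ j" unfolding inj_def by (metis linorder_neqE_nat)
  then obtain p where p: "p > 0" "m ^ i = m ^ (i + p)" by (metis less_imp_add_positive)
  have per: "m ^ (n + k * p) = m ^ n" if "n \<ge> i" for n k
  proof (induction k)
    case (Suc k)
    obtain d where d: "n = i + d" using \<open>n \<ge> i\<close> le_Suc_ex by blast
    have "m ^ (n + p) = m ^ (i + p) * m ^ d" unfolding d power_add[symmetric] by (simp add: ac_simps)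
    also have "\<dots> = m ^ n" unfolding p(2)[symmetric] d power_add[symmetric] by simp
    finally have "m ^ (n + p) * m ^ (k * p) = m ^ n * m ^ (k * p)" by simp
    then show ?case using Suc unfolding power_add[symmetric] by (simp add: ac_simps)
  qed simp
  \<comment> \<open>The exponent is a multiple of the period that reaches the index, so doubling it
    does not change the power. Taking \<open>i + 1\<close> instead of \<open>i\<close> keeps it
    positive when \<open>i = 0\<close>.\<close>
  have "(i + 1) * p \<ge> i" using p(1) by (cases p) auto
  then have "m ^ ((i + 1) * p) * m ^ ((i + 1) * p) = m ^ ((i + 1) * p)"
    using per[of "(i + 1) * p" "i + 1"] unfolding power_add[symmetric] by simp
  moreover have "(i + 1) * p > 0" using p by simp
  ultimately show ?thesis by blast
qed

lemma omega_idem_power: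
  fixes m :: "'m::{monoid_mult,finite}"
  shows "omega m * omega m = omega m \<and> (\<exists>n>0. omega m = m ^ n)"
  unfolding omega_def
proof (rule theI')
  obtain n where n: "n > 0" "m ^ n * m ^ n = m ^ n" using exists_idem_power by blast
  show "\<exists>!e. e * e = e \<and> (\<exists>n>0. e = m ^ n)"
  proof (rule ex1I[of _ "m ^ n"])
    fix e assume e: "e * e = e \<and> (\<exists>n>0. e = m ^ n)"
    then obtain k where k: "k > 0" "e = m ^ k" by blast
    have "e = e ^ n" using idem_power e n by metis
    also have "\<dots> = (m ^ n) ^ k" unfolding k(2) by (simp add: power_mult[symmetric] mult.commute)
    also have "\<dots> = m ^ n" using idem_power n k by metis
    finally show "e = m ^ n" .
  qed (use n in blast)
qed

text \<open>In products nested to the right, a known product must also be recognised in front of a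
  tail \<open>x\<close>; this supplies the corresponding rewrite rule.\<close>

lemma assoc_ext: "a * b = c \<Longrightarrow> a * (b * x) = c * (x::'m::semigroup_mult)"
  by (simp add: mult.assoc[symmetric])

lemma assoc_ext3: "a * (b * c) = d \<Longrightarrow> a * (b * (c * x)) = d * (x::'m::semigroup_mult)"
  by (simp add: mult.assoc[symmetric])

text \<open>For \<open>X = MeM\<close>, \<open>ge e m\<close> says that \<open>m \<in> M_X\<close>.\<close>

definition ge :: "'m::monoid_mult \<Rightarrow> 'm \<Rightarrow> bool" where
  "ge e m \<longleftrightarrow> (\<exists>a b. e = a * m * b)"

lemma geI: "e = a * m * b \<Longrightarrow> ge e m" by (auto simp: ge_def)

lemma ge_refl: "ge m m" by (rule geI[of _ 1 _ 1]) simp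

lemma ge_trans: "ge a b \<Longrightarrow> ge b c \<Longrightarrow> ge a c"
proof -
  assume "ge a b" "ge b c"
  then obtain x y z w where "a = x * b * y" "b = z * c * w" by (auto simp: ge_def)
  then show "ge a c" by (intro geI[of _ "x * z" _ "w * y"]) (simp add: mult.assoc)
qed

lemma ge_mult_left: "ge (m * n) m" by (rule geI[of _ 1]) simp
lemma ge_mult_right: "ge (m * n) n" by (rule geI[of _ _ _ 1]) simp

lemma ge_multD: "ge e (m * n) \<Longrightarrow> ge e m" "ge e (m * n) \<Longrightarrow> ge e n"
  using ge_trans ge_mult_left ge_mult_right by blast+

lemma ideal_subset_iff: "ideal_of e \<subseteq> ideal_of m \<longleftrightarrow> ge e m"
proof
  assume "ideal_of e \<subseteq> ideal_of m"
  moreover have "e \<in> ideal_of e" unfolding ideal_of_def by (rule CollectI) (metis mult_1_left mult_1_right)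
  ultimately have "e \<in> ideal_of m" by blast
  then show "ge e m" by (auto simp: ideal_of_def ge_def)
next
  assume "ge e m"
  then obtain a b where e: "e = a * m * b" by (auto simp: ge_def)
  show "ideal_of e \<subseteq> ideal_of m" unfolding ideal_of_def e
  proof clarify
    fix c d show "\<exists>a' b'. c * (a * m * b) * d = a' * m * b' \<and> True"
      by (intro exI[of _ "c * a"] exI[of _ "b * d"]) (simp add: mult.assoc)
  qed
qed

lemma ideal_eq_iff: "ideal_of e = ideal_of f \<longleftrightarrow> ge e f \<and> ge f e"
  using ideal_subset_iff[of e f] ideal_subset_iff[of f e] by auto

lemma nabla_iff: "m \<in> nabla (ideal_of e) \<longleftrightarrow> \<not> ge e m"
  by (simp add: nabla_def MX_def ideal_subset_iff)

lemma idems_iff: "e \<in> idems \<longleftrightarrow> e * e = e" by (simp add: idems_def)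

lemma corner_iff: "e * e = e \<Longrightarrow> f * f = f \<Longrightarrow> x \<in> corner e f \<longleftrightarrow> e * x = x \<and> x * f = x"
  unfolding corner_def by (auto simp: mult.assoc) (metis mult.assoc)+

text \<open>Left multiplication by \<open>x\<close> on eM is injective because \<open>a\<close>
  undoes it. By finiteness it is surjective, which produces a right inverse of \<open>x\<close>, and
  this must be \<open>a\<close>.\<close>

lemma left_inverse_corner:
  fixes e :: "'m::{monoid_mult,finite}"
  assumes a: "e * a = a" "a * e = a" and x: "e * x = x" "x * e = x" and ax: "a * x = e"
  shows "x * a = e"
proof -
  let ?E = "{y. e * y = y}"
  have "inj_on ((*) x) ?E"
  proof (rule inj_onI)
    fix y y' assume h: "y \<in> ?E" "y' \<in> ?E" "x * y = x * y'"
    have "a * (x * y) = a * (x * y')" using h(3) by simp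
    then show "y = y'" using h(1,2) by (simp add: assoc_ext[OF ax])
  qed
  moreover have "(*) x ` ?E \<subseteq> ?E" using x by (auto simp: mult.assoc[symmetric])
  ultimately have "(*) x ` ?E = ?E" by (intro endo_inj_surj) auto
  moreover have "e * e = e" using assoc_ext[OF a(1), of x] ax by simp
  ultimately have "e \<in> (*) x ` ?E" by simp
  then obtain y where y: "e * y = y" "x * y = e" by auto
  have "a = a * (x * y)" using a y by simp
  also have "\<dots> = y" using assoc_ext[OF ax, of y] y by simp
  finally have "a = y" .
  then show ?thesis using y by simp
qed

text \<open>For the reverse direction a factorisation \<open>e = a * g * b\<close> is moved into
  eMe. Finiteness makes one-sided inverses two-sided, and \<open>b' * a'\<close> turns out to invert
  \<open>g\<close>.\<close>

lemma Gunits_iff: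
  fixes e :: "'m::{monoid_mult,finite}"
  assumes e: "e * e = e"
  shows "g \<in> Gunits e \<longleftrightarrow> e * g = g \<and> g * e = g \<and> ge e g"
proof
  assume "g \<in> Gunits e"
  then show "e * g = g \<and> g * e = g \<and> ge e g" unfolding Gunits_def using corner_iff[OF e e]
    by (auto intro: geI[of _ 1])
next
  assume h: "e * g = g \<and> g * e = g \<and> ge e g"
  then obtain a b where ab: "e = a * g * b" by (auto simp: ge_def)
  define a' b' where "a' = e * a * e" and "b' = e * b * e"
  have c: "e * a' = a'" "a' * e = a'" "e * b' = b'" "b' * e = b'"
    unfolding a'_def b'_def by (simp_all add: mult.assoc e assoc_ext[OF e])
  have ab3: "a * (g * b) = e" using ab by (simp add: mult.assoc)
  have eq: "a' * (g * b') = e" using h unfolding a'_def b'_def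
    by (simp add: mult.assoc assoc_ext[of e g] assoc_ext[of g e] assoc_ext3[OF ab3] e)
  have gs: "e * g = g" "g * e = g" using h by auto
  note ext = c[THEN assoc_ext] gs[THEN assoc_ext] c gs mult.assoc
  have l: "b' * (a' * g) = e"
    by (rule left_inverse_corner) (simp_all add: ext eq)
  have l2: "(b' * a') * g = e" using l by (simp add: mult.assoc)
  have "g * (b' * a') = e"
    by (rule left_inverse_corner[OF _ _ _ _ l2]) (simp_all add: ext)
  moreover have "e * (b' * a') = b' * a'" "b' * a' * e = b' * a'" by (simp_all add: ext)
  moreover note l2
  ultimately show "g \<in> Gunits e" unfolding Gunits_def using corner_iff[OF e e] h by blast
qed

lemma ginv_props:
  fixes e :: "'m::{monoid_mult,finite}"
  assumes e: "e * e = e" and g: "g \<in> Gunits e"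
  shows "ginv e g \<in> Gunits e" "g * ginv e g = e" "ginv e g * g = e"
proof -
  obtain h where h: "h \<in> corner e e" "g * h = e" "h * g = e" "g \<in> corner e e" using g unfolding Gunits_def by blast
  have "ginv e g \<in> corner e e \<and> g * ginv e g = e \<and> ginv e g * g = e"
    unfolding ginv_def
  proof (rule theI')
    show "\<exists>!h. h \<in> corner e e \<and> g * h = e \<and> h * g = e"
    proof (rule ex1I[of _ h])
      fix k assume "k \<in> corner e e \<and> g * k = e \<and> k * g = e"
      then have k: "e * k = k" "g * k = e" using corner_iff[OF e e] by auto
      have "k = h * (g * k)" using assoc_ext[OF h(3), of k] k by simp
      then show "k = h" using k h corner_iff[OF e e] by simp
    qed (use h in blast)
  qed
  then show "ginv e g \<in> Gunits e" "g * ginv e g = e" "ginv e g * g = e" using h unfolding Gunits_def by auto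
qed

lemma fin_group_Gunits:
  fixes e :: "'m::{monoid_mult,finite}"
  assumes e: "e * e = e"
  shows "fin_group (Gunits e) (*) e (ginv e)"
proof
  show "g * h \<in> Gunits e" if "g \<in> Gunits e" "h \<in> Gunits e" for g h
  proof -
    have p: "e * g = g" "g * e = g" "e * h = h" "h * e = h" "ginv e g * g = e" "h * ginv e h = e"
      using that ginv_props[OF e] Gunits_iff[OF e] by auto
    have "e = ginv e g * (g * h) * ginv e h"
      by (simp add: mult.assoc p e assoc_ext[OF p(5)])
    then have "ge e (g * h)" by (rule geI)
    then show ?thesis using Gunits_iff[OF e] p by (simp add: mult.assoc assoc_ext[OF p(1)])
  qed
qed (use ginv_props[OF e] Gunits_iff[OF e] e ge_refl in \<open>auto simp: mult.assoc\<close>)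

lemma fin_group_GG:
  fixes e f :: "'m::{monoid_mult,finite}"
  assumes e: "e * e = e" and f: "f * f = f"
  shows "fin_group (GG f e) pmul (f, e) (\<lambda>(g, h). (ginv f g, ginv e h))"
proof -
  interpret E: fin_group "Gunits e" "(*)" e "ginv e" by (rule fin_group_Gunits[OF e])
  interpret F: fin_group "Gunits f" "(*)" f "ginv f" by (rule fin_group_Gunits[OF f])
  show ?thesis
    by unfold_locales (auto simp: GG_def pmul_def E.u F.u E.mul F.mul E.inv F.inv E.assoc F.assoc E.unit F.unit E.inv_mul F.inv_mul)
qed

locale rect_monoid =
  fixes ty :: "'m::{monoid_mult,finite} itself"
  assumes rect: "rectangular TYPE('m)"
begin

lemma rect_ge:
  fixes e f g :: 'm
  assumes "e * e = e" "f * f = f" "g * g = g" "ge e f" "ge f e" "ge e g" "ge g e"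
  shows "ge e (f * g)" "(f * g) * (f * g) = f * g"
proof -
  have "ideal_of (f * g) = ideal_of e \<and> f * g \<in> idems"
    by (rule rect[unfolded rectangular_def, rule_format]) (use assms in \<open>auto simp: idems_iff ideal_eq_iff\<close>)
  then show "ge e (f * g)" "(f * g) * (f * g) = f * g" by (auto simp: idems_iff ideal_eq_iff)
qed

text \<open>From \<open>e = a * m * b\<close> and \<open>e = c * n * d\<close> one gets idempotents
  \<open>b * a * m\<close> and \<open>n * d * c\<close> that generate the same ideal as
  \<open>e\<close>. Rectangularity keeps their product in this class, and the product is a multiple
  of \<open>m * n\<close>.\<close>

lemma ge_mult:
  fixes e m n :: 'm
  assumes e: "e * e = e" and m: "ge e m" and n: "ge e n" shows "ge e (m * n)"
proof -
  obtain a0 b0 c0 d0 where z: "e = a0 * m * b0" "e = c0 * n * d0" using m n unfolding ge_def by blast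
  define a b c d where d: "a = e * a0" "b = b0 * e" "c = e * c0" "d = d0 * e"
  have z3: "a0 * (m * b0) = e" "c0 * (n * d0) = e" using z by (simp_all add: mult.assoc)
  have amb: "a * (m * b) = e" and cnd: "c * (n * d) = e"
    unfolding d by (simp_all add: mult.assoc assoc_ext3[OF z3(1)] assoc_ext3[OF z3(2)] e)
  have i: "b * e = b" "e * c = c" "d * e = d" "e * a = a" unfolding d using e by (simp_all add: mult.assoc) (simp_all add: mult.assoc[symmetric])
  define p q where pq: "p = b * a * m" "q = n * d * c"
  note ext = assoc_ext3[OF amb] assoc_ext3[OF cnd] i[THEN assoc_ext] i e amb cnd mult.assoc
  have p1: "p * p = p" "e = a * m * p * b" "p = b * e * (a * m)"
    and q1: "q * q = q" "e = c * q * (n * d)" "q = (n * d) * e * c"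
    unfolding pq by (simp_all add: ext)
  have "ge e (p * q)"
    by (rule rect_ge(1)[OF e p1(1) q1(1)]) (rule geI, rule p1 q1)+
  moreover have "p * q = (b * a) * (m * n) * (d * c)" unfolding pq by (simp add: mult.assoc)
  ultimately show ?thesis using ge_trans geI by metis
qed

lemma ge_mult_iff: "(e::'m) * e = e \<Longrightarrow> ge e (m * n) \<longleftrightarrow> ge e m \<and> ge e n"
  using ge_mult ge_multD by blast

lemma ge_power: "(e::'m) * e = e \<Longrightarrow> ge e m \<Longrightarrow> ge e (m ^ n)"
  by (induction n) (auto intro: ge_mult geI[of _ 1 _ e])

text \<open>\<open>M_X\<close> is closed under powers, so it contains \<open>m\<close> exactly when
  it contains its idempotent power. Every condition on \<open>sigma\<close> thus becomes one on
  \<open>ge\<close>.\<close>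

lemma subset_sigma_iff: fixes e m :: 'm assumes e: "e * e = e" shows "ideal_of e \<subseteq> sigma m \<longleftrightarrow> ge e m"
proof -
  obtain n where n: "n > 0" "omega m = m ^ n" using omega_idem_power by blast
  then have "ge (omega m) m" by (cases n) (auto intro: ge_mult_left)
  then show ?thesis unfolding sigma_def ideal_subset_iff n(2) using ge_power[OF e] ge_trans by blast
qed

lemma corner_unit: "(e::'m) * e = e \<Longrightarrow> ge e m \<Longrightarrow> e * m * e \<in> Gunits e"
  by (auto simp: Gunits_iff ge_mult_iff ge_refl mult.assoc) (simp add: mult.assoc[symmetric])

text \<open>This is multiplicativity of \<rho>_X on \<open>M_X\<close>. Dividing \<open>m\<close> by
  its corner on the left and \<open>n\<close> by its corner on the right gives idempotents
  \<open>p\<close> and \<open>q\<close> in the class of \<open>e\<close>. Their product is an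
  idempotent unit of eMe, hence \<open>e\<close>, and multiplying back gives the claim.\<close>

lemma corner_mult:
  fixes e m n :: 'm assumes e: "e * e = e" and m: "ge e m" and n: "ge e n"
  shows "e * m * n * e = e * m * e * (e * n * e)"
proof -
  define z w where zw: "z = ginv e (e * m * e)" "w = ginv e (e * n * e)"
  have z: "z \<in> Gunits e" "(e * m * e) * z = e" "z * (e * m * e) = e"
    and w: "w \<in> Gunits e" "(e * n * e) * w = e" "w * (e * n * e) = e"
    unfolding zw using ginv_props[OF e corner_unit[OF e m]] ginv_props[OF e corner_unit[OF e n]] by auto
  have ze: "e * z = z" "z * e = z" "e * w = w" "w * e = w" using z w Gunits_iff[OF e] by auto
  define p q where pq: "p = z * m" "q = n * w"
  have pe: "p * e = e" unfolding pq using z(3) assoc_ext[OF ze(2), of "m * e"] by (simp add: mult.assoc)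
  have eq: "e * q = e" unfolding pq using w(2) ze by (simp add: mult.assoc)
  have ep: "e * p = p" unfolding pq using assoc_ext[OF ze(1)] by simp
  have qe: "q * e = q" unfolding pq using ze by (simp add: mult.assoc)
  note ext = mult.assoc pe eq ep qe e pe[THEN assoc_ext] eq[THEN assoc_ext] ep[THEN assoc_ext] qe[THEN assoc_ext] e[THEN assoc_ext]
  have pp: "p * p = p" "q * q = q"
    using assoc_ext[OF pe, of p] assoc_ext[OF qe, of q] eq by (simp_all add: ep qe)
  have "ge e p" "ge p e" "ge e q" "ge q e"
    using pe eq ep qe by (auto intro: geI[of _ 1 _ e] geI[of _ 1 _ p] geI[of _ e _ 1] geI[of _ q _ 1])
  then have i: "ge e (p * q)" "(p * q) * (p * q) = p * q" using rect_ge[OF e pp] by blast+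
  have u: "p * q \<in> Gunits e" using i Gunits_iff[OF e] by (simp add: ext)
  have "p * q = ginv e (p * q) * ((p * q) * (p * q))"
    using assoc_ext[OF ginv_props(3)[OF e u], of "p * q"] u Gunits_iff[OF e] by simp
  also have "\<dots> = e" unfolding i(2) by (rule ginv_props(3)[OF e u])
  finally have pq_e: "p * q = e" .
  have "(e * m * e) * p = e * m" unfolding pq using assoc_ext[OF z(2), of m] assoc_ext[OF ze(1), of m] by (simp add: mult.assoc)
  moreover have "q * (e * n * e) = n * e" unfolding pq using w(3) assoc_ext[OF ze(4), of "n * e"] by (simp add: mult.assoc)
  ultimately have "(e * m) * (n * e) = ((e * m * e) * p) * (q * (e * n * e))" by simp
  also have "\<dots> = (e * m * e) * (p * q) * (e * n * e)" by (simp only: mult.assoc)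
  also have "\<dots> = e * m * e * (e * n * e)" unfolding pq_e by (simp add: mult.assoc assoc_ext[OF e])
  finally show ?thesis by (simp add: mult.assoc)
qed

end

section \<open>Matrix units from the splitting field\<close>

text \<open>The conclusion of Burnside's theorem: for nonempty \<open>J\<close> this is absolute
  simplicity. Unlike simplicity it is inherited by outer tensor products.\<close>

definition dens :: "'g set \<Rightarrow> 'j set \<Rightarrow> ('g \<Rightarrow> 'j \<Rightarrow> 'j \<Rightarrow> 'k::field) \<Rightarrow> bool" where
  "dens C J \<sigma> \<longleftrightarrow> (\<forall>X. \<exists>a. \<forall>i\<in>J. \<forall>j\<in>J. (\<Sum>g\<in>C. a g * \<sigma> g i j) = X i j)"

text \<open>The one-element index type lets \<open>mact\<close> serve as application of a single
  matrix.\<close>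

lemma dens_operator:
  assumes d: "dens C J \<sigma>"
  obtains a where "\<And>v. (\<Sum>g\<in>C. vsmul (a g) (mact J \<sigma> g v)) = mact J (\<lambda>_::unit. X) () v"
proof -
  obtain a where a: "\<And>i j. i \<in> J \<Longrightarrow> j \<in> J \<Longrightarrow> (\<Sum>g\<in>C. a g * \<sigma> g i j) = X i j"
    using d unfolding dens_def by metis
  have "(\<Sum>g\<in>C. vsmul (a g) (mact J \<sigma> g v)) i = mact J (\<lambda>_::unit. X) () v i" for v i
  proof (cases "i \<in> J")
    case True
    have "(\<Sum>g\<in>C. vsmul (a g) (mact J \<sigma> g v)) i = (\<Sum>g\<in>C. \<Sum>j\<in>J. a g * \<sigma> g i j * v j)"
      using True by (simp add: sum_fun_apply mact_def sum_distrib_left mult.assoc)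
    also have "\<dots> = (\<Sum>j\<in>J. (\<Sum>g\<in>C. a g * \<sigma> g i j) * v j)"
      by (subst sum.swap) (simp add: sum_distrib_right)
    also have "\<dots> = mact J (\<lambda>_::unit. X) () v i" using True by (simp add: mact_def a)
    finally show ?thesis .
  qed (simp add: sum_fun_apply mact_def)
  then show thesis using that by blast
qed

lemma flin_zero: "flin f \<Longrightarrow> f 0 = 0"
proof -
  assume "flin f"
  then interpret Vector_Spaces.linear vsmul vsmul f .
  show "f 0 = 0" by (rule zero)
qed

lemma delta_in_vsp: "j \<in> J \<Longrightarrow> delta j \<in> vsp J"
  by (auto simp: delta_def vsp_def)

lemma mact_column:
  assumes "finite J" "j0 \<in> J" "x \<in> vsp J"
  shows "mact J (\<lambda>_::unit. \<lambda>i j. if j = j0 then x i * c else 0) () v = vsmul (c * v j0) x"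
proof
  fix i
  have "(\<Sum>j\<in>J. (if j = j0 then x i * c else 0) * v j) = (\<Sum>j\<in>J. if j = j0 then x i * c * v j else 0)"
    by (rule sum.cong) auto
  then show "mact J (\<lambda>_::unit. \<lambda>i j. if j = j0 then x i * c else 0) () v i = vsmul (c * v j0) x i"
    using assms by (auto simp: mact_def vsp_def)
qed

text \<open>A rank-one matrix in the span sends \<open>delta j0\<close> to any given
  \<open>x\<close>. Since \<open>f\<close> commutes with it, \<open>f x\<close> is \<open>x\<close>
  scaled by the \<open>j0\<close> coordinate of \<open>f (delta j0)\<close>.\<close>

lemma dens_scalar_end:
  fixes \<sigma> :: "'g \<Rightarrow> 'j \<Rightarrow> 'j \<Rightarrow> 'k::field"
  assumes d: "dens C J \<sigma>" and J: "finite J" and C: "finite C"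
  shows "scalar_end C J \<sigma>"
  unfolding scalar_end_def
proof (intro allI impI, elim conjE)
  fix f :: "('j \<Rightarrow> 'k) \<Rightarrow> 'j \<Rightarrow> 'k"
  assume add: "\<forall>x\<in>vsp J. \<forall>y\<in>vsp J. f (x + y) = f x + f y"
    and scale: "\<forall>c. \<forall>x\<in>vsp J. f (vsmul c x) = vsmul c (f x)" and fJ: "f ` vsp J \<subseteq> vsp J"
    and eq: "\<forall>g\<in>C. \<forall>x\<in>vsp J. f (mact J \<sigma> g x) = mact J \<sigma> g (f x)"
  obtain F where F: "flin F" "\<And>x. x \<in> vsp J \<Longrightarrow> F x = f x"
    using linear_extend_from_subspace[OF subspace_vsp, of J f] add scale by blast
  interpret F: Vector_Spaces.linear vsmul vsmul F by (rule F(1))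
  show "\<exists>l. \<forall>x\<in>vsp J. f x = vsmul l x"
  proof (cases "J = {}")
    case True
    have "f x = x" if "x \<in> vsp J" for x
    proof -
      have "f x \<in> vsp J" using fJ that by blast
      then show ?thesis using that True by (auto simp: vsp_def fun_eq_iff)
    qed
    then show ?thesis by (intro exI[of _ 1]) simp
  next
    case False
    then obtain j0 where j0: "j0 \<in> J" by blast
    have d0: "(delta j0 :: 'j \<Rightarrow> 'k) \<in> vsp J" by (rule delta_in_vsp[OF j0])
    have "f x = vsmul (f (delta j0) j0) x" if x: "x \<in> vsp J" for x
    proof -
      obtain a where a: "\<And>v. (\<Sum>g\<in>C. vsmul (a g) (mact J \<sigma> g v))
          = mact J (\<lambda>_::unit. \<lambda>i j. if j = j0 then x i * 1 else 0) () v"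
        using dens_operator[OF d] by blast
      have "F (\<Sum>g\<in>C. vsmul (a g) (mact J \<sigma> g (delta j0))) = (\<Sum>g\<in>C. vsmul (a g) (mact J \<sigma> g (F (delta j0))))"
        unfolding F.sum F.scale using eq d0 by (intro sum.cong) (simp_all add: F(2) mact_in_vsp)
      then have "F (vsmul (1 * delta j0 j0) x) = vsmul (1 * F (delta j0) j0) x"
        unfolding a mact_column[OF J j0 x] .
      then show ?thesis using F(2) x d0 by (simp add: delta_def)
    qed
    then show ?thesis by blast
  qed
qed

text \<open>A nonzero coordinate of some \<open>s\<close> in \<open>S\<close> lets a rank-one matrix
  carry \<open>s\<close> to any prescribed vector, so a nonzero invariant subspace is
  everything.\<close>

lemma dens_simple:
  fixes \<sigma> :: "'g \<Rightarrow> 'j \<Rightarrow> 'j \<Rightarrow> 'k::field"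
  assumes d: "dens C J \<sigma>" and r: "is_rep C mul u J \<sigma>" and J: "J \<noteq> {}" and C: "finite C"
  shows "simple_mod C mul u J \<sigma>"
proof -
  have fJ: "finite J" using r by (simp add: is_rep_def)
  have "S = {0} \<or> S = vsp J" if S: "lsubspace J S" "invariant C J \<sigma> S" for S
  proof (cases "S \<subseteq> {0}")
    case True
    then show ?thesis using S fv.subspace_0 by (auto simp: lsubspace_iff)
  next
    case False
    then obtain s where s: "s \<in> S" "s \<noteq> 0" by blast
    then obtain j1 where "s j1 \<noteq> 0" by (auto simp: fun_eq_iff)
    moreover have "s \<in> vsp J" and sub: "fv.subspace S" "S \<subseteq> vsp J" using S s by (auto simp: lsubspace_iff)
    ultimately have j1: "j1 \<in> J" "s j1 \<noteq> 0" by (auto simp: vsp_def)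
    have "x \<in> S" if x: "x \<in> vsp J" for x
    proof -
      obtain a where a: "\<And>v. (\<Sum>g\<in>C. vsmul (a g) (mact J \<sigma> g v))
          = mact J (\<lambda>_::unit. \<lambda>i j. if j = j1 then x i * inverse (s j1) else 0) () v"
        using dens_operator[OF d] by blast
      have "(\<Sum>g\<in>C. vsmul (a g) (mact J \<sigma> g s)) \<in> S"
        by (intro fv.subspace_sum[OF sub(1)] fv.subspace_scale[OF sub(1)]) (use S s in \<open>auto simp: invariant_def\<close>)
      then show ?thesis unfolding a mact_column[OF fJ j1(1) x] using j1 by simp
    qed
    then show ?thesis using sub by blast
  qed
  moreover obtain j where "j \<in> J" using J by blast
  then have "{0} \<noteq> (vsp J :: ('j \<Rightarrow> 'k) set)" using delta_in_vsp[of j J, where 'b='k]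
    by (metis delta_def singletonD zero_fun_apply zero_neq_one)
  moreover have "section_ok C mul u J \<sigma> (vsp J) {0}"
    unfolding section_ok_def lsubspace_iff invariant_def
    using r subspace_vsp mact_in_vsp fv.subspace_0[OF subspace_vsp] fv.subspace_single_0 mact_zero by auto
  ultimately show ?thesis unfolding simple_mod_def simple_sec_def vzero_eq by blast
qed

section \<open>The algebra kM acting on a simple module\<close>

definition alg_act :: "'j set \<Rightarrow> ('m::{monoid_mult,finite} \<Rightarrow> 'j \<Rightarrow> 'j \<Rightarrow> 'k::field) \<Rightarrow> ('m \<Rightarrow> 'k) \<Rightarrow> ('j \<Rightarrow> 'k) \<Rightarrow> 'j \<Rightarrow> 'k" where
  "alg_act J \<sigma> a v = (\<Sum>m\<in>UNIV. vsmul (a m) (mact J \<sigma> m v))"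

context
  fixes J :: "'j set" and \<sigma> :: "'m::{monoid_mult,finite} \<Rightarrow> 'j \<Rightarrow> 'j \<Rightarrow> 'k::field"
  assumes rep: "is_rep UNIV (*) 1 J \<sigma>"
begin

lemma alg_act_in_vsp: "alg_act J \<sigma> a v \<in> vsp J"
  unfolding alg_act_def by (intro fv.subspace_sum[OF subspace_vsp] fv.subspace_scale[OF subspace_vsp] mact_in_vsp)

lemma flin_alg_act: "flin (alg_act J \<sigma> a)"
  by (rule flinI) (simp_all only: alg_act_def mact_add mact_scale fv.scale_right_distrib sum.distrib fv.scale_sum_right fv.scale_left_commute)

lemma alg_act_left: "flin (\<lambda>a. alg_act J \<sigma> a v)"
  by (rule flinI) (simp_all add: alg_act_def fv.scale_left_distrib sum.distrib fv.scale_sum_right)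

lemma alg_act_delta: "alg_act J \<sigma> (delta m) v = mact J \<sigma> m v"
proof -
  have "alg_act J \<sigma> (delta m) v = (\<Sum>x\<in>UNIV. if x = m then mact J \<sigma> m v else 0)"
    unfolding alg_act_def by (rule sum.cong) (auto simp: delta_def)
  then show ?thesis by simp
qed

lemma alg_act_one: "v \<in> vsp J \<Longrightarrow> alg_act J \<sigma> alg_one v = v"
  unfolding alg_one_def alg_act_delta by (rule mact_one[OF rep])

lemma alg_act_conv: "alg_act J \<sigma> (conv a b) v = alg_act J \<sigma> a (alg_act J \<sigma> b v)"
proof -
  have "alg_act J \<sigma> a (alg_act J \<sigma> b v) = (\<Sum>x\<in>UNIV. \<Sum>y\<in>UNIV. vsmul (a x * b y) (mact J \<sigma> (x * y) v))"
    unfolding alg_act_def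
  proof (rule sum.cong[OF refl])
    fix x
    interpret L: Vector_Spaces.linear vsmul vsmul "mact J \<sigma> x" by (rule flin_mact)
    show "vsmul (a x) (mact J \<sigma> x (\<Sum>m\<in>UNIV. vsmul (b m) (mact J \<sigma> m v))) = (\<Sum>y\<in>UNIV. vsmul (a x * b y) (mact J \<sigma> (x * y) v))"
      unfolding L.sum L.scale fv.scale_sum_right using mact_mul[OF rep] by (intro sum.cong) auto
  qed
  also have "\<dots> = (\<Sum>p\<in>UNIV. vsmul (a (fst p) * b (snd p)) (mact J \<sigma> (fst p * snd p) v))"
    unfolding sum.cartesian_product UNIV_Times_UNIV by (simp add: case_prod_beta)
  also have "\<dots> = (\<Sum>z\<in>UNIV. \<Sum>p\<in>{p \<in> UNIV. fst p * snd p = z}. vsmul (a (fst p) * b (snd p)) (mact J \<sigma> (fst p * snd p) v))"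
    by (rule sum.group[symmetric]) auto
  also have "\<dots> = alg_act J \<sigma> (conv a b) v"
    unfolding alg_act_def conv_def
  proof (rule sum.cong[OF refl])
    fix z :: 'm
    have "{p \<in> UNIV. fst p * snd p = z} = {(x, y). x * y = z}" by auto
    then have "(\<Sum>p\<in>{p \<in> UNIV. fst p * snd p = z}. vsmul (a (fst p) * b (snd p)) (mact J \<sigma> (fst p * snd p) v))
        = (\<Sum>p\<in>{(x, y). x * y = z}. vsmul (a (fst p) * b (snd p)) (mact J \<sigma> z v))"
      by (intro sum.cong) auto
    then show "(\<Sum>p\<in>{p \<in> UNIV. fst p * snd p = z}. vsmul (a (fst p) * b (snd p)) (mact J \<sigma> (fst p * snd p) v))
        = vsmul (\<Sum>p\<in>{(x, y). x * y = z}. a (fst p) * b (snd p)) (mact J \<sigma> z v)"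
      by (simp only: fv.scale_sum_left)
  qed
  finally show ?thesis by (rule sym)
qed

text \<open>The multiples of \<open>w\<close> under kM form a submodule that contains
  \<open>w\<close>, hence the whole simple module.\<close>

lemma alg_act_cyclic:
  assumes s: "simple_mod UNIV (*) 1 J \<sigma>" and w: "w \<in> vsp J" "w \<noteq> 0" and v: "v \<in> vsp J"
  obtains x where "v = alg_act J \<sigma> x w"
proof -
  interpret L: Vector_Spaces.linear vsmul vsmul "\<lambda>a. alg_act J \<sigma> a w" by (rule alg_act_left)
  let ?S = "range (\<lambda>a. alg_act J \<sigma> a w)"
  have "fv.subspace ?S" by (rule L.subspace_image) simp
  moreover have "?S \<subseteq> vsp J" using alg_act_in_vsp by auto
  moreover have "invariant UNIV J \<sigma> ?S" unfolding invariant_def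
  proof (intro ballI)
    fix g v assume "v \<in> ?S"
    then obtain a where v: "v = alg_act J \<sigma> a w" by blast
    have "mact J \<sigma> g v = alg_act J \<sigma> (conv (delta g) a) w" unfolding v alg_act_conv alg_act_delta ..
    then show "mact J \<sigma> g v \<in> ?S" by blast
  qed
  ultimately have "?S = {0} \<or> ?S = vsp J" by (intro simple_modD(3)[OF s])
  moreover have "w \<in> ?S" by (rule range_eqI[of _ _ alg_one]) (rule alg_act_one[OF w(1), symmetric])
  ultimately have "v \<in> ?S" using w v by auto
  then show thesis using that by blast
qed

text \<open>If \<open>a\<close> did not kill \<open>v\<close>, some \<open>x\<close> would return
  the image to \<open>v\<close>, so \<open>1 - x a\<close> would kill \<open>v\<close>. But
  \<open>1 - x a\<close> has a left inverse for \<open>a\<close> in the radical.\<close>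

lemma jrad_acts_zero:
  assumes s: "simple_mod UNIV (*) 1 J \<sigma>" and a: "a \<in> jrad" and v: "v \<in> vsp J"
  shows "alg_act J \<sigma> a v = 0"
proof (rule ccontr)
  assume "alg_act J \<sigma> a v \<noteq> 0"
  then obtain x where x: "v = alg_act J \<sigma> x (alg_act J \<sigma> a v)"
    using alg_act_cyclic[OF s alg_act_in_vsp _ v] by blast
  interpret L: Vector_Spaces.linear vsmul vsmul "\<lambda>a. alg_act J \<sigma> a v" by (rule alg_act_left)
  obtain y where y: "conv y (vsub alg_one (conv x a)) = alg_one" using a unfolding jrad_def by blast
  have "alg_act J \<sigma> (vsub alg_one (conv x a)) v = 0"
    unfolding vsub_eq L.diff alg_act_one[OF v] alg_act_conv using x by simp
  then have "alg_act J \<sigma> (conv y (vsub alg_one (conv x a))) v = 0"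
    unfolding alg_act_conv by (simp only: flin_zero[OF flin_alg_act])
  then have "v = 0" unfolding y alg_act_one[OF v] .
  then show False using \<open>alg_act J \<sigma> a v \<noteq> 0\<close> flin_zero[OF flin_alg_act] by simp
qed

end

text \<open>The radical acts by zero, so only the image in the product of matrix algebras counts.
  Some block acts nontrivially; its matrix units produce a spanning family together with
  coordinates, from which any operator can be assembled.\<close>

lemma splitting_dens:
  fixes J :: "'j set" and \<sigma> :: "'m::{monoid_mult,finite} \<Rightarrow> 'j \<Rightarrow> 'j \<Rightarrow> 'k::field"
  assumes split: "splitting_field TYPE('m) TYPE('k)" and s: "simple_mod UNIV (*) 1 J \<sigma>"
  shows "dens UNIV J \<sigma>"
proof -
  have rep: "is_rep UNIV (*) 1 J \<sigma>" by (rule simple_modD(1)[OF s])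
  let ?A = "alg_act J \<sigma>"
  obtain r n and \<phi> :: "('m \<Rightarrow> 'k) \<Rightarrow> nat \<Rightarrow> nat \<Rightarrow> nat \<Rightarrow> 'k" where
    pos: "\<forall>i<r. n i > 0" and
    add: "\<forall>a b. \<forall>i<r. \<forall>p<n i. \<forall>q<n i. \<phi> (vadd a b) i p q = \<phi> a i p q + \<phi> b i p q" and
    scale: "\<forall>c a. \<forall>i<r. \<forall>p<n i. \<forall>q<n i. \<phi> (vsmul c a) i p q = c * \<phi> a i p q" and
    mult: "\<forall>a b. \<forall>i<r. \<forall>p<n i. \<forall>q<n i. \<phi> (conv a b) i p q = (\<Sum>l<n i. \<phi> a i p l * \<phi> b i l q)" and
    one: "\<forall>i<r. \<forall>p<n i. \<forall>q<n i. \<phi> alg_one i p q = (if p = q then 1 else 0)" and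
    surj: "\<forall>B::nat \<Rightarrow> nat \<Rightarrow> nat \<Rightarrow> 'k. \<exists>a. \<forall>i<r. \<forall>p<n i. \<forall>q<n i. \<phi> a i p q = B i p q" and
    ker: "\<forall>a. a \<in> jrad \<longleftrightarrow> (\<forall>i<r. \<forall>p<n i. \<forall>q<n i. \<phi> a i p q = 0)"
    using split unfolding splitting_field_def by (elim exE conjE) blast
  define R where "R i p q \<longleftrightarrow> i < r \<and> p < n i \<and> q < n i" for i p q
  have add': "\<phi> (a + b) i p q = \<phi> a i p q + \<phi> b i p q" if "R i p q" for a b i p q
    using add that unfolding vadd_eq R_def by blast
  have scale': "\<phi> (vsmul c a) i p q = c * \<phi> a i p q" if "R i p q" for c a i p q
    using scale that unfolding R_def by blast
  have zero': "\<phi> 0 i p q = 0" if "R i p q" for i p q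
    using scale'[OF that, of 0 0] by (simp only: fv.scale_zero_left mult_zero_left)
  have sum': "\<phi> (\<Sum>x\<in>S. f x) i p q = (\<Sum>x\<in>S. \<phi> (f x) i p q)" if R: "R i p q" for S and f :: "nat \<Rightarrow> 'm \<Rightarrow> 'k" and i p q
    by (induction S rule: infinite_finite_induct) (simp_all add: zero'[OF R] add'[OF R] del: zero_fun_apply plus_fun_apply)
  have diff': "\<phi> (a - b) i p q = \<phi> a i p q - \<phi> b i p q" if "R i p q" for a b i p q
    using add'[OF that, of "a - b" b] by (simp only: diff_add_cancel) (simp add: algebra_simps)
  have mult': "\<phi> (conv a b) i p q = (\<Sum>l<n i. \<phi> a i p l * \<phi> b i l q)" if "R i p q" for a b i p q
    using mult that unfolding R_def by blast
  have act_eq: "?A a v = ?A b v" if h: "\<And>i p q. R i p q \<Longrightarrow> \<phi> a i p q = \<phi> b i p q" and v: "v \<in> vsp J" for a b v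
  proof -
    interpret L: Vector_Spaces.linear vsmul vsmul "\<lambda>a. ?A a v" by (rule alg_act_left[OF rep])
    have "\<phi> (a - b) i p q = 0" if "R i p q" for i p q using diff'[OF that] h[OF that] by simp
    then have "a - b \<in> jrad" using ker unfolding R_def by blast
    then have "?A (a - b) v = 0" by (rule jrad_acts_zero[OF rep s _ v])
    then show ?thesis unfolding L.diff by (simp only: right_minus_eq)
  qed
  \<comment> \<open>These preimages multiply like matrix units only modulo the radical, a difference
    that \<open>act_eq\<close> makes invisible on the module.\<close>
  define E where "E i p q = (SOME a. \<forall>j<r. \<forall>x<n j. \<forall>y<n j. \<phi> a j x y = (if j = i \<and> x = p \<and> y = q then 1 else 0))" for i p q
  have E0: "\<forall>j<r. \<forall>x<n j. \<forall>y<n j. \<phi> (E i p q) j x y = (if j = i \<and> x = p \<and> y = q then 1 else 0)" for i p q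
  proof -
    have "\<exists>a. \<forall>j<r. \<forall>x<n j. \<forall>y<n j. \<phi> a j x y = (if j = i \<and> x = p \<and> y = q then 1 else 0)"
      by (rule surj[THEN spec])
    from someI_ex[OF this] show ?thesis unfolding E_def .
  qed
  have E: "\<phi> (E i p q) j x y = (if j = i \<and> x = p \<and> y = q then 1 else 0)" if "R j x y" for i p q j x y
    using E0 that unfolding R_def by blast
  obtain v0 :: "'j \<Rightarrow> 'k" where v0: "v0 \<in> vsp J" "v0 \<noteq> 0"
    using simple_modD(2)[OF s] fv.subspace_0[OF subspace_vsp] by blast
  \<comment> \<open>The diagonal units sum to 1 modulo the radical, so they cannot all kill
    \<open>v0\<close>.\<close>
  have "\<exists>i<r. \<exists>p<n i. ?A (E i p p) v0 \<noteq> 0"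
  proof (rule ccontr)
    assume "\<not> ?thesis"
    then have z: "\<And>i p. i < r \<Longrightarrow> p < n i \<Longrightarrow> ?A (E i p p) v0 = 0" by blast
    interpret L: Vector_Spaces.linear vsmul vsmul "\<lambda>a. ?A a v0" by (rule alg_act_left[OF rep])
    have "v0 = ?A alg_one v0" by (rule alg_act_one[OF rep v0(1), symmetric])
    also have "\<dots> = ?A (\<Sum>i<r. \<Sum>p<n i. E i p p) v0"
    proof (rule act_eq[OF _ v0(1)])
      fix j x y assume R: "R j x y"
      have "\<phi> (\<Sum>i<r. \<Sum>p<n i. E i p p) j x y = (\<Sum>i<r. \<Sum>p<n i. \<phi> (E i p p) j x y)"
        unfolding sum'[OF R] ..
      also have "\<dots> = (\<Sum>i<r. if i = j then (\<Sum>p<n j. if p = x then (if x = y then 1 else 0) else 0) else 0)"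
      proof (rule sum.cong[OF refl])
        fix i
        have "(\<Sum>p<n j. if x = p \<and> y = p then 1 else (0::'k)) = (\<Sum>p<n j. if p = x then (if x = y then 1 else 0) else 0)"
          by (rule sum.cong) auto
        then show "(\<Sum>p<n i. \<phi> (E i p p) j x y) = (if i = j then (\<Sum>p<n j. if p = x then (if x = y then 1 else 0) else 0) else 0)"
          unfolding E[OF R] by auto
      qed
      also have "\<dots> = (if x = y then 1 else 0)" using R by (simp add: R_def)
      finally show "\<phi> alg_one j x y = \<phi> (\<Sum>i<r. \<Sum>p<n i. E i p p) j x y" using one R by (simp add: R_def)
    qed
    also have "\<dots> = (\<Sum>i<r. \<Sum>p<n i. ?A (E i p p) v0)" unfolding L.sum ..
    also have "\<dots> = 0" using z by (intro sum.neutral ballI) simp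
    finally show False using v0 by simp
  qed
  then obtain i p where ip: "i < r" "p < n i" and w0: "?A (E i p p) v0 \<noteq> 0" by blast
  \<comment> \<open>The vectors \<open>E i t p w\<close> span the module, and the matrix units permute them, up to factors \<open>0\<close> and \<open>1\<close>.\<close>
  define w where "w = ?A (E i p p) v0"
  have w: "w \<in> vsp J" "w \<noteq> 0" using w0 alg_act_in_vsp[OF rep] unfolding w_def by simp_all
  define U where "U t = ?A (E i t p) w" for t
  have EE: "\<phi> (conv a (E i t p)) j x y = (if j = i \<and> y = p then \<phi> a i x t else 0)" if R: "R j x y" and t: "t < n i" for a t j x y
  proof -
    have "\<phi> (conv a (E i t p)) j x y = (\<Sum>l<n j. \<phi> a j x l * (if j = i \<and> l = t \<and> y = p then 1 else 0))"
      unfolding mult'[OF R]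
    proof (rule sum.cong[OF refl])
      fix l assume "l \<in> {..<n j}"
      then have "R j l y" using R by (simp add: R_def)
      from E[OF this] show "\<phi> a j x l * \<phi> (E i t p) j l y = \<phi> a j x l * (if j = i \<and> l = t \<and> y = p then 1 else 0)"
        by simp
    qed
    also have "\<dots> = (\<Sum>l<n j. if l = t then (if j = i \<and> y = p then \<phi> a j x t else 0) else 0)"
      by (intro sum.cong) auto
    also have "\<dots> = (if j = i \<and> y = p then \<phi> a i x t else 0)" using t by auto
    finally show ?thesis .
  qed
  have act_w: "?A (E i p p) w = w" unfolding w_def alg_act_conv[OF rep, symmetric]
    using E ip by (intro act_eq v0) (auto simp: EE)
  have expand: "?A a w = (\<Sum>t<n i. vsmul (\<phi> a i t p) (U t))" for a
  proof -
    interpret L: Vector_Spaces.linear vsmul vsmul "\<lambda>a. ?A a w" by (rule alg_act_left[OF rep])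
    have "?A a w = ?A (conv a (E i p p)) w" unfolding alg_act_conv[OF rep] act_w ..
    also have "\<dots> = ?A (\<Sum>t<n i. vsmul (\<phi> a i t p) (E i t p)) w"
    proof (rule act_eq[OF _ w(1)])
      fix j x y assume R: "R j x y"
      have "\<phi> (\<Sum>t<n i. vsmul (\<phi> a i t p) (E i t p)) j x y = (\<Sum>t<n i. if t = x then (if j = i \<and> y = p then \<phi> a i x p else 0) else 0)"
        unfolding sum'[OF R] scale'[OF R] E[OF R] by (intro sum.cong) auto
      then show "\<phi> (conv a (E i p p)) j x y = \<phi> (\<Sum>t<n i. vsmul (\<phi> a i t p) (E i t p)) j x y"
        unfolding EE[OF R ip(2)] using R by (auto simp: R_def)
    qed
    also have "\<dots> = (\<Sum>t<n i. vsmul (\<phi> a i t p) (U t))" unfolding L.sum L.scale U_def ..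
    finally show ?thesis .
  qed
  have coord: "?A (E i p q) (U t) = (if q = t then w else 0)" if qt: "q < n i" "t < n i" for q t
  proof -
    have "?A (E i p q) (U t) = ?A (conv (E i p q) (E i t p)) w" unfolding U_def alg_act_conv[OF rep] ..
    also have "\<dots> = ?A (if q = t then E i p p else 0) w"
    proof (rule act_eq[OF _ w(1)])
      fix j x y assume R: "R j x y"
      have "\<phi> (E i p q) i x t = (if x = p \<and> t = q then 1 else 0)" if "j = i" using E[of i x t] R qt that by (auto simp: R_def)
      then show "\<phi> (conv (E i p q) (E i t p)) j x y = \<phi> (if q = t then E i p p else 0) j x y"
        unfolding EE[OF R qt(2)] using E[OF R] zero'[OF R] by (auto simp del: zero_fun_apply)
    qed
    also have "\<dots> = (if q = t then w else 0)" using act_w flin_zero[OF alg_act_left[OF rep]] by simp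
    finally show ?thesis .
  qed
  show ?thesis unfolding dens_def
  proof
    fix X :: "'j \<Rightarrow> 'j \<Rightarrow> 'k"
    define F where "F = mact J (\<lambda>_::unit. X) ()"
    interpret F: Vector_Spaces.linear vsmul vsmul F unfolding F_def by (rule flin_mact)
    have "\<forall>t. \<exists>b. F (U t) = ?A b w"
    proof
      fix t
      obtain b where "F (U t) = ?A b w" using alg_act_cyclic[OF rep s w, of "F (U t)"] mact_in_vsp unfolding F_def by metis
      then show "\<exists>b. F (U t) = ?A b w" by (rule exI[of "\<lambda>b. F (U t) = ?A b w"])
    qed
    from choice[OF this] obtain b where b: "\<And>t. F (U t) = ?A (b t) w" by blast
    \<comment> \<open>\<open>E i p t\<close> reads off the coordinate at \<open>t\<close> and puts
      it on \<open>w\<close>; then \<open>b t\<close> moves \<open>w\<close> to the desired image of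
      \<open>U t\<close>.\<close>
    define a where "a = (\<Sum>t<n i. conv (b t) (E i p t))"
    have aF: "?A a v = F v" if v: "v \<in> vsp J" for v
    proof -
      interpret L: Vector_Spaces.linear vsmul vsmul "\<lambda>a. ?A a v" by (rule alg_act_left[OF rep])
      obtain c where c: "v = ?A c w" using alg_act_cyclic[OF rep s w v] by blast
      have Ev: "?A (E i p t) v = vsmul (\<phi> c i t p) w" if t: "t < n i" for t
      proof -
        interpret K: Vector_Spaces.linear vsmul vsmul "?A (E i p t)" by (rule flin_alg_act[OF rep])
        have "?A (E i p t) v = (\<Sum>q<n i. vsmul (\<phi> c i q p) (?A (E i p t) (U q)))"
          unfolding c expand K.sum K.scale ..
        also have "\<dots> = (\<Sum>q<n i. if q = t then vsmul (\<phi> c i t p) w else 0)"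
          using coord t by (intro sum.cong) auto
        finally show ?thesis using t by simp
      qed
      have "?A a v = (\<Sum>t<n i. ?A (b t) (?A (E i p t) v))" unfolding a_def L.sum alg_act_conv[OF rep] ..
      also have "\<dots> = (\<Sum>t<n i. vsmul (\<phi> c i t p) (?A (b t) w))"
      proof (rule sum.cong[OF refl])
        fix t assume "t \<in> {..<n i}"
        then have "t < n i" by simp
        interpret K: Vector_Spaces.linear vsmul vsmul "?A (b t)" by (rule flin_alg_act[OF rep])
        show "?A (b t) (?A (E i p t) v) = vsmul (\<phi> c i t p) (?A (b t) w)" unfolding Ev[OF \<open>t < n i\<close>] K.scale ..
      qed
      also have "\<dots> = F v" unfolding c expand F.sum F.scale b ..
      finally show ?thesis .
    qed
    have "(\<Sum>g\<in>UNIV. a g * \<sigma> g x y) = X x y" if xy: "x \<in> J" "y \<in> J" for x y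
    proof -
      have fJ: "finite J" using rep by (simp add: is_rep_def)
      have col1: "mact J (\<lambda>_::unit. X) () (delta y) x = X x y"
      proof -
        have "(\<Sum>j\<in>J. X x j * delta y j) = (\<Sum>j\<in>J. if j = y then X x y else 0)"
          by (rule sum.cong) (auto simp: delta_def)
        then show ?thesis using fJ xy by (simp add: mact_def)
      qed
      have col2: "mact J \<sigma> g (delta y) x = \<sigma> g x y" for g
      proof -
        have "(\<Sum>j\<in>J. \<sigma> g x j * delta y j) = (\<Sum>j\<in>J. if j = y then \<sigma> g x y else 0)"
          by (rule sum.cong) (auto simp: delta_def)
        then show ?thesis using fJ xy by (simp add: mact_def)
      qed
      have "?A a (delta y) x = F (delta y) x" unfolding aF[OF delta_in_vsp[OF xy(2)]] ..
      then show ?thesis unfolding alg_act_def F_def col1 sum_fun_apply vsmul_apply col2 .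
    qed
    then show "\<exists>a. \<forall>i\<in>J. \<forall>j\<in>J. (\<Sum>g\<in>UNIV. a g * \<sigma> g i j) = X i j" by blast
  qed
qed

section \<open>Inflation and the simple modules\<close>

lemma simple_modI:
  fixes \<sigma> :: "'g \<Rightarrow> 'j \<Rightarrow> 'j \<Rightarrow> 'k::field"
  assumes r: "is_rep C mul u J \<sigma>" and n: "(vsp J :: ('j \<Rightarrow> 'k) set) \<noteq> {0}"
    and S: "\<And>S :: ('j \<Rightarrow> 'k) set. S \<subseteq> vsp J \<Longrightarrow> fv.subspace S \<Longrightarrow> invariant C J \<sigma> S \<Longrightarrow> S = {0} \<or> S = vsp J"
  shows "simple_mod C mul u J \<sigma>"
proof -
  have "section_ok C mul u J \<sigma> (vsp J) {0}"
    unfolding section_ok_def lsubspace_iff invariant_def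
    using r subspace_vsp mact_in_vsp fv.subspace_0[OF subspace_vsp] fv.subspace_single_0 mact_zero by auto
  then show ?thesis using n S unfolding simple_mod_def simple_sec_def vzero_eq lsubspace_iff by metis
qed

lemma mact_delta:
  assumes "finite I" "i \<in> I" "j \<in> I" shows "mact I \<rho> g (delta j) i = \<rho> g i j"
proof -
  have "(\<Sum>l\<in>I. \<rho> g i l * delta j l) = (\<Sum>l\<in>I. if l = j then \<rho> g i j else 0)"
    by (rule sum.cong) (auto simp: delta_def)
  then show ?thesis using assms by (simp add: mact_def)
qed

lemma mact_cong:
  assumes "\<And>i j. i \<in> I \<Longrightarrow> j \<in> I \<Longrightarrow> \<rho> g i j = \<rho>' h i j" shows "mact I \<rho> g v = mact I \<rho>' h v"
  unfolding mact_def using assms by (auto intro!: sum.cong)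

lemma corner_gunit: "(e::'m::{monoid_mult,finite}) * e = e \<Longrightarrow> g \<in> Gunits e \<Longrightarrow> e * g * e = g"
  by (auto simp: Gunits_iff)

lemma Gunits_geD: "(e::'m::{monoid_mult,finite}) * e = e \<Longrightarrow> g \<in> Gunits e \<Longrightarrow> ge e g"
  by (auto simp: Gunits_iff)

context rect_monoid begin

lemma infl_eq: fixes e :: 'm assumes "e * e = e"
  shows "infl e \<rho> m i j = (if ge e m then \<rho> (e * m * e) i j else 0)"
  unfolding infl_def subset_sigma_iff[OF assms] ..

lemma mact_infl: fixes e :: 'm assumes "e * e = e"
  shows "mact I (infl e \<rho>) m v = (if ge e m then mact I \<rho> (e * m * e) v else 0)"
proof (cases "ge e m")
  case True
  then show ?thesis by (auto intro!: mact_cong simp: infl_eq[OF assms])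
next
  case False
  then show ?thesis by (intro ext) (simp add: mact_def infl_eq[OF assms])
qed

lemma mact_infl_gunit: fixes e :: 'm assumes "e * e = e" "g \<in> Gunits e"
  shows "mact I (infl e \<rho>) g v = mact I \<rho> g v"
  unfolding mact_infl[OF assms(1)] corner_gunit[OF assms] using Gunits_geD[OF assms] by simp

text \<open>If both factors lie in \<open>M_X\<close>, this is \<open>corner_mult\<close>. Otherwise
  their product is outside \<open>M_X\<close> too, and both sides vanish.\<close>

lemma infl_rep: fixes e :: 'm
  assumes e: "e * e = e" and r: "is_rep (Gunits e) (*) e I \<rho>"
  shows "is_rep UNIV (*) 1 I (infl e \<rho>)"
  unfolding is_rep_def
proof (intro conjI ballI)
  show "finite I" using r by (simp add: is_rep_def)
  have "ge e 1" by (rule geI[of _ 1 _ e]) simp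
  then show "infl e \<rho> 1 i j = (if i = j then 1 else 0)" if "i \<in> I" "j \<in> I" for i j
    using r that e by (simp add: infl_eq[OF e] is_rep_def)
  fix m n i j assume ij: "i \<in> I" "j \<in> I"
  show "infl e \<rho> (m * n) i j = (\<Sum>l\<in>I. infl e \<rho> m i l * infl e \<rho> n l j)"
  proof (cases "ge e m \<and> ge e n")
    case True
    have "e * (m * n) * e = e * m * e * (e * n * e)" using corner_mult[OF e] True by (simp add: mult.assoc)
    then show ?thesis using True r ij corner_unit[OF e] by (simp add: infl_eq[OF e] ge_mult_iff[OF e] is_rep_def)
  next
    case False
    then show ?thesis by (auto simp add: infl_eq[OF e] ge_mult_iff[OF e])
  qed
qed

text \<open>On the group at \<open>e\<close> the inflated action is the given one, so every
  submodule for M is a submodule for the group.\<close>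

lemma infl_simple: fixes e :: 'm
  assumes e: "e * e = e" and s: "simple_mod (Gunits e) (*) e I \<rho>"
  shows "simple_mod UNIV (*) 1 I (infl e \<rho>)"
proof (rule simple_modI[OF infl_rep[OF e simple_modD(1)[OF s]] simple_modD(2)[OF s]])
  fix S assume S: "S \<subseteq> vsp I" "fv.subspace S" "invariant UNIV I (infl e \<rho>) S"
  have "invariant (Gunits e) I \<rho> S"
    using S(3) unfolding invariant_def by (metis UNIV_I mact_infl_gunit[OF e])
  then show "S = {0} \<or> S = vsp I" using simple_modD(3)[OF s S(1,2)] by blast
qed

text \<open>The apex of a simple module: among the elements that act nontrivially, one with a least
  ideal leads to the idempotent \<open>e0\<close>. Every \<open>e\<close> generating the same ideal
  is covered, so that the chosen \<open>e_X\<close> qualifies.\<close>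

lemma simple_is_infl:
  fixes \<rho> :: "'m \<Rightarrow> 'i \<Rightarrow> 'i \<Rightarrow> 'k::field"
  assumes s: "simple_mod UNIV (*) 1 I \<rho>"
  obtains e0 :: 'm where "e0 * e0 = e0"
    "\<And>e. e * e = e \<Longrightarrow> ge e e0 \<Longrightarrow> ge e0 e \<Longrightarrow>
       simple_mod (Gunits e) (*) e I \<rho> \<and> (\<forall>m v. mact I \<rho> m v = mact I (infl e \<rho>) m v)"
proof -
  have rep: "is_rep UNIV (*) 1 I \<rho>" by (rule simple_modD(1)[OF s])
  have finI: "finite I" using rep by (simp add: is_rep_def)
  let ?V = "vsp I :: ('i \<Rightarrow> 'k) set"
  define act where "act m v = mact I \<rho> m v" for m and v :: "'i \<Rightarrow> 'k"
  have act_mul: "act (m * n) v = act m (act n v)" for m n v unfolding act_def using mact_mul[OF rep] by simp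
  have act_V: "act m v \<in> ?V" for m v unfolding act_def by (rule mact_in_vsp)
  have act0: "act m 0 = 0" for m unfolding act_def by (rule mact_zero)
  have act_sum: "act m (\<Sum>x\<in>UNIV. vsmul (a x) (F x)) = (\<Sum>x\<in>UNIV. vsmul (a x) (act m (F x)))" for m and a :: "'m \<Rightarrow> 'k" and F
  proof -
    interpret L: Vector_Spaces.linear vsmul vsmul "act m" unfolding act_def by (rule flin_mact)
    show ?thesis unfolding L.sum L.scale ..
  qed
  have cyc: "\<exists>a :: 'm \<Rightarrow> 'k. v = (\<Sum>x\<in>UNIV. vsmul (a x) (act x w))" if w: "w \<in> ?V" "w \<noteq> 0" and v: "v \<in> ?V" for v w
  proof -
    obtain x where "v = alg_act I \<rho> x w" using alg_act_cyclic[OF rep s w v] by blast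
    then show ?thesis unfolding alg_act_def act_def by blast
  qed
  define nz where "nz m \<longleftrightarrow> (\<exists>v\<in>?V. act m v \<noteq> 0)" for m
  have "nz 1"
  proof -
    obtain v where "v \<in> ?V" "v \<noteq> 0" using simple_modD(2)[OF s] fv.subspace_0[OF subspace_vsp, of I] by blast
    then show ?thesis unfolding nz_def act_def using mact_one[OF rep] by metis
  qed
  then obtain m0 where m0: "nz m0" "\<And>m. nz m \<Longrightarrow> card (ideal_of m0) \<le> card (ideal_of m)"
    using ex_has_least_nat[of nz 1 "\<lambda>m. card (ideal_of m)"] by blast
  have min0: "ge m0 m" if "nz m" "ge m m0" for m
  proof -
    have "ideal_of m = ideal_of m0"
      by (rule card_subset_eq) (use that m0(2)[OF that(1)] card_mono[of "ideal_of m0" "ideal_of m"] in \<open>auto simp: ideal_subset_iff\<close>)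
    then show ?thesis by (simp add: ideal_eq_iff)
  qed
  \<comment> \<open>If every \<open>m0 * x * m0\<close> acted as zero, \<open>m0\<close> would kill
    the submodule generated by a nonzero vector \<open>act m0 v\<close>, which is
    everything.\<close>
  obtain x where x: "nz (m0 * x * m0)"
  proof (rule ccontr)
    assume "\<not> thesis"
    then have z: "\<And>x. \<not> nz (m0 * x * m0)" using that by blast
    obtain v where v: "v \<in> ?V" "act m0 v \<noteq> 0" using m0(1) by (auto simp: nz_def)
    obtain a where a: "v = (\<Sum>x\<in>UNIV. vsmul (a x) (act x (act m0 v)))" using cyc[OF act_V v(2) v(1)] by blast
    have "act m0 v = (\<Sum>x\<in>UNIV. vsmul (a x) (act m0 (act x (act m0 v))))" by (subst a) (rule act_sum)
    also have "\<dots> = 0"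
    proof (rule sum.neutral, rule ballI)
      fix x
      have "act (m0 * x * m0) v = 0" using z[of x] v(1) unfolding nz_def by blast
      then show "vsmul (a x) (act m0 (act x (act m0 v))) = 0" unfolding act_mul by simp
    qed
    finally show False using v by blast
  qed
  have "ge (m0 * x * m0) m0" by (rule ge_mult_right)
  then obtain a b where ab: "m0 = a * (m0 * x * m0) * b" using min0[OF x] by (auto simp: ge_def)
  have iter: "m0 = (a * m0 * x) ^ n * m0 * b ^ n" for n
  proof (induction n)
    case (Suc n)
    have "m0 = (a * m0 * x) ^ n * (a * (m0 * x * m0) * b) * b ^ n" using Suc ab by metis
    also have "\<dots> = (a * m0 * x) ^ Suc n * m0 * b ^ Suc n" unfolding power_Suc2[of "a * m0 * x"] power_Suc[of b] by (simp add: mult.assoc)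
    finally show ?case .
  qed simp
  obtain n where n: "n > 0" "(a * m0 * x) ^ n * (a * m0 * x) ^ n = (a * m0 * x) ^ n" using exists_idem_power by blast
  define e0 where "e0 = (a * m0 * x) ^ n"
  have e0: "e0 * e0 = e0" using n by (simp add: e0_def)
  have e0m0: "m0 = e0 * m0 * b ^ n" unfolding e0_def by (rule iter)
  have e0m: "e0 * m0 = m0"
  proof -
    have "e0 * m0 = e0 * (e0 * m0 * b ^ n)" using e0m0 by simp
    also have "\<dots> = e0 * m0 * b ^ n" by (simp add: mult.assoc assoc_ext[OF e0])
    also have "\<dots> = m0" by (rule e0m0[symmetric])
    finally show ?thesis .
  qed
  have ge0: "ge e0 m0"
  proof -
    obtain k where "n = Suc k" using n(1) by (cases n) auto
    then have "e0 = a * m0 * (x * (a * m0 * x) ^ k)" by (simp add: e0_def mult.assoc)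
    then show ?thesis by (rule geI)
  qed
  have nz0: "nz e0"
  proof -
    obtain v where v: "v \<in> ?V" "act m0 v \<noteq> 0" using m0(1) by (auto simp: nz_def)
    have "act e0 (act m0 v) \<noteq> 0" using v(2) unfolding act_mul[symmetric] e0m .
    then show ?thesis unfolding nz_def using act_V by blast
  qed
  show thesis
  proof (rule that[OF e0])
    fix e :: 'm assume e: "e * e = e" and ge_e: "ge e e0" "ge e0 e"
    obtain v0 where v0: "v0 \<in> ?V" "act e v0 \<noteq> 0"
    proof -
      obtain c d where cd: "e0 = c * e * d" using ge_e by (auto simp: ge_def)
      obtain v where v: "v \<in> ?V" "act e0 v \<noteq> 0" using nz0 by (auto simp: nz_def)
      have "act e (act d v) \<noteq> 0" using v(2) act0 unfolding cd act_mul by metis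
      then show thesis using that act_V by blast
    qed
    have min: "ge e m" if "nz m" "ge m e" for m
      using min0[OF that(1)] ge_trans[OF that(2)] ge_trans[OF ge_e(1)] ge0 ge_trans by blast
    have w0: "act e v0 \<in> ?V" by (rule act_V)
    \<comment> \<open>The vectors \<open>act (x * e) v0\<close> span the module. If
      \<open>m * x * e\<close> acted nontrivially, minimality would put \<open>m\<close> into
      \<open>M_X\<close>.\<close>
    have kill: "act m v = 0" if m: "\<not> ge e m" and v: "v \<in> ?V" for m v
    proof -
      obtain a where a: "v = (\<Sum>x\<in>UNIV. vsmul (a x) (act x (act e v0)))" using cyc[OF w0 v0(2) v] by blast
      have "act m v = (\<Sum>x\<in>UNIV. vsmul (a x) (act m (act x (act e v0))))" by (subst a) (rule act_sum)
      also have "\<dots> = 0"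
      proof (rule sum.neutral, rule ballI)
        fix x
        have "\<not> nz (m * x * e)" using min[OF _ ge_mult_right] m ge_multD by blast
        then have "act (m * x * e) v0 = 0" using v0(1) unfolding nz_def by blast
        then show "vsmul (a x) (act m (act x (act e v0))) = 0" unfolding act_mul by simp
      qed
      finally show ?thesis .
    qed
    \<comment> \<open>A nonzero \<open>u\<close> generates \<open>v0\<close>, which \<open>e\<close>
      does not kill; hence the elements of eM separate vectors.\<close>
    have sep: "u = 0" if u: "u \<in> ?V" and z: "\<And>y. act (e * y) u = 0" for u
    proof (rule ccontr)
      assume "u \<noteq> 0"
      then obtain a where a: "v0 = (\<Sum>x\<in>UNIV. vsmul (a x) (act x u))" using cyc[OF u _ v0(1)] by blast
      have "act e v0 = (\<Sum>x\<in>UNIV. vsmul (a x) (act e (act x u)))" by (subst a) (rule act_sum)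
      also have "\<dots> = 0"
      proof (rule sum.neutral, rule ballI)
        fix x show "vsmul (a x) (act e (act x u)) = 0" using z[of x] unfolding act_mul by simp
      qed
      finally show False using v0 by blast
    qed
    \<comment> \<open>Rectangularity enters here: it makes the apex idempotent act as the identity on the whole module.\<close>
    have fixw: "act (x * e) v0 = act (e * x * e) v0" for x
    proof -
      have "act (x * e) v0 - act (e * x * e) v0 = 0"
      proof (rule sep)
        show "act (x * e) v0 - act (e * x * e) v0 \<in> ?V" by (rule fv.subspace_diff[OF subspace_vsp act_V act_V])
        fix y
        have "act (e * y * (x * e)) v0 = act (e * y * (e * x * e)) v0"
        proof (cases "ge e y \<and> ge e x")
          case True
          then have "e * y * (x * e) = e * y * (e * x * e)"
            using corner_mult[OF e, of y x] by (simp add: mult.assoc assoc_ext[OF e])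
          then show ?thesis by simp
        next
          case False
          then have "\<not> ge e (e * y * (x * e))" "\<not> ge e (e * y * (e * x * e))" by (auto simp add: ge_mult_iff[OF e])
          then show ?thesis using kill v0(1) by metis
        qed
        then show "act (e * y) (act (x * e) v0 - act (e * x * e) v0) = 0"
          unfolding act_def mact_diff unfolding act_def[symmetric] act_mul[symmetric] by (simp only: right_minus_eq)
      qed
      then show ?thesis by (simp only: right_minus_eq)
    qed
    have id: "act e v = v" if v: "v \<in> ?V" for v
    proof -
      obtain a where a: "v = (\<Sum>x\<in>UNIV. vsmul (a x) (act x (act e v0)))" using cyc[OF w0 v0(2) v] by blast
      have "act e v = (\<Sum>x\<in>UNIV. vsmul (a x) (act e (act x (act e v0))))" by (subst a) (rule act_sum)
      also have "\<dots> = (\<Sum>x\<in>UNIV. vsmul (a x) (act x (act e v0)))"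
        using fixw unfolding act_mul by (intro sum.cong) simp_all
      finally show ?thesis using a by simp
    qed
    have infl_on: "act m v = mact I (infl e \<rho>) m v" if v: "v \<in> ?V" for m v
    proof (cases "ge e m")
      case True
      then show ?thesis unfolding mact_infl[OF e] act_def[symmetric] act_mul using id v act_V by simp
    next
      case False
      then show ?thesis unfolding mact_infl[OF e] using kill v by simp
    qed
    have infl: "mact I \<rho> m v = mact I (infl e \<rho>) m v" for m v
    proof -
      have r: "mact I \<tau> m v = mact I \<tau> m (\<lambda>i. if i \<in> I then v i else 0)" for \<tau> :: "'m \<Rightarrow> 'i \<Rightarrow> 'i \<Rightarrow> 'k"
        unfolding mact_def by (auto intro!: sum.cong)
      have "(\<lambda>i. if i \<in> I then v i else 0) \<in> ?V" by (simp add: vsp_def)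
      from infl_on[OF this, of m] show ?thesis unfolding act_def r[symmetric] .
    qed
    have "simple_mod (Gunits e) (*) e I \<rho>"
    proof (rule simple_modI[OF _ simple_modD(2)[OF s]])
      have "\<rho> e i j = (if i = j then 1 else 0)" if ij: "i \<in> I" "j \<in> I" for i j
      proof -
        have "\<rho> e i j = act e (delta j) i" unfolding act_def mact_delta[OF finI ij] ..
        then show ?thesis unfolding id[OF delta_in_vsp[OF ij(2)]] by (simp add: delta_def)
      qed
      then show "is_rep (Gunits e) (*) e I \<rho>" using rep by (simp add: is_rep_def)
      fix S assume S: "S \<subseteq> vsp I" "fv.subspace S" "invariant (Gunits e) I \<rho> S"
      have "invariant UNIV I \<rho> S" unfolding invariant_def infl unfolding mact_infl[OF e]
        using S(3) corner_unit[OF e] fv.subspace_0[OF S(2)] unfolding invariant_def by auto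
      then show "S = {0} \<or> S = vsp I" using simple_modD(3)[OF s S(1,2)] by blast
    qed
    then show "simple_mod (Gunits e) (*) e I \<rho> \<and> (\<forall>m v. mact I \<rho> m v = mact I (infl e \<rho>) m v)" using infl by blast
  qed
qed

lemma iso_modI_same_action:
  assumes "\<And>m v. m \<in> C \<Longrightarrow> mact I \<rho> m v = mact I \<rho>' m v"
  shows "iso_mod C I \<rho> I \<rho>'"
  unfolding iso_mod_def iso_sec_def vzero_eq vsub_eq
  by (rule exI[of _ "\<lambda>x. x"]) (use assms in auto)

text \<open>Each idempotent acts as the identity on its own module, so by the isomorphism it cannot
  act as zero on the other one. This puts each of them into the \<open>M_X\<close> belonging to the
  other.\<close>

lemma iso_infl:
  fixes \<rho> :: "'m \<Rightarrow> 'i \<Rightarrow> 'i \<Rightarrow> 'k::field" and \<rho>' :: "'m \<Rightarrow> 'j \<Rightarrow> 'j \<Rightarrow> 'k" and e e' :: 'm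
  assumes e: "e * e = e" and e': "e' * e' = e'"
    and s: "simple_mod (Gunits e) (*) e I \<rho>" and s': "simple_mod (Gunits e') (*) e' J \<rho>'"
    and iso: "iso_mod UNIV I (infl e \<rho>) J (infl e' \<rho>')"
  shows "ge e e'" "ge e' e" "e = e' \<Longrightarrow> iso_mod (Gunits e) I \<rho> J \<rho>'"
proof -
  obtain f where F: "\<forall>x\<in>vsp I. \<forall>y\<in>vsp I. f (x + y) = f x + f y" "\<forall>c. \<forall>x\<in>vsp I. f (vsmul c x) = vsmul c (f x)"
    and fJ: "f ` vsp I \<subseteq> vsp J" and inj0: "\<forall>x\<in>vsp I. (f x = 0) = (x = 0)"
    and surj: "\<forall>y\<in>vsp J. \<exists>x\<in>vsp I. y = f x"
    and eq0: "\<forall>m\<in>UNIV. \<forall>x\<in>vsp I. f (mact I (infl e \<rho>) m x) = mact J (infl e' \<rho>') m (f x)"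
    using iso unfolding iso_mod_def iso_sec_def vzero_eq vadd_eq vsub_eq right_minus_eq singleton_iff
    by (elim exE conjE) (rule that)
  note inj = inj0[rule_format]
  have eq: "f (mact I (infl e \<rho>) m x) = mact J (infl e' \<rho>') m (f x)" if "x \<in> vsp I" for m x
    using eq0 that by blast
  obtain x :: "'i \<Rightarrow> 'k" where x: "x \<in> vsp I" "x \<noteq> 0" using simple_modD(2)[OF s] fv.subspace_0[OF subspace_vsp, of I] by blast
  have G: "e \<in> Gunits e" "e' \<in> Gunits e'" using fin_group.u[OF fin_group_Gunits] e e' by blast+
  have ex: "mact I (infl e \<rho>) e x = x" unfolding mact_infl_gunit[OF e G(1)] by (rule mact_one[OF simple_modD(1)[OF s] x(1)])
  have fx: "f x \<in> vsp J" "f x \<noteq> 0" using fJ inj x by auto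
  have e'fx: "mact J (infl e' \<rho>') e' (f x) = f x"
    unfolding mact_infl_gunit[OF e' G(2)] by (rule mact_one[OF simple_modD(1)[OF s'] fx(1)])
  show "ge e' e"
  proof (rule ccontr)
    assume "\<not> ge e' e"
    then have "f x = 0" using eq[OF x(1), of e] unfolding ex by (simp only: mact_infl[OF e'] if_False)
    then show False using fx by blast
  qed
  show "ge e e'"
  proof (rule ccontr)
    assume "\<not> ge e e'"
    then have "f 0 = f x" using eq[OF x(1), of e'] unfolding e'fx by (simp only: mact_infl[OF e] if_False)
    moreover have "f 0 = 0" using inj fv.subspace_0[OF subspace_vsp] by blast
    ultimately show False using fx by simp
  qed
  show "iso_mod (Gunits e) I \<rho> J \<rho>'" if "e = e'"
    unfolding iso_mod_def iso_sec_def vzero_eq vadd_eq vsub_eq right_minus_eq singleton_iff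
  proof (intro exI[of _ f] conjI ballI allI)
    fix g and x :: "'i \<Rightarrow> 'k" assume g: "g \<in> Gunits e" and x: "x \<in> vsp I"
    show "f (mact I \<rho> g x) = mact J \<rho>' g (f x)"
      using eq[OF x, of g] unfolding mact_infl_gunit[OF e g] mact_infl_gunit[OF e' g[unfolded that]] .
  qed (rule F[rule_format] F(2)[rule_format] fJ inj surj[rule_format]; assumption)+
qed

text \<open>Coefficients are summed over the fibres of the corner map from \<open>M_X\<close> to the
  group; elements outside \<open>M_X\<close> contribute zero.\<close>

lemma dens_Gunits:
  fixes \<rho> :: "'m \<Rightarrow> 'i \<Rightarrow> 'i \<Rightarrow> 'k::field" and e :: 'm
  assumes e: "e * e = e" and d: "dens UNIV I (infl e \<rho>)"
  shows "dens (Gunits e) I \<rho>"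
  unfolding dens_def
proof
  fix X :: "'i \<Rightarrow> 'i \<Rightarrow> 'k"
  obtain a where a: "\<And>i j. i \<in> I \<Longrightarrow> j \<in> I \<Longrightarrow> (\<Sum>m\<in>UNIV. a m * infl e \<rho> m i j) = X i j"
    using d unfolding dens_def by metis
  define b where "b g = (\<Sum>m\<in>{m \<in> {m. ge e m}. e * m * e = g}. a m)" for g
  have "(\<Sum>g\<in>Gunits e. b g * \<rho> g i j) = X i j" if ij: "i \<in> I" "j \<in> I" for i j
  proof -
    have "(\<Sum>g\<in>Gunits e. b g * \<rho> g i j) = (\<Sum>g\<in>Gunits e. \<Sum>m\<in>{m \<in> {m. ge e m}. e * m * e = g}. a m * \<rho> (e * m * e) i j)"
      unfolding b_def sum_distrib_right by (intro sum.cong) auto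
    also have "\<dots> = (\<Sum>m\<in>{m. ge e m}. a m * \<rho> (e * m * e) i j)"
      by (rule sum.group) (use corner_unit[OF e] in auto)
    also have "\<dots> = (\<Sum>m\<in>UNIV. a m * infl e \<rho> m i j)"
      by (rule sum.mono_neutral_cong_left) (auto simp: infl_eq[OF e])
    finally show ?thesis using a ij by simp
  qed
  then show "\<exists>a. \<forall>i\<in>I. \<forall>j\<in>I. (\<Sum>g\<in>Gunits e. a g * \<rho> g i j) = X i j" by blast
qed

end

section \<open>The tensor product of V with the dual of U\<close>

lemma (in fin_group) inv_mul_rev: "g \<in> C \<Longrightarrow> h \<in> C \<Longrightarrow> inv (mul g h) = mul (inv h) (inv g)"
proof (rule inv_unique)
  assume g: "g \<in> C" and h: "h \<in> C"
  have "mul (mul (inv h) (inv g)) (mul g h) = mul (inv h) (mul (mul (inv g) g) h)"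
    using g h by (simp add: assoc mul inv)
  then show "mul (mul (inv h) (inv g)) (mul g h) = u" using g h by (simp add: inv_mul unit)
qed (simp_all add: mul inv)

lemma (in fin_group) inv_unit: "inv u = u"
  by (rule inv_unique) (simp_all add: u unit)

text \<open>Inversion reverses products in the U-factor and the exchange of matrix indices restores
  their order, so the dual is again a left module.\<close>

lemma tens_rep:
  fixes \<rho>V :: "'m::{monoid_mult,finite} \<Rightarrow> 'v \<Rightarrow> 'v \<Rightarrow> 'k::field" and \<rho>U :: "'m \<Rightarrow> 'u \<Rightarrow> 'u \<Rightarrow> 'k"
  assumes e: "e * e = e" and V: "is_rep (Gunits f) (*) f J \<rho>V" and U: "is_rep (Gunits e) (*) e I \<rho>U"
  shows "is_rep (GG f e) pmul (f, e) (J \<times> I) (tens e \<rho>V \<rho>U)"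
  unfolding is_rep_def
proof (intro conjI ballI)
  interpret E: fin_group "Gunits e" "(*)" e "ginv e" by (rule fin_group_Gunits[OF e])
  show "finite (J \<times> I)" using U V by (simp add: is_rep_def)
  show "tens e \<rho>V \<rho>U (f, e) x y = (if x = y then 1 else 0)" if "x \<in> J \<times> I" "y \<in> J \<times> I" for x y
  proof -
    have "\<rho>V f i j = (if i = j then 1 else 0)" if "i \<in> J" "j \<in> J" for i j using V that by (simp add: is_rep_def)
    moreover have "\<rho>U e i j = (if i = j then 1 else 0)" if "i \<in> I" "j \<in> I" for i j using U that by (simp add: is_rep_def)
    ultimately show ?thesis using that by (cases x; cases y) (simp add: tens_def E.inv_unit)
  qed
  fix p q x y assume p: "p \<in> GG f e" "q \<in> GG f e" and xy: "x \<in> J \<times> I" "y \<in> J \<times> I"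
  obtain g h g' h' j i j' i' where pq: "p = (g, h)" "q = (g', h')" "x = (j, i)" "y = (j', i')"
    by (metis surj_pair)
  have m: "g \<in> Gunits f" "h \<in> Gunits e" "g' \<in> Gunits f" "h' \<in> Gunits e" "j \<in> J" "j' \<in> J" "i \<in> I" "i' \<in> I"
    using p xy pq by (auto simp: GG_def)
  have "tens e \<rho>V \<rho>U (pmul p q) x y = \<rho>V (g * g') j j' * \<rho>U (ginv e h' * ginv e h) i' i"
    unfolding pq by (simp add: tens_def pmul_def E.inv_mul_rev m)
  also have "\<dots> = (\<Sum>l\<in>J. \<rho>V g j l * \<rho>V g' l j') * (\<Sum>l\<in>I. \<rho>U (ginv e h') i' l * \<rho>U (ginv e h) l i)"
    using U V m E.inv by (simp add: is_rep_def)
  also have "\<dots> = (\<Sum>l\<in>J. \<Sum>t\<in>I. tens e \<rho>V \<rho>U p x (l, t) * tens e \<rho>V \<rho>U q (l, t) y)"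
    unfolding sum_product pq tens_def by (simp add: mult.assoc mult.left_commute mult.commute)
  also have "\<dots> = (\<Sum>l\<in>J \<times> I. tens e \<rho>V \<rho>U p x l * tens e \<rho>V \<rho>U q l y)"
    unfolding sum.cartesian_product by (simp add: case_prod_beta)
  finally show "tens e \<rho>V \<rho>U (pmul p q) x y = (\<Sum>l\<in>J \<times> I. tens e \<rho>V \<rho>U p x l * tens e \<rho>V \<rho>U q l y)" .
qed

text \<open>The target matrix is cut into blocks indexed by pairs \<open>p\<close> from
  \<open>J\<close>: \<open>a p\<close> realises the matrix unit at \<open>p\<close> on V, and
  \<open>b p\<close> the transposed block on U. The inverse in \<open>c\<close> matches the one by
  which the group acts on the dual.\<close>

lemma dens_tens:
  fixes \<rho>V :: "'m::{monoid_mult,finite} \<Rightarrow> 'v \<Rightarrow> 'v \<Rightarrow> 'k::field" and \<rho>U :: "'m \<Rightarrow> 'u \<Rightarrow> 'u \<Rightarrow> 'k"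
  assumes e: "e * e = e" and V: "dens (Gunits f) J \<rho>V" and U: "dens (Gunits e) I \<rho>U" and fJ: "finite J"
  shows "dens (GG f e) (J \<times> I) (tens e \<rho>V \<rho>U)"
  unfolding dens_def
proof
  interpret E: fin_group "Gunits e" "(*)" e "ginv e" by (rule fin_group_Gunits[OF e])
  fix X :: "'v \<times> 'u \<Rightarrow> 'v \<times> 'u \<Rightarrow> 'k"
  have "\<forall>p. \<exists>a. \<forall>i\<in>J. \<forall>j\<in>J. (\<Sum>g\<in>Gunits f. a g * \<rho>V g i j) = (if (i, j) = p then 1 else 0)"
    by (rule allI) (rule V[unfolded dens_def, THEN spec])
  from choice[OF this] obtain a where
    a: "\<And>p i j. i \<in> J \<Longrightarrow> j \<in> J \<Longrightarrow> (\<Sum>g\<in>Gunits f. a p g * \<rho>V g i j) = (if (i, j) = p then 1 else 0)" by blast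
  have "\<forall>p. \<exists>b. \<forall>i\<in>I. \<forall>j\<in>I. (\<Sum>h\<in>Gunits e. b h * \<rho>U h i j) = X (fst p, j) (snd p, i)"
    by (rule allI) (rule U[unfolded dens_def, THEN spec])
  from choice[OF this] obtain b where
    b: "\<And>p i j. i \<in> I \<Longrightarrow> j \<in> I \<Longrightarrow> (\<Sum>h\<in>Gunits e. b p h * \<rho>U h i j) = X (fst p, j) (snd p, i)" by blast
  define c where "c gh = (\<Sum>p\<in>J \<times> J. a p (fst gh) * b p (ginv e (snd gh)))" for gh
  have "(\<Sum>gh\<in>GG f e. c gh * tens e \<rho>V \<rho>U gh x y) = X x y" if xy: "x \<in> J \<times> I" "y \<in> J \<times> I" for x y
  proof -
    obtain j i j' i' where x: "x = (j, i)" "y = (j', i')" "j \<in> J" "j' \<in> J" "i \<in> I" "i' \<in> I" using xy by auto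
    have "(\<Sum>gh\<in>GG f e. c gh * tens e \<rho>V \<rho>U gh x y)
        = (\<Sum>p\<in>J \<times> J. \<Sum>gh\<in>Gunits f \<times> Gunits e. (a p (fst gh) * \<rho>V (fst gh) j j') * (b p (ginv e (snd gh)) * \<rho>U (ginv e (snd gh)) i' i))"
      unfolding c_def GG_def x sum_distrib_right tens_def by (subst sum.swap) (simp add: ac_simps)
    also have "\<dots> = (\<Sum>p\<in>J \<times> J. (\<Sum>g\<in>Gunits f. a p g * \<rho>V g j j') * (\<Sum>h\<in>Gunits e. b p (ginv e h) * \<rho>U (ginv e h) i' i))"
      unfolding sum_product sum.cartesian_product by (simp add: case_prod_beta)
    also have "\<dots> = (\<Sum>p\<in>J \<times> J. (if p = (j, j') then X (j, i) (j', i') else 0))"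
    proof (rule sum.cong[OF refl])
      fix p
      have "(\<Sum>h\<in>Gunits e. b p (ginv e h) * \<rho>U (ginv e h) i' i) = X (fst p, i) (snd p, i')"
        unfolding sum.reindex_bij_betw[OF E.bij_inv, of "\<lambda>h. b p h * \<rho>U h i' i"] using b x by simp
      then show "(\<Sum>g\<in>Gunits f. a p g * \<rho>V g j j') * (\<Sum>h\<in>Gunits e. b p (ginv e h) * \<rho>U (ginv e h) i' i)
          = (if p = (j, j') then X (j, i) (j', i') else 0)" using a x by auto
    qed
    also have "\<dots> = X x y" using x fJ by simp
    finally show ?thesis .
  qed
  then show "\<exists>a. \<forall>i\<in>J \<times> I. \<forall>j\<in>J \<times> I. (\<Sum>g\<in>GG f e. a g * tens e \<rho>V \<rho>U g i j) = X i j" by blast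
qed

section \<open>Cocycles with values in a bimodule\<close>

lemma (in fin_group) bij_left: assumes h: "h \<in> C" shows "bij_betw (mul h) C C"
proof (rule bij_betw_byWitness[where f' = "mul (inv h)"])
  show "\<forall>g\<in>C. mul (inv h) (mul h g) = g" "\<forall>g\<in>C. mul h (mul (inv h) g) = g"
    using h by (auto simp: assoc[symmetric] inv inv_mul unit)
qed (use h in \<open>auto simp: mul inv\<close>)

lemma corner_translate:
  fixes e f :: "'m::{monoid_mult,finite}"
  assumes e: "e * e = e" and f: "f * f = f" and g: "g \<in> Gunits f" and h: "h \<in> Gunits e"
  shows "g * a * h \<in> corner f e"
proof -
  have "f * g = g" "h * e = h" using g h Gunits_iff e f by blast+
  then show ?thesis unfolding corner_iff[OF f e] by (simp add: mult.assoc) (simp add: mult.assoc[symmetric])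
qed

lemma prep_rep:
  fixes e f :: "'m::{monoid_mult,finite}"
  assumes e: "e * e = e" and f: "f * f = f"
  shows "is_rep (GG f e) pmul (f, e) (corner f e) (prep e :: _ \<Rightarrow> _ \<Rightarrow> _ \<Rightarrow> 'k::field)"
  unfolding is_rep_def
proof (intro conjI ballI)
  interpret E: fin_group "Gunits e" "(*)" e "ginv e" by (rule fin_group_Gunits[OF e])
  show "finite (corner f e)" by simp
  show "(prep e (f, e) a b :: 'k) = (if a = b then 1 else 0)" if "a \<in> corner f e" "b \<in> corner f e" for a b
    using that unfolding prep_def corner_iff[OF f e] by (simp add: E.inv_unit)
  fix p q a b assume p: "p \<in> GG f e" "q \<in> GG f e" and ab: "a \<in> corner f e" "b \<in> corner f e"
  obtain g h g' h' where pq: "p = (g, h)" "q = (g', h')" by (metis surj_pair)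
  have m: "g \<in> Gunits f" "h \<in> Gunits e" "g' \<in> Gunits f" "h' \<in> Gunits e" using p pq by (auto simp: GG_def)
  let ?c = "g' * b * ginv e h'"
  have "(\<Sum>l\<in>corner f e. prep e p a l * prep e q l b) = (\<Sum>l\<in>corner f e. if l = ?c then (if a = g * ?c * ginv e h then 1 else 0) else (0::'k))"
    by (rule sum.cong) (auto simp: prep_def pq)
  also have "\<dots> = (if a = g * ?c * ginv e h then 1 else 0)"
    using corner_translate[OF e f m(3) E.inv[OF m(4)], of b] by simp
  also have "\<dots> = prep e (pmul p q) a b" by (simp add: prep_def pq pmul_def E.inv_mul_rev m mult.assoc)
  finally show "(prep e (pmul p q) a b :: 'k) = (\<Sum>l\<in>corner f e. prep e p a l * prep e q l b)" by simp
qed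

text \<open>A change of variables in the permutation action. It turns equivariance of a map into a
  condition on the translates of its values.\<close>

lemma sum_mact_prep:
  fixes e f :: "'m::{monoid_mult,finite}"
  assumes e: "e * e = e" and f: "f * f = f" and g: "g \<in> Gunits f" and h: "h \<in> Gunits e"
  shows "(\<Sum>a\<in>corner f e. mact (corner f e) (prep e) (g, h) v a * t a) = (\<Sum>b\<in>corner f e. v b * (t (g * b * ginv e h) :: 'k::field))"
proof -
  interpret E: fin_group "Gunits e" "(*)" e "ginv e" by (rule fin_group_Gunits[OF e])
  have "(\<Sum>a\<in>corner f e. mact (corner f e) (prep e) (g, h) v a * t a)
      = (\<Sum>b\<in>corner f e. \<Sum>a\<in>corner f e. if a = g * b * ginv e h then v b * t a else 0)"
    unfolding mact_def by (subst sum.swap) (auto simp: prep_def sum_distrib_right intro!: sum.cong)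
  also have "\<dots> = (\<Sum>b\<in>corner f e. v b * t (g * b * ginv e h))"
    using corner_translate[OF e f g E.inv[OF h]] by (intro sum.cong) auto
  finally show ?thesis .
qed

lemma mact_prep_delta:
  fixes e f :: "'m::{monoid_mult,finite}"
  assumes e: "e * e = e" and f: "f * f = f" and g: "g \<in> Gunits f" and h: "h \<in> Gunits e" and b: "b \<in> corner f e"
  shows "mact (corner f e) (prep e) (g, h) (delta b) = (delta (g * b * ginv e h) :: _ \<Rightarrow> 'k::field)"
proof
  fix a
  interpret E: fin_group "Gunits e" "(*)" e "ginv e" by (rule fin_group_Gunits[OF e])
  show "mact (corner f e) (prep e) (g, h) (delta b) a = (delta (g * b * ginv e h) :: _ \<Rightarrow> 'k) a"
  proof (cases "a \<in> corner f e")
    case True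
    then show ?thesis unfolding mact_delta[OF finite True b] by (simp add: prep_def delta_def)
  next
    case False
    then show ?thesis using corner_translate[OF e f g E.inv[OF h], of b] by (auto simp: mact_def delta_def)
  qed
qed

text \<open>Transitivity and symmetry only add sums and negatives of generating differences, and two
  elements of \<open>NN\<close> differ by vectors already spanned. So the quotient by the
  equivalence relation can be handled through its generators.\<close>

lemma rel_span_eq:
  fixes A :: "'m set"
  shows "lspan ({delta z | z. z \<in> NN} \<union> {vsub (delta a) (delta b) | a b. (a, b) \<in> eqcl A (R \<union> NN \<times> NN)})
    = fv.span ({delta z | z. z \<in> NN} \<union> {delta a - (delta b :: 'm \<Rightarrow> 'k::field) | a b. (a, b) \<in> R})"
  (is "lspan (?D \<union> ?E) = fv.span (?D \<union> ?F)")
proof -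
  let ?T = "fv.span (?D \<union> ?F)"
  have NN: "delta z \<in> ?T" if "z \<in> NN" for z using that by (intro fv.span_base) blast
  have R: "delta a - delta b \<in> ?T" if "(a, b) \<in> R" for a b using that by (intro fv.span_base) blast
  have gen: "delta a - delta b \<in> ?T" if ab: "(a, b) \<in> Id_on A \<union> (R \<union> NN \<times> NN) \<union> (R \<union> NN \<times> NN)\<inverse>" for a b
  proof -
    consider "a = b" | "(a, b) \<in> R" | "(b, a) \<in> R" | "a \<in> NN" "b \<in> NN" using ab by auto
    then show ?thesis
    proof cases
      case 1
      then show ?thesis using fv.span_zero by (simp only: diff_self)
    next
      case 3
      then show ?thesis using fv.span_neg[OF R[of b a]] by (simp only: minus_diff_eq)
    qed (use NN R fv.span_diff in blast)+
  qed
  have "delta a - delta b \<in> ?T" if "(a, b) \<in> eqcl A (R \<union> NN \<times> NN)" for a b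
    using that unfolding eqcl_def
  proof (induction rule: rtrancl_induct)
    case base
    show ?case using fv.span_zero by (simp only: diff_self)
  next
    case (step y z)
    have "delta a - delta z = (delta a - delta y) + (delta y - (delta z :: 'm \<Rightarrow> 'k))" by simp
    then show ?case using fv.span_add[OF step.IH gen[OF step.hyps(2)]] by (simp only:)
  qed
  then have "?D \<union> ?E \<subseteq> ?T" using NN by (auto simp only: vsub_eq)
  moreover have "R \<subseteq> eqcl A (R \<union> NN \<times> NN)" unfolding eqcl_def by blast
  then have "?F \<subseteq> ?E" unfolding vsub_eq by blast
  then have DF: "?D \<union> ?F \<subseteq> fv.span (?D \<union> ?E)" by (intro order_trans[OF Un_mono[OF subset_refl] fv.span_superset])
  ultimately have "fv.span (?D \<union> ?E) \<subseteq> ?T" by (intro fv.span_minimal[OF _ fv.subspace_span])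
  moreover have "?T \<subseteq> fv.span (?D \<union> ?E)" using DF by (rule fv.span_minimal[OF _ fv.subspace_span])
  ultimately show ?thesis unfolding lspan_eq_span by (rule subset_antisym)
qed

text \<open>\<open>k^K\<close> is an \<open>M\<close>-bimodule, with \<open>L m x = m x\<close> and \<open>R m x = x m\<close>, on which \<open>M\<close> acts from the left through
  \<open>\<rho>_Y\<close> and from the right through \<open>\<rho>_X\<close>, where \<open>Y = MfM\<close> and \<open>X = MeM\<close>.\<close>

locale bimodule_ext = rect_monoid ty for ty :: "'m::{monoid_mult,finite} itself" +
  fixes e f :: 'm and K :: "'x set" and L R :: "'m \<Rightarrow> ('x \<Rightarrow> 'k::field) \<Rightarrow> 'x \<Rightarrow> 'k"
    and \<sigma> :: "'m \<times> 'm \<Rightarrow> 'x \<Rightarrow> 'x \<Rightarrow> 'k"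
  assumes e: "e * e = e" and f: "f * f = f"
    and linL: "flin (L m)" and linR: "flin (R m)"
    and LK: "L m x \<in> vsp K" and RK: "R m x \<in> vsp K"
    and L_mult: "L (m * n) x = L m (L n x)" and R_mult: "R (m * n) x = R n (R m x)"
    and LR: "L m (R n x) = R n (L m x)"
    and L_f: "x \<in> vsp K \<Longrightarrow> L f x = x" and R_e: "x \<in> vsp K \<Longrightarrow> R e x = x"
    and L_kill: "\<not> ge f m \<Longrightarrow> L m x = 0" and R_kill: "\<not> ge e m \<Longrightarrow> R m x = 0"
    and \<sigma>_act: "g \<in> Gunits f \<Longrightarrow> h \<in> Gunits e \<Longrightarrow> x \<in> vsp K \<Longrightarrow> mact K \<sigma> (g, h) x = L g (R (ginv e h) x)"
begin

sublocale E: fin_group "Gunits e" "(*)" e "ginv e" by (rule fin_group_Gunits[OF e])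
sublocale F: fin_group "Gunits f" "(*)" f "ginv f" by (rule fin_group_Gunits[OF f])

sublocale LL: Vector_Spaces.linear vsmul vsmul "L m" for m by (rule linL)
sublocale RR: Vector_Spaces.linear vsmul vsmul "R m" for m by (rule linR)

lemma L_simps: "L (f * m) x = L m x" "x \<in> vsp K \<Longrightarrow> L (m * f) x = L m x"
  by (simp_all add: L_mult L_f LK)

lemma R_simps: "R (n * e) x = R n x" "x \<in> vsp K \<Longrightarrow> R (e * n) x = R n x"
  by (simp_all add: R_mult R_e RK)

lemma R_1: "x \<in> vsp K \<Longrightarrow> R 1 x = x" using R_simps(2)[of x 1] R_e by simp

abbreviation "Q \<equiv> corner f e"

lemma Q_iff: "a \<in> Q \<longleftrightarrow> f * a = a \<and> a * e = a" by (rule corner_iff[OF f e])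

lemma Q_I: "f * m * e \<in> Q" by (auto simp: corner_def)

lemma Q_ge: assumes "a \<in> Q" shows "ge a f" "ge a e"
  using assms ge_mult_left[of f a] ge_mult_right[of a e] by (auto simp: Q_iff)

text \<open>A derivation of M in the bimodule. Its uncurried form \<open>coc\<close> has the type of
  the Ext cocycles and of the maps in \<open>Hm\<close>.\<close>

definition is_coc :: "('m \<Rightarrow> 'x \<Rightarrow> 'k) \<Rightarrow> bool" where
  "is_coc c \<longleftrightarrow> (\<forall>m. c m \<in> vsp K) \<and> (\<forall>m n. c (m * n) = L m (c n) + R n (c m))"

definition coc :: "('m \<times> 'x \<Rightarrow> 'k) set" where
  "coc = {c. is_coc (\<lambda>m x. c (m, x))}"

definition cob :: "('m \<times> 'x \<Rightarrow> 'k) set" where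
  "cob = {c. \<exists>x\<in>vsp K. \<forall>m. (\<lambda>y. c (m, y)) = L m x - R m x}"

definition ap :: "('m \<Rightarrow> 'x \<Rightarrow> 'k) \<Rightarrow> ('m \<Rightarrow> 'k) \<Rightarrow> 'x \<Rightarrow> 'k" where
  "ap T v = (\<Sum>a\<in>Q. vsmul (v a) (T a))"

lemma ap_app: "app Q \<theta> v = ap (\<lambda>a x. \<theta> (a, x)) v"
  by (rule ext) (simp add: app_def ap_def sum_fun_apply)

lemma app_ap: "ap T v = app Q (\<lambda>(a, x). T a x) v"
  by (simp add: ap_app)

lemma ap_delta: assumes "a \<in> Q" shows "ap T (delta a) = T a"
proof -
  have "ap T (delta a) = (\<Sum>b\<in>Q. if b = a then T a else 0)"
    unfolding ap_def by (rule sum.cong) (auto simp: delta_def)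
  then show ?thesis using assms by simp
qed

lemma ap_diff: "ap T (v - w) = ap T v - ap T w" unfolding app_ap by (rule app_diff)
lemma ap_add: "ap T (v + w) = ap T v + ap T w" unfolding app_ap by (rule app_add)

lemma coc_mult: "is_coc c \<Longrightarrow> c (m * n) = L m (c n) + R n (c m)" by (simp add: is_coc_def)
lemma coc_K: "is_coc c \<Longrightarrow> c m \<in> vsp K" by (simp add: is_coc_def)

lemma coc_corner:
  assumes c: "is_coc c"
  shows "c (f * m * n * e) = L m (c (n * e)) + R n (c (f * m))"
  using coc_mult[OF c, of "f * m" "n * e"] by (simp only: L_simps R_simps mult.assoc)

text \<open>The product rule is applied twice to \<open>f * m * e\<close>; \<open>L f\<close> and
  \<open>R e\<close> are the identity on the bimodule.\<close>

lemma coc_expand: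
  assumes c: "is_coc c"
  shows "c m = c (f * m * e) - L m (c e) - R m (c f)"
proof -
  have "c (f * m * e) = L m (c e) + c (f * m)"
    using coc_corner[OF c, of m 1] by (simp only: mult_1_left mult_1_right R_1[OF coc_K[OF c]])
  moreover have "c (f * m) = c m + R m (c f)" using coc_mult[OF c, of f m] by (simp only: L_f[OF coc_K[OF c]])
  ultimately show ?thesis by simp
qed

text \<open>The hypotheses are what each of the four cases must supply. By \<open>UL\<close> and
  \<open>UR\<close> the linear extensions of both actions vanish on \<open>U\<close>: this kills
  coboundaries there and removes the outer terms of \<open>c (g * a * h)\<close>, so a restricted
  cocycle is equivariant. With \<open>ker\<close> and \<open>sur\<close> the second isomorphism
  theorem concludes.\<close>

lemma ext_eq_hom:
  assumes U: "fv.subspace U" "U \<subseteq> vsp Q" and S: "S \<subseteq> U"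
    and UL: "\<And>v x. v \<in> U \<Longrightarrow> x \<in> vsp K \<Longrightarrow> ap (\<lambda>a. L a x) v = 0"
    and UR: "\<And>v x. v \<in> U \<Longrightarrow> x \<in> vsp K \<Longrightarrow> ap (\<lambda>a. R a x) v = 0"
    and CS: "\<And>c s. is_coc c \<Longrightarrow> s \<in> S \<Longrightarrow> ap c s = 0"
    and ker: "\<And>c. is_coc c \<Longrightarrow> (\<And>v. v \<in> U \<Longrightarrow> ap c v = 0) \<Longrightarrow> \<exists>x\<in>vsp K. \<forall>m. c m = L m x - R m x"
    and sur: "\<And>T. (\<And>a. T a \<in> vsp K) \<Longrightarrow> (\<And>s. s \<in> S \<Longrightarrow> ap T s = 0) \<Longrightarrow>
       (\<And>g h v. g \<in> Gunits f \<Longrightarrow> h \<in> Gunits e \<Longrightarrow> v \<in> U \<Longrightarrow> ap (\<lambda>a. T (g * a * h)) v = L g (R h (ap T v))) \<Longrightarrow>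
       \<exists>c. is_coc c \<and> (\<forall>v\<in>U. ap c v = ap T v)"
  shows "qdim coc cob = qdim (Hm (GG f e) Q (prep e) K \<sigma> U (fv.span S)) (Hm (GG f e) Q (prep e) K \<sigma> U U)"
proof -
  have ap_K: "ap T v \<in> vsp K" if "\<And>a. T a \<in> vsp K" for T v
    unfolding ap_def using that by (intro fv.subspace_sum[OF subspace_vsp] fv.subspace_scale[OF subspace_vsp])
  have act: "app Q \<theta> (mact Q (prep e) (g, h) v) = ap (\<lambda>a x. \<theta> (g * a * ginv e h, x)) v"
    if "g \<in> Gunits f" "h \<in> Gunits e" for \<theta> :: "'m \<times> 'x \<Rightarrow> 'k" and g h v
    using sum_mact_prep[OF e f that] by (intro ext) (simp add: app_def ap_def sum_fun_apply)
  have eqv: "ap (\<lambda>a. c (g * a * h)) v = L g (R h (ap c v))"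
    if c: "is_coc c" and g: "g \<in> Gunits f" and h: "h \<in> Gunits e" and v: "v \<in> U" for c g h v
  proof -
    have "ap (\<lambda>a. c (g * a * h)) v = ap (\<lambda>a. L g (L a (c h)) + L g (R h (c a)) + R h (R a (c g))) v"
      unfolding coc_mult[OF c] LL.add RR.add L_mult R_mult mult.assoc by (simp only: LR add.assoc)
    also have "\<dots> = L g (ap (\<lambda>a. L a (c h)) v) + L g (R h (ap c v)) + R h (ap (\<lambda>a. R a (c g)) v)"
      unfolding ap_def LL.sum RR.sum LL.scale RR.scale fv.scale_right_distrib sum.distrib ..
    also have "\<dots> = L g (R h (ap c v))" unfolding UL[OF v coc_K[OF c]] UR[OF v coc_K[OF c]] by (simp only: LL.zero RR.zero add_0_left add_0_right)
    finally show ?thesis .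
  qed
  have sub_span: "ap T v = 0" if "\<And>s. s \<in> S \<Longrightarrow> ap T s = 0" "v \<in> fv.span S" for T v
  proof -
    have "fv.subspace {v. ap T v = 0}" unfolding app_ap by (rule module_hom.subspace_kernel) (rule Vector_Spaces.linear.axioms(3)[OF flin_app])
    then have "fv.span S \<subseteq> {v. ap T v = 0}" using that(1) by (intro fv.span_minimal) auto
    then show ?thesis using that(2) by blast
  qed
  show ?thesis
  proof (rule qdim_second_iso[OF subspace_Hm])
    have zero_coc: "is_coc (\<lambda>m x. 0)"
    proof -
      have "is_coc (\<lambda>m. 0)" unfolding is_coc_def by (simp only: LL.zero RR.zero add_0_left fv.subspace_0[OF subspace_vsp] simp_thms)
      then show ?thesis unfolding zero_fun_def .
    qed
    show "coc \<subseteq> Hm (GG f e) Q (prep e) K \<sigma> U (fv.span S)"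
    proof
      fix c assume "c \<in> coc"
      then have c: "is_coc (\<lambda>m x. c (m, x))" by (simp add: coc_def)
      show "c \<in> Hm (GG f e) Q (prep e) K \<sigma> U (fv.span S)" unfolding Hm_def
      proof (intro CollectI conjI allI ballI impI)
        show "c (a, j) = 0" if "j \<notin> K" for a j using coc_K[OF c, of a] that by (simp add: vsp_def)
        fix p v assume p: "p \<in> GG f e" and v: "v \<in> U"
        obtain g h where gh: "p = (g, h)" "g \<in> Gunits f" "h \<in> Gunits e" using p by (auto simp: GG_def)
        show "app Q c (mact Q (prep e) p v) = mact K \<sigma> p (app Q c v)"
          unfolding gh(1) act[OF gh(2,3)] unfolding ap_app \<sigma>_act[OF gh(2,3) ap_K[OF coc_K[OF c]]]
          by (rule eqv[OF c gh(2) E.inv[OF gh(3)] v])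
      next
        fix v assume "v \<in> fv.span S"
        then show "app Q c v = 0" unfolding ap_app using sub_span CS[OF c] by blast
      qed
    qed
    show "c \<in> cob \<longleftrightarrow> c \<in> Hm (GG f e) Q (prep e) K \<sigma> U U" if cc: "c \<in> coc" for c
    proof
      have c: "is_coc (\<lambda>m x. c (m, x))" using cc by (simp add: coc_def)
      {
        assume "c \<in> cob"
        then obtain x where x: "x \<in> vsp K" "\<And>m. (\<lambda>y. c (m, y)) = L m x - R m x" unfolding cob_def by blast
        have z: "app Q c v = 0" if "v \<in> U" for v
        proof -
          have "ap (\<lambda>m. L m x - R m x) v = ap (\<lambda>m. L m x) v - ap (\<lambda>m. R m x) v"
            unfolding ap_def fv.scale_right_diff_distrib sum_subtractf ..
          then show ?thesis unfolding ap_app x(2) UL[OF that x(1)] UR[OF that x(1)] by (simp only: diff_self)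
        qed
        have "c \<in> Hm (GG f e) Q (prep e) K \<sigma> U (fv.span S)" using \<open>coc \<subseteq> _\<close> cc by blast
        then show "c \<in> Hm (GG f e) Q (prep e) K \<sigma> U U" using z unfolding Hm_def by blast
      }
      {
        assume "c \<in> Hm (GG f e) Q (prep e) K \<sigma> U U"
        then have "ap (\<lambda>m x. c (m, x)) v = 0" if "v \<in> U" for v using that unfolding Hm_def ap_app by blast
        from ker[OF c this] show "c \<in> cob" unfolding cob_def by blast
      }
    qed
    show "cob \<subseteq> coc"
    proof
      fix c assume "c \<in> cob"
      then obtain x where x: "x \<in> vsp K" "\<And>m. (\<lambda>y. c (m, y)) = L m x - R m x" unfolding cob_def by blast
      have "is_coc (\<lambda>m. L m x - R m x)" unfolding is_coc_def
      proof (intro conjI allI)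
        show "L m x - R m x \<in> vsp K" for m by (rule fv.subspace_diff[OF subspace_vsp LK RK])
        show "L (m * n) x - R (m * n) x = L m (L n x - R n x) + R n (L m x - R m x)" for m n
          unfolding L_mult R_mult LL.diff RR.diff LR by simp
      qed
      then show "c \<in> coc" unfolding coc_def x(2)[symmetric] by blast
    qed
    show "\<exists>y\<in>coc. \<theta> - y \<in> Hm (GG f e) Q (prep e) K \<sigma> U U" if \<theta>: "\<theta> \<in> Hm (GG f e) Q (prep e) K \<sigma> U (fv.span S)" for \<theta>
    proof -
      let ?T = "\<lambda>a x. \<theta> (a, x)"
      have K: "?T a \<in> vsp K" for a using \<theta> by (simp add: Hm_def vsp_def)
      have "ap ?T s = 0" if "s \<in> S" for s using \<theta> fv.span_base[OF that] unfolding Hm_def ap_app by blast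
      moreover have "ap (\<lambda>a. ?T (g * a * h)) v = L g (R h (ap ?T v))" if g: "g \<in> Gunits f" and h: "h \<in> Gunits e" and v: "v \<in> U" for g h v
      proof -
        have h': "ginv e h \<in> Gunits e" by (rule E.inv[OF h])
        have "(g, ginv e h) \<in> GG f e" using g h' by (simp add: GG_def)
        then have "app Q \<theta> (mact Q (prep e) (g, ginv e h) v) = mact K \<sigma> (g, ginv e h) (app Q \<theta> v)"
          using \<theta> v unfolding Hm_def by blast
        then show ?thesis unfolding act[OF g h'] unfolding ap_app \<sigma>_act[OF g h' ap_K[OF K]] E.inv_inv[OF h] .
      qed
      ultimately obtain c where c: "is_coc c" "\<forall>v\<in>U. ap c v = ap ?T v" using sur[of ?T] K by blast
      let ?y = "\<lambda>(a, x). c a x"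
      have y: "?y \<in> coc" using c(1) by (simp add: coc_def)
      have "?y \<in> Hm (GG f e) Q (prep e) K \<sigma> U (fv.span S)" using \<open>coc \<subseteq> _\<close> y by blast
      then have "\<theta> - ?y \<in> Hm (GG f e) Q (prep e) K \<sigma> U (fv.span S)" by (rule fv.subspace_diff[OF subspace_Hm \<theta>])
      moreover have "app Q (\<theta> - ?y) v = 0" if "v \<in> U" for v
      proof -
        have "app Q \<theta> v = app Q ?y v" by (simp add: ap_app c(2)[rule_format, OF that])
        then show ?thesis unfolding app_diff_left by (simp only: diff_self)
      qed
      ultimately have "\<theta> - ?y \<in> Hm (GG f e) Q (prep e) K \<sigma> U U" unfolding Hm_def by blast
      then show ?thesis using y by blast
    qed
    show "fv.subspace coc"
      unfolding fv.subspace_def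
    proof (intro conjI ballI allI)
      show "0 \<in> coc" using zero_coc by (simp add: coc_def)
      fix c d assume "c \<in> coc"
      then have c: "is_coc (\<lambda>m x. c (m, x))" by (simp add: coc_def)
      {
        assume "d \<in> coc"
        then have d: "is_coc (\<lambda>m x. d (m, x))" by (simp add: coc_def)
        have "is_coc (\<lambda>m. (\<lambda>x. c (m, x)) + (\<lambda>x. d (m, x)))" unfolding is_coc_def
        proof (intro conjI allI)
          show "(\<lambda>x. c (m, x)) + (\<lambda>x. d (m, x)) \<in> vsp K" for m
            by (rule fv.subspace_add[OF subspace_vsp coc_K[OF c] coc_K[OF d]])
          show "(\<lambda>x. c (m * n, x)) + (\<lambda>x. d (m * n, x)) = L m ((\<lambda>x. c (n, x)) + (\<lambda>x. d (n, x))) + R n ((\<lambda>x. c (m, x)) + (\<lambda>x. d (m, x)))" for m n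
            unfolding coc_mult[OF c] coc_mult[OF d] LL.add RR.add by (simp only: add.assoc add.left_commute add.commute)
        qed
        then show "c + d \<in> coc" unfolding coc_def plus_fun_def by simp
      }
      fix l
      have "is_coc (\<lambda>m. vsmul l (\<lambda>x. c (m, x)))" unfolding is_coc_def
      proof (intro conjI allI)
        show "vsmul l (\<lambda>x. c (m, x)) \<in> vsp K" for m by (rule fv.subspace_scale[OF subspace_vsp coc_K[OF c]])
        show "vsmul l (\<lambda>x. c (m * n, x)) = L m (vsmul l (\<lambda>x. c (n, x))) + R n (vsmul l (\<lambda>x. c (m, x)))" for m n
          unfolding coc_mult[OF c] LL.scale RR.scale fv.scale_right_distrib ..
      qed
      then show "vsmul l c \<in> coc" unfolding coc_def vsmul_def by simp
    qed
  qed
qed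

end

section \<open>A criterion for a subquotient of k[fMe] to compute Ext, and the means to verify
  it\<close>

context bimodule_ext begin

definition computes_ext :: "('m \<Rightarrow> 'k) set \<Rightarrow> ('m \<Rightarrow> 'k) set \<Rightarrow> bool" where
  "computes_ext U W \<longleftrightarrow> section_ok (GG f e) pmul (f, e) Q (prep e) U W \<and>
     qdim coc cob = qdim (Hm (GG f e) Q (prep e) K \<sigma> U W) (Hm (GG f e) Q (prep e) K \<sigma> U U)"

text \<open>\<open>NN\<close> is \<open>(\<nabla>Y)(\<nabla>X) \<inter> e_Y M e_X\<close>.\<close>

definition NN :: "'m set" where
  "NN = {p * q | p q. \<not> ge f p \<and> \<not> ge e q} \<inter> Q"

definition relset :: "('m \<times> 'm) set \<Rightarrow> ('m \<Rightarrow> 'k) set" where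
  "relset r = {delta z | z. z \<in> NN} \<union> {delta a - delta b | a b. (a, b) \<in> r}"

lemma NN_I: "\<not> ge f p \<Longrightarrow> \<not> ge e q \<Longrightarrow> p * q \<in> Q \<Longrightarrow> p * q \<in> NN"
  unfolding NN_def by blast

lemma NN_Q: "z \<in> NN \<Longrightarrow> z \<in> Q"
  unfolding NN_def by blast

lemma NN_not_ge: "z \<in> NN \<Longrightarrow> \<not> ge f z" "z \<in> NN \<Longrightarrow> \<not> ge e z"
  unfolding NN_def using ge_multD by blast+

lemma NN_translate:
  assumes g: "g \<in> Gunits f" and h: "h \<in> Gunits e" and z: "z \<in> NN" shows "g * z * h \<in> NN"
proof -
  obtain p q where pq: "z = p * q" "\<not> ge f p" "\<not> ge e q" using z unfolding NN_def by blast
  have "(g * p) * (q * h) \<in> NN"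
    by (rule NN_I) (use pq corner_translate[OF e f g h, of z] in \<open>auto simp: mult.assoc dest: ge_multD\<close>)
  then show ?thesis using pq by (simp add: mult.assoc)
qed

text \<open>In the product rule for \<open>p * q\<close> the left action of \<open>p\<close> and the
  right action of \<open>q\<close> are both zero. This is why such products are among the relations
  in all four cases.\<close>

lemma coc_NN: assumes c: "is_coc c" and z: "z \<in> NN" shows "c z = 0"
proof -
  obtain p q where pq: "z = p * q" "\<not> ge f p" "\<not> ge e q" using z unfolding NN_def by blast
  show ?thesis unfolding pq coc_mult[OF c] L_kill[OF pq(2)] R_kill[OF pq(3)] by (rule add_0_left)
qed

text \<open>Invariance is asked of the generators alone; it passes to their span because the group
  acts linearly.\<close>

lemma computes_extI:
  assumes U: "fv.subspace U" "U \<subseteq> vsp Q" and S: "S \<subseteq> U"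
    and Uinv: "\<And>g h v. g \<in> Gunits f \<Longrightarrow> h \<in> Gunits e \<Longrightarrow> v \<in> U \<Longrightarrow> mact Q (prep e) (g, h) v \<in> U"
    and Sinv: "\<And>g h s. g \<in> Gunits f \<Longrightarrow> h \<in> Gunits e \<Longrightarrow> s \<in> S \<Longrightarrow> mact Q (prep e) (g, h) s \<in> S"
    and UL: "\<And>v x. v \<in> U \<Longrightarrow> x \<in> vsp K \<Longrightarrow> ap (\<lambda>a. L a x) v = 0"
    and UR: "\<And>v x. v \<in> U \<Longrightarrow> x \<in> vsp K \<Longrightarrow> ap (\<lambda>a. R a x) v = 0"
    and CS: "\<And>c s. is_coc c \<Longrightarrow> s \<in> S \<Longrightarrow> ap c s = 0"
    and ker: "\<And>c. is_coc c \<Longrightarrow> (\<And>v. v \<in> U \<Longrightarrow> ap c v = 0) \<Longrightarrow> \<exists>x\<in>vsp K. \<forall>m. c m = L m x - R m x"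
    and sur: "\<And>T. (\<And>a. T a \<in> vsp K) \<Longrightarrow> (\<And>s. s \<in> S \<Longrightarrow> ap T s = 0) \<Longrightarrow>
       (\<And>g h v. g \<in> Gunits f \<Longrightarrow> h \<in> Gunits e \<Longrightarrow> v \<in> U \<Longrightarrow> ap (\<lambda>a. T (g * a * h)) v = L g (R h (ap T v))) \<Longrightarrow>
       \<exists>c. is_coc c \<and> (\<forall>v\<in>U. ap c v = ap T v)"
  shows "computes_ext U (fv.span S)"
  unfolding computes_ext_def
proof
  have sp: "fv.span S \<subseteq> U" by (rule fv.span_minimal[OF S U(1)])
  have iU: "invariant (GG f e) Q (prep e) U" unfolding invariant_def GG_def using Uinv by auto
  have "mact Q (prep e) p v \<in> fv.span S" if p: "p \<in> GG f e" and v: "v \<in> fv.span S" for p v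
  proof -
    interpret M: Vector_Spaces.linear vsmul vsmul "mact Q (prep e) p :: ('m \<Rightarrow> 'k) \<Rightarrow> _" by (rule flin_mact)
    obtain g h where gh: "p = (g, h)" "g \<in> Gunits f" "h \<in> Gunits e" using p by (auto simp: GG_def)
    have "mact Q (prep e) p ` S \<subseteq> S" using Sinv[OF gh(2,3)] unfolding gh(1) by blast
    then have "fv.span (mact Q (prep e) p ` S) \<subseteq> fv.span S" by (rule fv.span_mono)
    then show ?thesis unfolding M.span_image using v by blast
  qed
  then have "invariant (GG f e) Q (prep e) (fv.span S)" unfolding invariant_def by blast
  then show "section_ok (GG f e) pmul (f, e) Q (prep e) U (fv.span S)"
    unfolding section_ok_def lsubspace_iff using prep_rep[OF e f] U sp iU by auto
  show "qdim coc cob = qdim (Hm (GG f e) Q (prep e) K \<sigma> U (fv.span S)) (Hm (GG f e) Q (prep e) K \<sigma> U U)"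
    by (rule ext_eq_hom[OF U S UL UR CS ker sur])
qed

lemma relset_inv:
  assumes r: "\<And>a b. (a, b) \<in> r \<Longrightarrow> a \<in> Q \<and> b \<in> Q"
    and tr: "\<And>g h a b. g \<in> Gunits f \<Longrightarrow> h \<in> Gunits e \<Longrightarrow> (a, b) \<in> r \<Longrightarrow> (g * a * h, g * b * h) \<in> r"
    and gh: "g \<in> Gunits f" "h \<in> Gunits e" and s: "s \<in> relset r"
  shows "mact Q (prep e) (g, h) s \<in> relset r"
proof -
  have h': "ginv e h \<in> Gunits e" by (rule E.inv[OF gh(2)])
  from s consider z where "z \<in> NN" "s = delta z" | a b where "(a, b) \<in> r" "s = delta a - delta b"
    unfolding relset_def by blast
  then show ?thesis
  proof cases
    case 1
    then show ?thesis using NN_translate[OF gh(1) h'] unfolding 1(2) mact_prep_delta[OF e f gh NN_Q[OF 1(1)]] relset_def by blast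
  next
    case 2
    note ab = r[OF 2(1)]
    show ?thesis unfolding 2(2) mact_diff mact_prep_delta[OF e f gh ab[THEN conjunct1]] mact_prep_delta[OF e f gh ab[THEN conjunct2]]
      using tr[OF gh(1) h' 2(1)] unfolding relset_def by blast
  qed
qed

lemma coc_relset:
  assumes c: "is_coc c" and r: "\<And>a b. (a, b) \<in> r \<Longrightarrow> a \<in> Q \<and> b \<in> Q"
    and eq: "\<And>a b. (a, b) \<in> r \<Longrightarrow> c a = c b" and s: "s \<in> relset r"
  shows "ap c s = 0"
proof -
  from s consider z where "z \<in> NN" "s = delta z" | a b where "(a, b) \<in> r" "s = delta a - delta b"
    unfolding relset_def by blast
  then show ?thesis
  proof cases
    case 1
    then show ?thesis using coc_NN[OF c] by (simp only: ap_delta[OF NN_Q])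
  next
    case 2
    note ab = r[OF 2(1)]
    show ?thesis unfolding 2(2) ap_diff ap_delta[OF ab[THEN conjunct1]] ap_delta[OF ab[THEN conjunct2]] eq[OF 2(1)] by (rule diff_self)
  qed
qed

lemma relset_zeroD:
  assumes T: "\<And>s. s \<in> relset r \<Longrightarrow> ap T s = 0" and r: "\<And>a b. (a, b) \<in> r \<Longrightarrow> a \<in> Q \<and> b \<in> Q"
  shows "z \<in> NN \<Longrightarrow> T z = 0" "(a, b) \<in> r \<Longrightarrow> T a = T b"
proof -
  assume z: "z \<in> NN"
  have "delta z \<in> relset r" using z unfolding relset_def by blast
  from T[OF this] show "T z = 0" unfolding ap_delta[OF NN_Q[OF z]] .
next
  assume ab: "(a, b) \<in> r"
  have "delta a - delta b \<in> relset r" using ab unfolding relset_def by blast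
  from T[OF this] show "T a = T b" unfolding ap_diff ap_delta[OF r[OF ab, THEN conjunct1]] ap_delta[OF r[OF ab, THEN conjunct2]]
    by (simp only: right_minus_eq)
qed

text \<open>The kernel of the map to \<open>kG_d\<close> induced by \<open>a \<mapsto> \<rho>(a)\<close>: this is the space \<open>U_0\<close> in the comparable
  cases, with \<open>d\<close> the smaller of the two idempotents.\<close>

definition Uk :: "'m \<Rightarrow> ('m \<Rightarrow> 'k) set" where
  "Uk d = {v \<in> vsp Q. \<forall>k\<in>Gunits d. (\<Sum>a\<in>Q. v a * (if ge d a \<and> d * a * d = k then 1 else 0)) = 0}"

lemma subspace_Uk: "fv.subspace (Uk d)"
  unfolding Uk_def fv.subspace_def
  using fv.subspace_0[OF subspace_vsp] fv.subspace_add[OF subspace_vsp] fv.subspace_scale[OF subspace_vsp]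
  by (auto simp: distrib_right sum.distrib mult.assoc sum_distrib_left[symmetric])

lemma delta_sum: "a \<in> Q \<Longrightarrow> (\<Sum>x\<in>Q. delta a x * t x) = (t a :: 'k)"
proof -
  assume "a \<in> Q"
  have "(\<Sum>x\<in>Q. delta a x * t x) = (\<Sum>x\<in>Q. if x = a then t a else 0)"
    by (rule sum.cong) (auto simp: delta_def)
  then show ?thesis using \<open>a \<in> Q\<close> by simp
qed

lemma diff_in_Uk:
  assumes "a \<in> Q" "b \<in> Q" "ge d a \<longleftrightarrow> ge d b" "ge d a \<Longrightarrow> ge d b \<Longrightarrow> d * a * d = d * b * d"
  shows "delta a - delta b \<in> Uk d"
  unfolding Uk_def using assms fv.subspace_diff[OF subspace_vsp delta_in_vsp delta_in_vsp, of a Q b]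
  by (auto simp: left_diff_distrib sum_subtractf delta_sum)

lemma delta_in_Uk: "a \<in> Q \<Longrightarrow> \<not> ge d a \<Longrightarrow> delta a \<in> Uk d"
  unfolding Uk_def using delta_in_vsp[of a Q] by (auto simp: delta_sum)

text \<open>By multiplicativity of \<rho> at \<open>d\<close>, an element lies over
  \<open>k'\<close> exactly when its translate lies over \<open>g1 * k' * h1\<close>. So the group
  only permutes the fibre sums that define \<open>Uk d\<close>.\<close>

lemma Uk_invariant:
  assumes d: "d * d = d" and de: "ge d e" "ge d f" and g: "g \<in> Gunits f" and h: "h \<in> Gunits e" and v: "v \<in> Uk d"
  shows "mact Q (prep e) (g, h) v \<in> Uk d"
proof -
  interpret D: fin_group "Gunits d" "(*)" d "ginv d" by (rule fin_group_Gunits[OF d])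
  have "(\<Sum>a\<in>Q. mact Q (prep e) (g, h) v a * (if ge d a \<and> d * a * d = k then 1 else 0)) = 0" if k: "k \<in> Gunits d" for k
  proof -
    define h' where "h' = ginv e h"
    have gg: "ge d g" using ge_trans[OF de(2) Gunits_geD[OF f g]] .
    have gh: "ge d h'" using ge_trans[OF de(1) Gunits_geD[OF e E.inv[OF h]]] unfolding h'_def .
    define g1 h1 where "g1 = d * g * d" and "h1 = d * h' * d"
    have u: "g1 \<in> Gunits d" "h1 \<in> Gunits d" unfolding g1_def h1_def using corner_unit[OF d] gg gh by auto
    define k' where "k' = ginv d g1 * k * ginv d h1"
    have k': "k' \<in> Gunits d" unfolding k'_def using u k by (simp add: D.mul D.inv)
    have eqv: "ge d (g * b * h') \<and> d * (g * b * h') * d = k \<longleftrightarrow> ge d b \<and> d * b * d = k'" for b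
    proof (cases "ge d b")
      case True
      have "d * (g * b * h') * d = (d * (g * b) * d) * h1"
        using corner_mult[OF d ge_mult[OF d gg True] gh] unfolding h1_def by (simp only: mult.assoc)
      also have "d * (g * b) * d = g1 * (d * b * d)"
        using corner_mult[OF d gg True] unfolding g1_def by (simp only: mult.assoc)
      finally have "d * (g * b * h') * d = g1 * (d * b * d) * h1" .
      moreover have "g1 * x * h1 = k \<longleftrightarrow> x = k'" if x: "x \<in> Gunits d" for x
      proof
        assume "g1 * x * h1 = k"
        then have "k' = ginv d g1 * (g1 * x * h1) * ginv d h1" by (simp add: k'_def)
        also have "\<dots> = (ginv d g1 * g1) * x * (h1 * ginv d h1)" by (simp add: mult.assoc)
        also have "\<dots> = x" using u x by (simp add: D.inv_mul D.unit)
        finally show "x = k'" by simp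
      next
        assume "x = k'"
        then have "g1 * x * h1 = (g1 * ginv d g1) * k * (ginv d h1 * h1)" by (simp add: k'_def mult.assoc)
        then show "g1 * x * h1 = k" using u k by (simp add: D.inv_mul D.unit)
      qed
      ultimately show ?thesis using True corner_unit[OF d True] gg gh by (simp add: ge_mult_iff[OF d])
    next
      case False
      then show ?thesis by (simp add: ge_mult_iff[OF d])
    qed
    show ?thesis unfolding sum_mact_prep[OF e f g h] h'_def[symmetric] eqv using v k' unfolding Uk_def by blast
  qed
  then show ?thesis unfolding Uk_def by (simp add: mact_in_vsp)
qed

text \<open>A function that factors through the map to the group algebra is constant on the fibres,
  and all fibre sums of \<open>v\<close> are zero.\<close>

lemma Uk_group:
  assumes d: "d * d = d" and v: "v \<in> Uk d" and Tn: "\<And>a. a \<in> Q \<Longrightarrow> \<not> ge d a \<Longrightarrow> T a = 0"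
    and Tg: "\<And>a. a \<in> Q \<Longrightarrow> ge d a \<Longrightarrow> T a = F (d * a * d)"
  shows "ap T v = 0"
proof -
  have "ap T v = (\<Sum>a\<in>{a \<in> Q. ge d a}. vsmul (v a) (F (d * a * d)))"
    unfolding ap_def
  proof (rule sum.mono_neutral_cong_right)
    show "\<forall>i\<in>Q - {a \<in> Q. ge d a}. vsmul (v i) (T i) = 0" using Tn by simp
  qed (use Tg in auto)
  also have "\<dots> = (\<Sum>k\<in>Gunits d. \<Sum>a\<in>{a \<in> {a \<in> Q. ge d a}. d * a * d = k}. vsmul (v a) (F (d * a * d)))"
    by (rule sum.group[symmetric]) (use corner_unit[OF d] in auto)
  also have "\<dots> = (\<Sum>k\<in>Gunits d. 0)"
  proof (rule sum.cong[OF refl])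
    fix k assume k: "k \<in> Gunits d"
    have "(\<Sum>a\<in>{a \<in> {a \<in> Q. ge d a}. d * a * d = k}. vsmul (v a) (F (d * a * d)))
        = vsmul (\<Sum>a\<in>{a \<in> {a \<in> Q. ge d a}. d * a * d = k}. v a) (F k)"
      unfolding fv.scale_sum_left by (rule sum.cong) auto
    also have "(\<Sum>a\<in>{a \<in> {a \<in> Q. ge d a}. d * a * d = k}. v a) = (\<Sum>a\<in>Q. v a * (if ge d a \<and> d * a * d = k then 1 else 0))"
      by (rule sum.mono_neutral_cong_left) auto
    also have "\<dots> = 0" using v k unfolding Uk_def by blast
    finally show "(\<Sum>a\<in>{a \<in> {a \<in> Q. ge d a}. d * a * d = k}. vsmul (v a) (F (d * a * d))) = 0" by (simp only: fv.scale_zero_left)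
  qed
  finally show ?thesis by simp
qed

text \<open>The image of \<open>p\<close> in the group at \<open>d\<close> is the identity, so
  inserting \<open>p\<close> is invisible there.\<close>

lemma corner_absorb:
  fixes d :: 'm
  assumes d: "d * d = d" and p: "ge d p" "d * p * d = d" and x: "ge d x" and y: "ge d y"
  shows "d * (x * p * y) * d = d * (x * y) * d"
proof -
  have "d * (x * p * y) * d = d * x * d * ((d * p * d) * (d * y * d))"
    using corner_mult[OF d x ge_mult[OF d p(1) y]] corner_mult[OF d p(1) y] by (simp only: mult.assoc)
  also have "\<dots> = d * x * d * (d * y * d)" unfolding p(2) by (simp add: mult.assoc assoc_ext[OF d])
  also have "\<dots> = d * (x * y) * d" using corner_mult[OF d x y] by (simp add: mult.assoc)
  finally show ?thesis .
qed

lemma insertion_Q: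
  assumes "\<exists>m n p. (p = e \<or> p = f) \<and> a = f * m * n * e \<and> b = f * m * p * n * e"
  shows "a \<in> Q \<and> b \<in> Q"
  using assms unfolding Q_iff by (auto simp: mult.assoc e assoc_ext[OF f])

text \<open>Each generating relation of the comparable cases inserts \<open>e\<close> or
  \<open>f\<close> between two factors. Both go to the identity at \<open>d\<close>, so the
  relations lie in the kernel.\<close>

lemma insertion_Uk:
  assumes d: "d * d = d" and de: "ge d e \<and> d * e * d = d" and df: "ge d f \<and> d * f * d = d"
    and ex: "\<exists>m n p. (p = e \<or> p = f) \<and> a = f * m * n * e \<and> b = f * m * p * n * e"
  shows "delta a - delta b \<in> Uk d"
proof (rule diff_in_Uk)
  show "a \<in> Q" "b \<in> Q" using insertion_Q[OF ex] by auto
  obtain m n p where p: "a = f * m * n * e" "b = f * m * p * n * e" "ge d p" "d * p * d = d"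
    using ex de df by blast
  show ab: "ge d a \<longleftrightarrow> ge d b" unfolding p using p(3) by (auto simp: ge_mult_iff[OF d])
  show "d * a * d = d * b * d" if "ge d a"
    using corner_absorb[OF d p(3,4), of "f * m" "n * e"] that unfolding p
    by (simp add: ge_mult_iff[OF d] mult.assoc)
qed

text \<open>A unit on the left is absorbed by \<open>m\<close>, one on the right by
  \<open>n\<close>, so the shape of a relation survives translation.\<close>

lemma translate_rel:
  assumes g: "g \<in> Gunits f" and h: "h \<in> Gunits e"
  shows "g * (f * m * n * e) * h = f * (g * m) * (n * h) * e"
    "g * (f * m * p * n * e) * h = f * (g * m) * p * (n * h) * e"
proof -
  have s: "f * g = g" "g * f = g" "e * h = h" "h * e = h" using g h Gunits_iff e f by blast+
  show "g * (f * m * n * e) * h = f * (g * m) * (n * h) * e"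
    "g * (f * m * p * n * e) * h = f * (g * m) * p * (n * h) * e"
    by (simp_all add: mult.assoc s s[THEN assoc_ext])
qed

end

context bimodule_ext begin

section \<open>The four cases\<close>

lemma corner_f_unit: "ge f m \<Longrightarrow> f * m * f \<in> Gunits f" by (rule corner_unit[OF f])
lemma corner_e_unit: "ge e m \<Longrightarrow> e * m * e \<in> Gunits e" by (rule corner_unit[OF e])

lemma unit_f: "f \<in> Gunits f" by (rule F.u)
lemma unit_e: "e \<in> Gunits e" by (rule E.u)

lemma L_corner: "x \<in> vsp K \<Longrightarrow> L (f * m * f) x = L m x" by (simp only: L_simps mult.assoc)
lemma R_corner: "x \<in> vsp K \<Longrightarrow> R (e * n * e) x = R n x" by (simp only: R_simps)

definition incset :: "('m \<Rightarrow> 'k) set" where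
  "incset = {delta z | z. z \<in> NN} \<union>
     {delta (f * m * n * e) + delta (f * m * f * e * n * e) - delta (f * m * f * n * e) - delta (f * m * e * n * e) | m n. True}"

text \<open>No element of fMe lies in \<open>M_X\<close> or \<open>M_Y\<close>, so both actions
  vanish on all of it and no kernel has to be taken. The four-term relation holds for every cocycle:
  expand each term at the break between \<open>m\<close> and \<open>n\<close> and the parts
  cancel.\<close>

lemma computes_ext_inc:
  assumes inc: "\<not> ge e f" "\<not> ge f e"
  shows "computes_ext (vsp Q) (fv.span incset)"
proof (rule computes_extI)
  have Qn: "\<not> ge f a" "\<not> ge e a" if "a \<in> Q" for a using Q_ge[OF that] inc ge_trans by blast+
  have q: "f * m * n * e \<in> Q" "f * m * f * e * n * e \<in> Q" "f * m * f * n * e \<in> Q" "f * m * e * n * e \<in> Q" for m n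
    unfolding Q_iff by (simp_all add: mult.assoc e assoc_ext[OF f])
  have ap4: "ap T (delta (f * m * n * e) + delta (f * m * f * e * n * e) - delta (f * m * f * n * e) - delta (f * m * e * n * e))
      = T (f * m * n * e) + T (f * m * f * e * n * e) - T (f * m * f * n * e) - T (f * m * e * n * e)" for T m n
    unfolding ap_diff ap_add by (simp only: ap_delta q)
  show "fv.subspace (vsp Q)" by (rule subspace_vsp)
  show "vsp Q \<subseteq> vsp Q" ..
  show "incset \<subseteq> vsp Q" unfolding incset_def using q NN_Q
    by (auto intro!: delta_in_vsp fv.subspace_add[OF subspace_vsp] fv.subspace_diff[OF subspace_vsp])
  show "mact Q (prep e) (g, h) v \<in> vsp Q" for g h and v :: "'m \<Rightarrow> 'k" by (rule mact_in_vsp)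
  show "mact Q (prep e) (g, h) s \<in> incset" if g: "g \<in> Gunits f" and h: "h \<in> Gunits e" and s: "s \<in> incset" for g h s
  proof -
    have h': "ginv e h \<in> Gunits e" by (rule E.inv[OF h])
    from s consider z where "z \<in> NN" "s = delta z" | m n where
      "s = delta (f * m * n * e) + delta (f * m * f * e * n * e) - delta (f * m * f * n * e) - delta (f * m * e * n * e)"
      unfolding incset_def by blast
    then show ?thesis
    proof cases
      case 1
      then show ?thesis using NN_translate[OF g h'] unfolding 1(2) mact_prep_delta[OF e f g h NN_Q[OF 1(1)]] incset_def by blast
    next
      case 2
      have y: "g * (f * m * f * e * n * e) * ginv e h = f * (g * m) * f * e * (n * ginv e h) * e"
        using translate_rel(2)[OF g h', of m "f * e" n] by (simp only: mult.assoc)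
      show ?thesis unfolding 2 mact_diff mact_add mact_prep_delta[OF e f g h q(1)] mact_prep_delta[OF e f g h q(2)]
          mact_prep_delta[OF e f g h q(3)] mact_prep_delta[OF e f g h q(4)] translate_rel[OF g h'] y incset_def by blast
    qed
  qed
  show "ap (\<lambda>a. L a x) v = 0" for v x unfolding ap_def using L_kill[OF Qn(1)] by (intro sum.neutral) simp
  show "ap (\<lambda>a. R a x) v = 0" for v x unfolding ap_def using R_kill[OF Qn(2)] by (intro sum.neutral) simp
  show "ap c s = 0" if c: "is_coc c" and s: "s \<in> incset" for c s
  proof -
    from s consider z where "z \<in> NN" "s = delta z" | m n where
      "s = delta (f * m * n * e) + delta (f * m * f * e * n * e) - delta (f * m * f * n * e) - delta (f * m * e * n * e)"
      unfolding incset_def by blast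
    then show ?thesis
    proof cases
      case 1
      then show ?thesis using coc_NN[OF c] by (simp only: ap_delta[OF NN_Q])
    next
      case 2
      note K = coc_K[OF c]
      have 1: "c (f * m * f * e * n * e) = L m (c (e * n * e)) + R n (c (f * m * f))"
        using coc_corner[OF c, of "m * f" "e * n"] by (simp only: L_simps R_simps K mult.assoc)
      have 4: "c (f * m * f * n * e) = L m (c (n * e)) + R n (c (f * m * f))"
        using coc_corner[OF c, of "m * f" "n"] by (simp only: L_simps R_simps K mult.assoc)
      have 3: "c (f * m * e * n * e) = L m (c (e * n * e)) + R n (c (f * m))"
        using coc_corner[OF c, of "m" "e * n"] by (simp only: L_simps R_simps K mult.assoc)
      show ?thesis unfolding 2 ap4 unfolding coc_corner[OF c, of m n] 1 4 3 by simp
    qed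
  qed
  show "\<exists>x\<in>vsp K. \<forall>m. c m = L m x - R m x" if c: "is_coc c" and z: "\<And>v. v \<in> vsp Q \<Longrightarrow> ap c v = 0" for c
  proof (intro bexI allI)
    fix m
    have zQ: "c a = 0" if "a \<in> Q" for a using z[OF delta_in_vsp[OF that]] unfolding ap_delta[OF that] .
    have "c (f * e) = 0" using zQ[OF Q_I[of 1]] by simp
    \<comment> \<open>Vanishing at \<open>f * e\<close> ties \<open>c e\<close> to
      \<open>c f\<close>, so the single vector \<open>c f\<close> serves in both terms of the
      coboundary.\<close>
    then have "c e = - c f" using coc_mult[OF c, of f e] by (simp only: L_f R_e coc_K[OF c]) (metis add.commute minus_unique)
    then show "c m = L m (c f) - R m (c f)" using coc_expand[OF c, of m] by (simp only: zQ[OF Q_I] LL.neg) simp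
  qed (rule coc_K[OF c])
  show "\<exists>c. is_coc c \<and> (\<forall>v\<in>vsp Q. ap c v = ap T v)"
    if K: "\<And>a. T a \<in> vsp K" and S: "\<And>s. s \<in> incset \<Longrightarrow> ap T s = 0"
      and eqv: "\<And>g h v. g \<in> Gunits f \<Longrightarrow> h \<in> Gunits e \<Longrightarrow> v \<in> vsp Q \<Longrightarrow> ap (\<lambda>a. T (g * a * h)) v = L g (R h (ap T v))" for T
  proof -
    have TN: "T z = 0" if z: "z \<in> NN" for z
    proof -
      have "delta z \<in> incset" using z unfolding incset_def by blast
      from S[OF this] show ?thesis unfolding ap_delta[OF NN_Q[OF z]] .
    qed
    have rel: "T (f * m * n * e) + T (f * m * f * e * n * e) - T (f * m * f * n * e) - T (f * m * e * n * e) = 0" for m n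
      unfolding ap4[symmetric] by (rule S) (auto simp: incset_def)
    have eq: "T (g * a * h) = L g (R h (T a))" if "g \<in> Gunits f" "h \<in> Gunits e" "a \<in> Q" for g h a
      using eqv[OF that(1,2) delta_in_vsp[OF that(3)]] unfolding ap_delta[OF that(3)] .
    \<comment> \<open>If \<open>m\<close> lies in \<open>M_Y\<close>, its corner is a unit and
      equivariance applies. Otherwise the argument of \<open>T\<close> lies in \<open>NN\<close> and
      both sides are zero.\<close>
    have TL: "T (f * m * f * n * e) = L m (T (f * n * e))" for m n
    proof (cases "ge f m")
      case True
      have "T (f * m * f * (f * n * e) * e) = L (f * m * f) (R e (T (f * n * e)))"
        by (rule eq[OF corner_f_unit[OF True] unit_e Q_I])
      then show ?thesis by (simp only: L_corner R_e K) (simp add: mult.assoc e assoc_ext[OF f])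
    next
      case False
      have "(f * m * f) * (f * n * e) \<in> NN"
        by (rule NN_I) (use False Qn(2)[OF Q_I] in \<open>auto dest: ge_multD simp: Q_iff mult.assoc e assoc_ext[OF f]\<close>)
      then have "T (f * m * f * n * e) = 0" using TN by (simp add: mult.assoc assoc_ext[OF f])
      then show ?thesis unfolding L_kill[OF False] .
    qed
    have TR: "T (f * m * e * n * e) = R n (T (f * m * e))" for m n
    proof (cases "ge e n")
      case True
      have "T (f * (f * m * e) * (e * n * e)) = L f (R (e * n * e) (T (f * m * e)))"
        by (rule eq[OF unit_f corner_e_unit[OF True] Q_I])
      then show ?thesis by (simp only: R_corner L_f K RK) (simp add: mult.assoc assoc_ext[OF e] assoc_ext[OF f])
    next
      case False
      have "(f * m * e) * (e * n * e) \<in> NN"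
        by (rule NN_I) (use False Qn(1)[OF Q_I] in \<open>auto dest: ge_multD simp: Q_iff mult.assoc e assoc_ext[OF f]\<close>)
      then have "T (f * m * e * n * e) = 0" using TN by (simp add: mult.assoc assoc_ext[OF e])
      then show ?thesis unfolding R_kill[OF False] .
    qed
    have TLR: "T (f * m * f * e * n * e) = L m (R n (T (f * e)))" for m n
    proof -
      have "T (f * m * f * (e * n) * e) = L m (T (f * (e * n) * e))" by (rule TL)
      moreover have "T (f * 1 * e * n * e) = R n (T (f * 1 * e))" by (rule TR)
      ultimately show ?thesis by (simp add: mult.assoc)
    qed
    \<comment> \<open>\<open>coc_expand\<close> forces this formula for the representative with
      \<open>c e = 0\<close>. It has \<open>c f = T (f * e)\<close>, whence the correction
      term.\<close>
    define c where "c m = T (f * m * e) - R m (T (f * e))" for m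
    have "is_coc c" unfolding is_coc_def
    proof (intro conjI allI)
      show "c m \<in> vsp K" for m unfolding c_def by (rule fv.subspace_diff[OF subspace_vsp K RK])
      fix m n
      have "T (f * (m * n) * e) = L m (T (f * n * e)) + R n (T (f * m * e)) - L m (R n (T (f * e)))"
        using rel[of m n] unfolding TL TR TLR by (simp add: algebra_simps mult.assoc)
      then show "c (m * n) = L m (c n) + R n (c m)" unfolding c_def LL.diff RR.diff R_mult by (simp add: algebra_simps)
    qed
    moreover have "ap c v = ap T v" for v
      unfolding ap_def
    proof (rule sum.cong[OF refl])
      fix a assume a: "a \<in> Q"
      then have "f * a * e = a" by (simp add: Q_iff)
      then show "vsmul (v a) (c a) = vsmul (v a) (T a)" unfolding c_def R_kill[OF Qn(2)[OF a]] by (simp only: diff_zero)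
    qed
    ultimately show ?thesis by blast
  qed
qed

definition ltrel :: "('m \<times> 'm) set" where
  "ltrel = {(f * m * n * e, f * m * f * n * e) | m n. True} \<union> {(f * m * n * e, f * m * e * n * e) | m n. \<not> ge f m}"

text \<open>As \<open>e * f = e\<close>, the map \<open>R f\<close> is the identity and every
  cocycle vanishes at \<open>f\<close>. The left action is zero on fMe. The right action sees
  \<open>a\<close> only through its image in kG_X, so it vanishes on the kernel
  \<open>Uk e\<close>.\<close>

lemma computes_ext_lt:
  assumes lt: "e * f = e" "f * e = e" "\<not> ge f e"
  shows "computes_ext (Uk e) (fv.span (relset ltrel))"
proof (rule computes_extI)
  have ef: "ge e f" using lt by (metis ge_mult_right)
  have Qn: "\<not> ge f a" if "a \<in> Q" for a using Q_ge[OF that] lt(3) ge_trans by blast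
  have R_f: "R f x = x" if "x \<in> vsp K" for x using R_simps(2)[OF that, of f] R_e[OF that] unfolding lt(1) by simp
  have ins: "\<exists>m n p. (p = e \<or> p = f) \<and> a = f * m * n * e \<and> b = f * m * p * n * e" if "(a, b) \<in> ltrel" for a b
    using that unfolding ltrel_def by blast
  note rQ = insertion_Q[OF ins]
  have relU: "delta a - delta b \<in> Uk e" if "(a, b) \<in> ltrel" for a b
    by (rule insertion_Uk[OF e _ _ ins[OF that]]) (use ef lt in \<open>simp_all add: ge_refl e f\<close>)
  show "fv.subspace (Uk e)" by (rule subspace_Uk)
  show "Uk e \<subseteq> vsp Q" unfolding Uk_def by blast
  show "relset ltrel \<subseteq> Uk e" unfolding relset_def using relU delta_in_Uk[OF NN_Q NN_not_ge(2)] by blast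
  show "mact Q (prep e) (g, h) v \<in> Uk e" if "g \<in> Gunits f" "h \<in> Gunits e" "v \<in> Uk e" for g h v
    by (rule Uk_invariant[OF e ge_refl ef that])
  have tr: "(g * a * h, g * b * h) \<in> ltrel" if g: "g \<in> Gunits f" and h: "h \<in> Gunits e" and ab: "(a, b) \<in> ltrel" for g h a b
  proof -
    from ab consider m n where "a = f * m * n * e" "b = f * m * f * n * e"
      | m n where "a = f * m * n * e" "b = f * m * e * n * e" "\<not> ge f m"
      unfolding ltrel_def by blast
    then show ?thesis
    proof cases
      case 1
      show ?thesis unfolding 1 translate_rel[OF g h] ltrel_def by blast
    next
      case 2
      then have "\<not> ge f (g * m)" using ge_multD by blast
      then show ?thesis unfolding 2(1,2) translate_rel[OF g h] ltrel_def by blast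
    qed
  qed
  show "mact Q (prep e) (g, h) s \<in> relset ltrel" if "g \<in> Gunits f" "h \<in> Gunits e" "s \<in> relset ltrel" for g h s
    by (rule relset_inv[OF rQ tr that])
  show "ap (\<lambda>a. L a x) v = 0" for v x unfolding ap_def using L_kill[OF Qn] by (intro sum.neutral) simp
  show "ap (\<lambda>a. R a x) v = 0" if v: "v \<in> Uk e" and x: "x \<in> vsp K" for v x
    by (rule Uk_group[OF e v, where F = "\<lambda>a. R a x"]) (rule R_kill, assumption, rule R_corner[OF x, symmetric])
  have cf: "c f = 0" if c: "is_coc c" for c
    using coc_mult[OF c, of f f] by (simp only: f L_f R_f coc_K[OF c]) (metis add_cancel_left_left)
  show "ap c s = 0" if c: "is_coc c" and s: "s \<in> relset ltrel" for c s
  proof (rule coc_relset[OF c rQ _ s])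
    note K = coc_K[OF c]
    fix a b assume "(a, b) \<in> ltrel"
    then consider m n where "a = f * m * n * e" "b = f * m * f * n * e" | m n where "a = f * m * n * e" "b = f * m * e * n * e" "\<not> ge f m"
      unfolding ltrel_def by blast
    then show "c a = c b"
    proof cases
      case 1
      have "c (f * m * f) = c (f * m)" using coc_mult[OF c, of "f * m" f] by (simp only: cf[OF c] LL.zero R_f K add_0_left)
      moreover have "c (f * m * f * n * e) = L m (c (n * e)) + R n (c (f * m * f))"
        using coc_corner[OF c, of "m * f" "n"] by (simp only: L_simps R_simps K mult.assoc)
      ultimately show ?thesis unfolding 1 coc_corner[OF c, of m n] by (simp only:)
    next
      case 2
      have "c (f * m * e * n * e) = L m (c (e * n * e)) + R n (c (f * m))"
        using coc_corner[OF c, of "m" "e * n"] by (simp only: L_simps R_simps K mult.assoc)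
      then show ?thesis unfolding 2(1,2) coc_corner[OF c, of m n] unfolding L_kill[OF 2(3)] by (simp only:)
    qed
  qed
  \<comment> \<open>A cocycle with \<open>c e = 0\<close> has \<open>c m = c (f * m * e)\<close> and
    \<open>c (e * m * e) = 0\<close>, so all its values are taken at these elements of the
    kernel.\<close>
  have shift: "delta (f * m * e) - delta (e * m * e) \<in> Uk e" for m
  proof (rule diff_in_Uk)
    show "e * m * e \<in> Q" unfolding Q_iff by (simp add: mult.assoc e assoc_ext[OF lt(2)])
    show "ge e (f * m * e) \<longleftrightarrow> ge e (e * m * e)" by (simp add: ge_mult_iff[OF e] ef ge_refl)
    show "e * (f * m * e) * e = e * (e * m * e) * e" by (simp add: mult.assoc assoc_ext[OF lt(1)] assoc_ext[OF e])
  qed (rule Q_I)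
  have eQ: "e * m * e \<in> Q" for m unfolding Q_iff by (simp add: mult.assoc e assoc_ext[OF lt(2)])
  show "\<exists>x\<in>vsp K. \<forall>m. c m = L m x - R m x" if c: "is_coc c" and z: "\<And>v. v \<in> Uk e \<Longrightarrow> ap c v = 0" for c
  proof (intro bexI allI)
    fix m
    note K = coc_K[OF c]
    have "c (f * m * e) = c (e * m * e)" using z[OF shift, of m] unfolding ap_diff ap_delta[OF Q_I] ap_delta[OF eQ] by (simp only: right_minus_eq)
    also have "\<dots> = R m (c e)"
      using coc_mult[OF c, of e "m * e"] by (simp only: L_kill[OF lt(3)] R_simps mult.assoc add_0_left)
    finally show "c m = L m (- c e) - R m (- c e)" using coc_expand[OF c, of m] by (simp only: cf[OF c] LL.neg RR.neg RR.zero) simp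
  qed (rule fv.subspace_neg[OF subspace_vsp coc_K[OF c]])
  show "\<exists>c. is_coc c \<and> (\<forall>v\<in>Uk e. ap c v = ap T v)"
    if K: "\<And>a. T a \<in> vsp K" and S: "\<And>s. s \<in> relset ltrel \<Longrightarrow> ap T s = 0"
      and eqv: "\<And>g h v. g \<in> Gunits f \<Longrightarrow> h \<in> Gunits e \<Longrightarrow> v \<in> Uk e \<Longrightarrow> ap (\<lambda>a. T (g * a * h)) v = L g (R h (ap T v))" for T
  proof -
    note TN = relset_zeroD(1)[OF S rQ] and Trel = relset_zeroD(2)[OF S rQ]
    have r1: "T (f * m * n * e) = T (f * m * f * n * e)" for m n by (rule Trel) (auto simp: ltrel_def)
    have r2: "T (f * m * n * e) = T (f * m * e * n * e)" if "\<not> ge f m" for m n by (rule Trel) (use that in \<open>auto simp: ltrel_def\<close>)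
    have eq: "T (g * (f * m * e) * h) - T (g * (e * m * e) * h) = L g (R h (T (f * m * e) - T (e * m * e)))"
      if "g \<in> Gunits f" "h \<in> Gunits e" for g h m
      using eqv[OF that shift, of m] unfolding ap_diff ap_delta[OF Q_I] ap_delta[OF eQ] .
    \<comment> \<open>\<open>T\<close> is equivariant on \<open>Uk e\<close> only, so it may enter
      only through differences from the kernel. The identities \<open>A\<close>, \<open>B\<close>
      and \<open>C\<close> then telescope to the product rule.\<close>
    define c where "c m = T (f * m * e) - T (e * m * e)" for m
    have A: "R n (c m) = T (f * m * e * n * e) - T (e * m * e * n * e)" for m n
    proof (cases "ge e n")
      case True
      have "T (f * (f * m * e) * (e * n * e)) - T (f * (e * m * e) * (e * n * e)) = L f (R (e * n * e) (c m))"
        unfolding c_def by (rule eq[OF unit_f corner_e_unit[OF True]])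
      moreover have "c m \<in> vsp K" unfolding c_def by (rule fv.subspace_diff[OF subspace_vsp K K])
      ultimately show ?thesis by (simp only: R_corner L_f RK) (simp add: mult.assoc assoc_ext[OF e] assoc_ext[OF f] assoc_ext[OF lt(2)])
    next
      case False
      have "(f * m * e) * (e * n * e) \<in> NN"
        by (rule NN_I) (use False Qn[OF Q_I] in \<open>auto dest: ge_multD simp: Q_iff mult.assoc e assoc_ext[OF f]\<close>)
      moreover have "(e * m * e) * (e * n * e) \<in> NN"
        by (rule NN_I) (use False Qn[OF eQ] in \<open>auto dest: ge_multD simp: Q_iff mult.assoc e assoc_ext[OF lt(2)]\<close>)
      ultimately have "T (f * m * e * n * e) = 0" "T (e * m * e * n * e) = 0" using TN by (simp_all add: mult.assoc assoc_ext[OF e])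
      then show ?thesis unfolding R_kill[OF False] by (simp only: diff_self)
    qed
    have B: "L m (c n) = T (f * m * n * e) - T (f * m * e * n * e)" for m n
    proof (cases "ge f m")
      case True
      have "T (f * m * f * (f * n * e) * e) - T (f * m * f * (e * n * e) * e) = L (f * m * f) (R e (c n))"
        unfolding c_def by (rule eq[OF corner_f_unit[OF True] unit_e])
      moreover have "c n \<in> vsp K" unfolding c_def by (rule fv.subspace_diff[OF subspace_vsp K K])
      ultimately have "L m (c n) = T (f * m * f * (f * n * e) * e) - T (f * m * f * (e * n * e) * e)" by (simp only: L_corner R_e)
      moreover have "f * m * f * (f * n * e) * e = f * m * f * n * e" "f * m * f * (e * n * e) * e = f * m * e * n * e"
        by (simp_all add: mult.assoc e assoc_ext[OF f] assoc_ext[OF lt(2)])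
      ultimately show ?thesis unfolding r1[of m n] by (simp only:)
    next
      case False
      show ?thesis unfolding L_kill[OF False] r2[OF False] by (simp only: diff_self)
    qed
    have C: "T (e * m * n * e) = T (e * m * e * n * e)" for m n
    proof -
      have "\<not> ge f (e * m)" using lt(3) ge_multD by blast
      from r2[OF this, of n] show ?thesis by (simp add: mult.assoc assoc_ext[OF lt(2)])
    qed
    have "is_coc c" unfolding is_coc_def
    proof (intro conjI allI)
      show "c m \<in> vsp K" for m unfolding c_def by (rule fv.subspace_diff[OF subspace_vsp K K])
      fix m n
      have "c (m * n) = T (f * m * n * e) - T (e * m * n * e)" by (simp only: c_def mult.assoc)
      then show "c (m * n) = L m (c n) + R n (c m)" unfolding A B C by simp
    qed
    moreover have "ap c v = ap T v" if v: "v \<in> Uk e" for v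
    proof -
      \<comment> \<open>The subtracted term factors through the map to kG_X: for \<open>a\<close>
        outside \<open>M_X\<close> the product \<open>e * a\<close> lies in \<open>NN\<close>, where
        \<open>T\<close> vanishes.\<close>
      have "ap (\<lambda>a. T (e * a * e)) v = 0"
      proof (rule Uk_group[OF e v, where F = T])
        fix a assume a: "a \<in> Q" "\<not> ge e a"
        have "e * a \<in> NN" by (rule NN_I) (use a lt in \<open>auto simp: Q_iff mult.assoc assoc_ext[OF lt(2)]\<close>)
        then show "T (e * a * e) = 0" using TN a by (simp add: Q_iff mult.assoc)
      qed simp
      moreover have "ap c v = ap T v - ap (\<lambda>a. T (e * a * e)) v"
        unfolding ap_def sum_subtractf[symmetric] fv.scale_right_diff_distrib[symmetric]
        by (rule sum.cong) (simp_all only: c_def Q_iff)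
      ultimately show ?thesis by (simp only: diff_zero)
    qed
    ultimately show ?thesis by blast
  qed
qed

end

context bimodule_ext begin

definition gtrel :: "('m \<times> 'm) set" where
  "gtrel = {(f * m * n * e, f * m * e * n * e) | m n. True} \<union> {(f * m * n * e, f * m * f * n * e) | m n. \<not> ge e n}"

text \<open>The mirror image of the case X < Y: every cocycle now vanishes at \<open>e\<close>, and
  the remaining freedom is spent on \<open>c f = 0\<close>. This is why \<open>f * m * f\<close>
  replaces \<open>e * m * e\<close> in the formula for the cocycle.\<close>

lemma computes_ext_gt:
  assumes gt: "e * f = f" "f * e = f" "\<not> ge e f"
  shows "computes_ext (Uk f) (fv.span (relset gtrel))"
proof (rule computes_extI)
  have fe: "ge f e" using gt by (metis ge_mult_right)
  have Qn: "\<not> ge e a" if "a \<in> Q" for a using Q_ge[OF that] gt(3) ge_trans by blast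
  have L_e: "L e x = x" if "x \<in> vsp K" for x using L_mult[of e f x] L_f[OF that] unfolding gt(1) by simp
  have ins: "\<exists>m n p. (p = e \<or> p = f) \<and> a = f * m * n * e \<and> b = f * m * p * n * e" if "(a, b) \<in> gtrel" for a b
    using that unfolding gtrel_def by blast
  note rQ = insertion_Q[OF ins]
  have relU: "delta a - delta b \<in> Uk f" if "(a, b) \<in> gtrel" for a b
    by (rule insertion_Uk[OF f _ _ ins[OF that]]) (use fe gt in \<open>simp_all add: ge_refl e f\<close>)
  show "fv.subspace (Uk f)" by (rule subspace_Uk)
  show "Uk f \<subseteq> vsp Q" unfolding Uk_def by blast
  show "relset gtrel \<subseteq> Uk f" unfolding relset_def using relU delta_in_Uk[OF NN_Q NN_not_ge(1)] by blast
  show "mact Q (prep e) (g, h) v \<in> Uk f" if "g \<in> Gunits f" "h \<in> Gunits e" "v \<in> Uk f" for g h v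
    by (rule Uk_invariant[OF f fe ge_refl that])
  have tr: "(g * a * h, g * b * h) \<in> gtrel" if g: "g \<in> Gunits f" and h: "h \<in> Gunits e" and ab: "(a, b) \<in> gtrel" for g h a b
  proof -
    from ab consider m n where "a = f * m * n * e" "b = f * m * e * n * e"
      | m n where "a = f * m * n * e" "b = f * m * f * n * e" "\<not> ge e n"
      unfolding gtrel_def by blast
    then show ?thesis
    proof cases
      case 1
      show ?thesis unfolding 1 translate_rel[OF g h] gtrel_def by blast
    next
      case 2
      then have "\<not> ge e (n * h)" using ge_multD by blast
      then show ?thesis unfolding 2(1,2) translate_rel[OF g h] gtrel_def by blast
    qed
  qed
  show "mact Q (prep e) (g, h) s \<in> relset gtrel" if "g \<in> Gunits f" "h \<in> Gunits e" "s \<in> relset gtrel" for g h s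
    by (rule relset_inv[OF rQ tr that])
  show "ap (\<lambda>a. R a x) v = 0" for v x unfolding ap_def using R_kill[OF Qn] by (intro sum.neutral) simp
  show "ap (\<lambda>a. L a x) v = 0" if v: "v \<in> Uk f" and x: "x \<in> vsp K" for v x
    by (rule Uk_group[OF f v, where F = "\<lambda>a. L a x"]) (rule L_kill, assumption, rule L_corner[OF x, symmetric])
  have ce: "c e = 0" if c: "is_coc c" for c
    using coc_mult[OF c, of e e] by (simp only: e L_e R_e coc_K[OF c]) (metis add_cancel_left_left)
  show "ap c s = 0" if c: "is_coc c" and s: "s \<in> relset gtrel" for c s
  proof (rule coc_relset[OF c rQ _ s])
    note K = coc_K[OF c]
    fix a b assume "(a, b) \<in> gtrel"
    then consider m n where "a = f * m * n * e" "b = f * m * e * n * e" | m n where "a = f * m * n * e" "b = f * m * f * n * e" "\<not> ge e n"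
      unfolding gtrel_def by blast
    then show "c a = c b"
    proof cases
      case 1
      have "c (e * n * e) = c (n * e)" using coc_mult[OF c, of e "n * e"] by (simp only: ce[OF c] RR.zero L_e K add_0_right mult.assoc)
      moreover have "c (f * m * e * n * e) = L m (c (e * n * e)) + R n (c (f * m))"
        using coc_corner[OF c, of "m" "e * n"] by (simp only: L_simps R_simps K mult.assoc)
      ultimately show ?thesis unfolding 1 coc_corner[OF c, of m n] by (simp only:)
    next
      case 2
      have "c (f * m * f * n * e) = L m (c (n * e)) + R n (c (f * m * f))"
        using coc_corner[OF c, of "m * f" "n"] by (simp only: L_simps R_simps K mult.assoc)
      then show ?thesis unfolding 2(1,2) coc_corner[OF c, of m n] unfolding R_kill[OF 2(3)] by (simp only:)
    qed
  qed
  have fQ: "f * m * f \<in> Q" for m unfolding Q_iff by (simp add: mult.assoc gt assoc_ext[OF f])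
  have shift: "delta (f * m * e) - delta (f * m * f) \<in> Uk f" for m
  proof (rule diff_in_Uk[OF Q_I fQ])
    show "ge f (f * m * e) \<longleftrightarrow> ge f (f * m * f)" by (simp add: ge_mult_iff[OF f] fe ge_refl)
    show "f * (f * m * e) * f = f * (f * m * f) * f" by (simp add: mult.assoc gt f)
  qed
  show "\<exists>x\<in>vsp K. \<forall>m. c m = L m x - R m x" if c: "is_coc c" and z: "\<And>v. v \<in> Uk f \<Longrightarrow> ap c v = 0" for c
  proof (intro bexI allI)
    fix m
    note K = coc_K[OF c]
    have "c (f * m * e) = c (f * m * f)" using z[OF shift, of m] unfolding ap_diff ap_delta[OF Q_I] ap_delta[OF fQ] by (simp only: right_minus_eq)
    also have "\<dots> = L m (c f)"
      using coc_mult[OF c, of "f * m" f] by (simp only: R_kill[OF gt(3)] L_simps add_0_right)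
    finally show "c m = L m (c f) - R m (c f)" using coc_expand[OF c, of m] by (simp only: ce[OF c] LL.zero) simp
  qed (rule coc_K[OF c])
  show "\<exists>c. is_coc c \<and> (\<forall>v\<in>Uk f. ap c v = ap T v)"
    if K: "\<And>a. T a \<in> vsp K" and S: "\<And>s. s \<in> relset gtrel \<Longrightarrow> ap T s = 0"
      and eqv: "\<And>g h v. g \<in> Gunits f \<Longrightarrow> h \<in> Gunits e \<Longrightarrow> v \<in> Uk f \<Longrightarrow> ap (\<lambda>a. T (g * a * h)) v = L g (R h (ap T v))" for T
  proof -
    note TN = relset_zeroD(1)[OF S rQ] and Trel = relset_zeroD(2)[OF S rQ]
    have r1: "T (f * m * n * e) = T (f * m * e * n * e)" for m n by (rule Trel) (auto simp: gtrel_def)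
    have r2: "T (f * m * n * e) = T (f * m * f * n * e)" if "\<not> ge e n" for m n by (rule Trel) (use that in \<open>auto simp: gtrel_def\<close>)
    have eq: "T (g * (f * m * e) * h) - T (g * (f * m * f) * h) = L g (R h (T (f * m * e) - T (f * m * f)))"
      if "g \<in> Gunits f" "h \<in> Gunits e" for g h m
      using eqv[OF that shift, of m] unfolding ap_diff ap_delta[OF Q_I] ap_delta[OF fQ] .
    define c where "c m = T (f * m * e) - T (f * m * f)" for m
    have cK: "c m \<in> vsp K" for m unfolding c_def by (rule fv.subspace_diff[OF subspace_vsp K K])
    have A: "L m (c n) = T (f * m * f * n * e) - T (f * m * f * n * f)" for m n
    proof (cases "ge f m")
      case True
      have "T (f * m * f * (f * n * e) * e) - T (f * m * f * (f * n * f) * e) = L (f * m * f) (R e (c n))"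
        unfolding c_def by (rule eq[OF corner_f_unit[OF True] unit_e])
      then show ?thesis by (simp only: L_corner R_e cK) (simp add: mult.assoc e gt assoc_ext[OF f])
    next
      case False
      have "(f * m * f) * (f * n * e) \<in> NN"
        by (rule NN_I) (use False Qn[OF Q_I] in \<open>auto dest: ge_multD simp: Q_iff mult.assoc e assoc_ext[OF f]\<close>)
      moreover have "(f * m * f) * (f * n * f) \<in> NN"
        by (rule NN_I) (use False Qn[OF fQ] in \<open>auto dest: ge_multD simp: Q_iff mult.assoc gt assoc_ext[OF f]\<close>)
      ultimately have "T (f * m * f * n * e) = 0" "T (f * m * f * n * f) = 0" using TN by (simp_all add: mult.assoc assoc_ext[OF f])
      then show ?thesis unfolding L_kill[OF False] by (simp only: diff_self)
    qed
    have B: "R n (c m) = T (f * m * n * e) - T (f * m * f * n * e)" for m n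
    proof (cases "ge e n")
      case True
      have "T (f * (f * m * e) * (e * n * e)) - T (f * (f * m * f) * (e * n * e)) = L f (R (e * n * e) (c m))"
        unfolding c_def by (rule eq[OF unit_f corner_e_unit[OF True]])
      then have "R n (c m) = T (f * (f * m * e) * (e * n * e)) - T (f * (f * m * f) * (e * n * e))" by (simp only: R_corner L_f RK cK)
      moreover have "f * (f * m * e) * (e * n * e) = f * m * e * n * e" "f * (f * m * f) * (e * n * e) = f * m * f * n * e"
        by (simp_all add: mult.assoc assoc_ext[OF e] assoc_ext[OF f] assoc_ext[OF gt(2)])
      ultimately show ?thesis unfolding r1[of m n] by (simp only:)
    next
      case False
      show ?thesis unfolding R_kill[OF False] r2[OF False] by (simp only: diff_self)
    qed
    have C: "T (f * m * n * f) = T (f * m * f * n * f)" for m n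
    proof -
      have "\<not> ge e (n * f)" using gt(3) ge_multD by blast
      from r2[OF this, of m] show ?thesis by (simp add: mult.assoc gt)
    qed
    have "is_coc c" unfolding is_coc_def
    proof (intro conjI allI)
      show "c m \<in> vsp K" for m by (rule cK)
      fix m n
      have "c (m * n) = T (f * m * n * e) - T (f * m * n * f)" by (simp only: c_def mult.assoc)
      then show "c (m * n) = L m (c n) + R n (c m)" unfolding A B C by simp
    qed
    moreover have "ap c v = ap T v" if v: "v \<in> Uk f" for v
    proof -
      have "ap (\<lambda>a. T (f * a * f)) v = 0"
      proof (rule Uk_group[OF f v, where F = T])
        fix a assume a: "a \<in> Q" "\<not> ge f a"
        have "a * f \<in> NN" by (rule NN_I) (use a gt in \<open>auto simp: Q_iff mult.assoc[symmetric]\<close>, simp add: mult.assoc gt)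
        then show "T (f * a * f) = 0" using TN a by (simp add: Q_iff)
      qed simp
      moreover have "ap c v = ap T v - ap (\<lambda>a. T (f * a * f)) v"
        unfolding ap_def sum_subtractf[symmetric] fv.scale_right_diff_distrib[symmetric]
        by (rule sum.cong) (simp_all only: c_def Q_iff)
      ultimately show ?thesis by (simp only: diff_zero)
    qed
    ultimately show ?thesis by blast
  qed
qed

definition diagrel :: "('m \<times> 'm) set" where
  "diagrel = {(e * m * n * e, e * m * e * n * e) | m n. \<not> ge e (m * n)}"

text \<open>The averaging identity behind the vanishing of the first cohomology of a finite group of
  invertible order, stated without dividing by the order.\<close>

lemma coc_unit_coboundary:
  assumes c: "is_coc c" and g: "g \<in> Gunits e"
  shows "vsmul (of_nat (card (Gunits e))) (c g) = R g (\<Sum>h\<in>Gunits e. R (ginv e h) (c h)) - L g (\<Sum>h\<in>Gunits e. R (ginv e h) (c h))"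
proof -
  have 1: "L g (R (ginv e h) (c h)) = R (ginv e h) (c (g * h)) - c g" if h: "h \<in> Gunits e" for h
  proof -
    have "R (ginv e h) (c (g * h)) = R (ginv e h) (L g (c h)) + R (h * ginv e h) (c g)"
      unfolding coc_mult[OF c] RR.add R_mult ..
    then show ?thesis unfolding LR E.inv_mul(2)[OF h] R_e[OF coc_K[OF c]] by simp
  qed
  have "R g (\<Sum>h\<in>Gunits e. R (ginv e h) (c h)) = (\<Sum>h\<in>Gunits e. R (ginv e h * g) (c h))"
    unfolding RR.sum R_mult ..
  also have "\<dots> = (\<Sum>h\<in>Gunits e. R (ginv e (g * h) * g) (c (g * h)))"
    by (rule sum.reindex_bij_betw[OF E.bij_left[OF g], symmetric])
  also have "\<dots> = (\<Sum>h\<in>Gunits e. R (ginv e h) (c (g * h)))"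
  proof (rule sum.cong[OF refl])
    fix h assume h: "h \<in> Gunits e"
    have "ginv e (g * h) * g = ginv e h * (ginv e g * g)" using g h by (simp add: E.inv_mul_rev mult.assoc)
    also have "\<dots> = ginv e h" using g h by (simp add: E.inv_mul E.unit E.inv)
    finally show "R (ginv e (g * h) * g) (c (g * h)) = R (ginv e h) (c (g * h))" by simp
  qed
  moreover have "L g (\<Sum>h\<in>Gunits e. R (ginv e h) (c h)) = (\<Sum>h\<in>Gunits e. R (ginv e h) (c (g * h)) - c g)"
    unfolding LL.sum by (rule sum.cong[OF refl]) (rule 1)
  moreover have "(\<Sum>h\<in>Gunits e. c g) = vsmul (of_nat (card (Gunits e))) (c g)"
    by (rule ext) (simp add: sum_fun_apply)
  ultimately show ?thesis by (simp add: sum_subtractf)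
qed

text \<open>Both actions are zero outside \<open>M_X\<close>, hence on the span of the non-units. On
  the units a cocycle is a group cocycle and can be made zero; the rest of it is determined by its
  values on the non-units of eMe.\<close>

lemma computes_ext_diag:
  assumes fe: "f = e" and card: "(of_nat (card (Gunits e)) :: 'k) \<noteq> 0"
  shows "computes_ext (vsp (Q - Gunits e)) (fv.span (relset diagrel))"
proof (rule computes_extI)
  have Qe_iff: "a \<in> Q \<longleftrightarrow> e * a = a \<and> a * e = a" for a using Q_iff[of a] by (simp only: fe)
  have unit_iff: "a \<in> Gunits e \<longleftrightarrow> ge e a" if "a \<in> Q" for a
    using that Qe_iff Gunits_iff[OF e, of a] by blast
  have L_e: "L e x = x" if "x \<in> vsp K" for x using L_f[OF that] unfolding fe .
  have L_kill': "L m x = 0" if "\<not> ge e m" for m x by (rule L_kill) (use that fe in simp)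
  have rQ: "a \<in> Q \<and> b \<in> Q" if "(a, b) \<in> diagrel" for a b
    using that unfolding diagrel_def Qe_iff by (auto simp: mult.assoc e assoc_ext[OF e])
  have rn: "\<not> ge e a \<and> \<not> ge e b" if "(a, b) \<in> diagrel" for a b
    using that unfolding diagrel_def by (auto simp: ge_mult_iff[OF e])
  show "fv.subspace (vsp (Q - Gunits e))" by (rule subspace_vsp)
  show "(vsp (Q - Gunits e) :: ('m \<Rightarrow> 'k) set) \<subseteq> vsp Q" unfolding vsp_def by blast
  have dU: "delta a \<in> vsp (Q - Gunits e)" if "a \<in> Q" "\<not> ge e a" for a
    using that unit_iff by (intro delta_in_vsp) auto
  show "relset diagrel \<subseteq> vsp (Q - Gunits e)" unfolding relset_def
    using dU[OF NN_Q NN_not_ge(2)] fv.subspace_diff[OF subspace_vsp dU dU] rQ rn by blast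
  show "mact Q (prep e) (g, h) v \<in> vsp (Q - Gunits e)" if g: "g \<in> Gunits f" and h: "h \<in> Gunits e" and v: "v \<in> vsp (Q - Gunits e)" for g h and v :: "'m \<Rightarrow> 'k"
  proof -
    have "mact Q (prep e) (g, h) v a = 0" if a: "a \<notin> Q - Gunits e" for a
    proof (cases "a \<in> Q")
      case True
      then have ua: "a \<in> Gunits e" using a by blast
      have "mact Q (prep e) (g, h) v a = (\<Sum>x\<in>Q. if x = a then mact Q (prep e) (g, h) v a else 0)"
        using True by simp
      also have "\<dots> = (\<Sum>x\<in>Q. mact Q (prep e) (g, h) v x * (if x = a then 1 else 0))"
        by (rule sum.cong) auto
      also have "\<dots> = (\<Sum>b\<in>Q. v b * (if g * b * ginv e h = a then 1 else 0))" by (rule sum_mact_prep[OF e f g h])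
      also have "\<dots> = 0"
      proof (rule sum.neutral, rule ballI)
        fix b assume b: "b \<in> Q"
        have "v b = 0" if "g * b * ginv e h = a"
        proof -
          have "ge e b" using Gunits_geD[OF e ua] ge_multD unfolding that[symmetric] by blast
          then show ?thesis using v unit_iff[OF b] unfolding vsp_def by blast
        qed
        then show "v b * (if g * b * ginv e h = a then 1 else 0) = 0" by simp
      qed
      finally show ?thesis .
    next
      case False
      then show ?thesis by (simp add: mact_def)
    qed
    then show ?thesis unfolding vsp_def by blast
  qed
  have tr: "(g * a * h, g * b * h) \<in> diagrel" if g: "g \<in> Gunits f" and h: "h \<in> Gunits e" and ab: "(a, b) \<in> diagrel" for g h a b
  proof -
    obtain m n where mn: "a = e * m * n * e" "b = e * m * e * n * e" "\<not> ge e (m * n)" using ab unfolding diagrel_def by blast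
    have "\<not> ge e ((g * m) * (n * h))" using mn(3) by (auto simp add: ge_mult_iff[OF e])
    moreover have "g * a * h = e * (g * m) * (n * h) * e" "g * b * h = e * (g * m) * e * (n * h) * e"
      using translate_rel(1)[OF g h, of m n] translate_rel(2)[OF g h, of m e n] unfolding mn fe by simp_all
    ultimately show ?thesis unfolding diagrel_def by blast
  qed
  show "mact Q (prep e) (g, h) s \<in> relset diagrel" if "g \<in> Gunits f" "h \<in> Gunits e" "s \<in> relset diagrel" for g h s
    by (rule relset_inv[OF rQ tr that])
  have van: "ap T v = 0" if v: "v \<in> vsp (Q - Gunits e)" and T: "\<And>a. a \<in> Q \<Longrightarrow> \<not> ge e a \<Longrightarrow> T a = 0" for T v
    unfolding ap_def
  proof (rule sum.neutral, rule ballI)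
    fix a assume a: "a \<in> Q"
    show "vsmul (v a) (T a) = 0"
    proof (cases "ge e a")
      case True
      then have "v a = 0" using v unit_iff[OF a] unfolding vsp_def by blast
      then show ?thesis by simp
    next
      case False
      then show ?thesis using T[OF a] by simp
    qed
  qed
  show "ap (\<lambda>a. L a x) v = 0" if "v \<in> vsp (Q - Gunits e)" for v x by (rule van[OF that]) (rule L_kill')
  show "ap (\<lambda>a. R a x) v = 0" if "v \<in> vsp (Q - Gunits e)" for v x by (rule van[OF that]) (rule R_kill)
  have ce: "c e = 0" if c: "is_coc c" for c
    using coc_mult[OF c, of e e] by (simp only: e L_e R_e coc_K[OF c]) (metis add_cancel_left_left)
  show "ap c s = 0" if c: "is_coc c" and s: "s \<in> relset diagrel" for c s
  proof (rule coc_relset[OF c rQ _ s])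
    note K = coc_K[OF c]
    fix a b assume "(a, b) \<in> diagrel"
    then obtain m n where mn: "a = e * m * n * e" "b = e * m * e * n * e" unfolding diagrel_def by blast
    have "c (e * n * e) = c (n * e)" using coc_mult[OF c, of e "n * e"] by (simp only: ce[OF c] RR.zero L_e K add_0_right mult.assoc)
    moreover have "c (f * m * e * n * e) = L m (c (e * n * e)) + R n (c (f * m))"
      using coc_corner[OF c, of "m" "e * n"] by (simp only: L_simps R_simps K mult.assoc)
    ultimately show "c a = c b" using coc_corner[OF c, of m n] unfolding mn fe by (simp only:)
  qed
  show "\<exists>x\<in>vsp K. \<forall>m. c m = L m x - R m x" if c: "is_coc c" and z: "\<And>v. v \<in> vsp (Q - Gunits e) \<Longrightarrow> ap c v = 0" for c
  proof -
    \<comment> \<open>Averaging over the group splits the cocycle on the units.\<close>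
    define s where "s = (\<Sum>h\<in>Gunits e. R (ginv e h) (c h))"
    define x where "x = vsmul (- inverse (of_nat (card (Gunits e)))) s"
    have x: "x \<in> vsp K" unfolding x_def s_def
      by (intro fv.subspace_scale[OF subspace_vsp] fv.subspace_sum[OF subspace_vsp] RK)
    have cg: "c g = L g x - R g x" if g: "g \<in> Gunits e" for g
    proof -
      have "c g = vsmul (inverse (of_nat (card (Gunits e)))) (vsmul (of_nat (card (Gunits e))) (c g))" using card by simp
      also have "\<dots> = L g x - R g x"
        unfolding coc_unit_coboundary[OF c g] s_def[symmetric] x_def LL.scale RR.scale
        by (rule ext) (simp add: algebra_simps)
      finally show ?thesis .
    qed
    have "c m = L m x - R m x" for m
    proof -
      have ex: "c m = c (e * m * e)" using coc_expand[OF c, of m] unfolding fe by (simp only: ce[OF c] LL.zero RR.zero diff_zero)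
      show ?thesis
      proof (cases "ge e m")
        case True
        have "L (e * m * e) x = L m x" using L_corner[OF x, of m] unfolding fe .
        then show ?thesis unfolding ex cg[OF corner_e_unit[OF True]] R_corner[OF x] by (simp only:)
      next
        case False
        have q: "e * m * e \<in> Q" using Q_I[of m] unfolding fe .
        have "\<not> ge e (e * m * e)" using False by (simp add: ge_mult_iff[OF e])
        from z[OF dU[OF q this]] have "c (e * m * e) = 0" unfolding ap_delta[OF q] .
        then show ?thesis unfolding ex L_kill'[OF False] R_kill[OF False] by (simp only: diff_self)
      qed
    qed
    then show ?thesis using x by blast
  qed
  show "\<exists>c. is_coc c \<and> (\<forall>v\<in>vsp (Q - Gunits e). ap c v = ap T v)"
    if K: "\<And>a. T a \<in> vsp K" and S: "\<And>s. s \<in> relset diagrel \<Longrightarrow> ap T s = 0"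
      and eqv: "\<And>g h v. g \<in> Gunits f \<Longrightarrow> h \<in> Gunits e \<Longrightarrow> v \<in> vsp (Q - Gunits e) \<Longrightarrow> ap (\<lambda>a. T (g * a * h)) v = L g (R h (ap T v))" for T
  proof -
    note TN = relset_zeroD(1)[OF S rQ] and Trel = relset_zeroD(2)[OF S rQ]
    have r: "T (e * m * n * e) = T (e * m * e * n * e)" if "\<not> ge e (m * n)" for m n by (rule Trel) (use that in \<open>auto simp: diagrel_def\<close>)
    have eQ: "e * m * e \<in> Q" for m using Q_I[of m] unfolding fe .
    have eq: "T (g * (e * m * e) * h) = L g (R h (T (e * m * e)))" if "g \<in> Gunits e" "h \<in> Gunits e" "\<not> ge e m" for g h m
    proof -
      have "\<not> ge e (e * m * e)" using that(3) by (simp add: ge_mult_iff[OF e])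
      have g: "g \<in> Gunits f" using that(1) fe by simp
      from eqv[OF g that(2) dU[OF eQ \<open>\<not> ge e (e * m * e)\<close>]] show ?thesis unfolding ap_delta[OF eQ] .
    qed
    \<comment> \<open>The normalised representative vanishes on \<open>M_X\<close>. As maps are
      compared on non-units only, the values of \<open>T\<close> on units are discarded.\<close>
    define c where "c m = (if ge e m then 0 else T (e * m * e))" for m
    have cK: "c m \<in> vsp K" for m
    proof (cases "ge e m")
      case True
      show ?thesis unfolding c_def if_P[OF True] by (rule fv.subspace_0[OF subspace_vsp])
    next
      case False
      show ?thesis unfolding c_def if_not_P[OF False] by (rule K)
    qed
    have Lc: "L (e * m * e) y = L m y" if "y \<in> vsp K" for m y using L_corner[OF that, of m] unfolding fe .
    have "is_coc c" unfolding is_coc_def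
    proof (intro conjI allI)
      show "c m \<in> vsp K" for m by (rule cK)
      fix m n
      have pos: "c k = 0" if "ge e k" for k unfolding c_def using that by (simp only: if_True)
      have neg: "c k = T (e * k * e)" if "\<not> ge e k" for k unfolding c_def using that by (simp only: if_False)
      \<comment> \<open>If both factors lie in \<open>M_X\<close>, so does their product, by
        rectangularity, and the zero values are consistent. The mixed cases rest on equivariance,
        the last one on \<open>NN\<close>.\<close>
      consider "ge e m" "ge e n" | "ge e m" "\<not> ge e n" | "\<not> ge e m" "ge e n" | "\<not> ge e m" "\<not> ge e n" by blast
      then show "c (m * n) = L m (c n) + R n (c m)"
      proof cases
        case 1
        then show ?thesis using ge_mult[OF e 1] by (simp only: pos LL.zero RR.zero add_0_left)
      next
        case 2
        then have n: "\<not> ge e (m * n)" by (simp add: ge_mult_iff[OF e])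
        have "c (m * n) = T (e * m * e * (e * n * e) * e)"
          using r[OF n] by (simp only: neg[OF n]) (simp add: mult.assoc e assoc_ext[OF e])
        also have "\<dots> = L (e * m * e) (R e (T (e * n * e)))" by (rule eq[OF corner_e_unit[OF 2(1)] unit_e 2(2)])
        also have "\<dots> = L m (c n)" by (simp only: neg[OF 2(2)] R_e K Lc)
        finally show ?thesis by (simp only: pos[OF 2(1)] RR.zero add_0_right)
      next
        case 3
        then have n: "\<not> ge e (m * n)" by (simp add: ge_mult_iff[OF e])
        have "c (m * n) = T (e * (e * m * e) * (e * n * e))"
          using r[OF n] by (simp only: neg[OF n]) (simp add: mult.assoc e assoc_ext[OF e])
        also have "\<dots> = L e (R (e * n * e) (T (e * m * e)))" by (rule eq[OF unit_e corner_e_unit[OF 3(2)] 3(1)])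
        also have "\<dots> = R n (c m)" by (simp only: neg[OF 3(1)] R_corner L_e K RK)
        finally show ?thesis by (simp only: pos[OF 3(2)] LL.zero add_0_left)
      next
        case 4
        then have n: "\<not> ge e (m * n)" by (simp add: ge_mult_iff[OF e])
        have "(e * m * e) * (e * n * e) \<in> Q" unfolding Qe_iff by (simp add: mult.assoc e assoc_ext[OF e])
        then have "(e * m * e) * (e * n * e) \<in> NN"
          by (rule NN_I[rotated 2]) (use 4 fe in \<open>simp_all add: ge_mult_iff[OF e]\<close>)
        then have "T ((e * m * e) * (e * n * e)) = 0" using TN by (simp only:)
        then have "c (m * n) = 0" using r[OF n] by (simp only: neg[OF n]) (simp add: mult.assoc assoc_ext[OF e])
        then show ?thesis unfolding L_kill'[OF 4(1)] R_kill[OF 4(2)] by (simp only: add_0_left)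
      qed
    qed
    moreover have "ap c v = ap T v" if v: "v \<in> vsp (Q - Gunits e)" for v
    proof -
      have "ap (\<lambda>a. c a - T a) v = 0"
      proof (rule van[OF v])
        fix a assume "a \<in> Q" "\<not> ge e a"
        then show "c a - T a = 0" unfolding c_def Qe_iff by (simp only: if_False diff_self)
      qed
      then show ?thesis unfolding ap_def fv.scale_right_diff_distrib sum_subtractf by (simp only: right_minus_eq)
    qed
    ultimately show ?thesis by blast
  qed
qed

end

context bimodule_ext begin

section \<open>The bimodule of linear maps and the quiver\<close>

lemma setmul_NN: "setmul (nabla (ideal_of f)) (nabla (ideal_of e)) \<inter> Q = NN"
  unfolding setmul_def NN_def nabla_iff ..

lemma Uk_eq: "{v \<in> vsp Q. \<forall>g\<in>Gunits d. (\<Sum>a\<in>{a \<in> Q. ge d a \<and> d * a * d = g}. v a) = 0} = Uk d"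
proof -
  have "(\<Sum>a\<in>{a \<in> Q. ge d a \<and> d * a * d = g}. v a) = (\<Sum>a\<in>Q. v a * (if ge d a \<and> d * a * d = g then 1 else 0))" for v :: "'m \<Rightarrow> 'k" and g
    by (rule sum.mono_neutral_cong_left) auto
  then show ?thesis unfolding Uk_def by (simp only:)
qed

lemma Zsp_eq: "Zsp e f r = fv.span (relset r)"
  unfolding Zsp_def Let_def setmul_NN relset_def by (rule rel_span_eq)

lemma Vinc_eq: "Vinc e f = (vsp Q, fv.span incset)"
proof -
  have "(\<lambda>x. delta (f * m * n * e) x + delta (f * m * f * e * n * e) x - delta (f * m * f * n * e) x - delta (f * m * e * n * e) x)
     = delta (f * m * n * e) + delta (f * m * f * e * n * e) - delta (f * m * f * n * e) - (delta (f * m * e * n * e) :: 'm \<Rightarrow> 'k)" for m n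
    by (rule ext) simp
  then show ?thesis unfolding Vinc_def Let_def lspan_eq_span incset_def Int_commute[of Q] setmul_NN by (simp only:)
qed

lemma Vlt_eq: "Vlt e f = (Uk e, fv.span (relset ltrel))"
  unfolding Vlt_def Let_def Zsp_eq subset_sigma_iff[OF e] subset_sigma_iff[OF f] Uk_eq ltrel_def ..

lemma Vgt_eq: "Vgt e f = (Uk f, fv.span (relset gtrel))"
  unfolding Vgt_def Let_def Zsp_eq subset_sigma_iff[OF e] subset_sigma_iff[OF f] Uk_eq gtrel_def ..

text \<open>The units of eMe are the elements of eMe in \<open>M_X\<close>, which translates the
  removal of the group into a condition on \<open>ge\<close>.\<close>

lemma Vdiag_eq: assumes fe: "f = e" shows "Vdiag e = (vsp (Q - Gunits e), fv.span (relset diagrel))"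
proof -
  let ?I = "Q - Gunits e"
  have Qe: "corner e e = Q" unfolding fe ..
  have I: "a \<in> ?I \<longleftrightarrow> a \<in> Q \<and> \<not> ge e a" for a
    using Gunits_iff[OF e, of a] Q_iff[of a] fe by auto
  have "setmul (nabla (ideal_of e)) (nabla (ideal_of e)) \<inter> Q = NN" using setmul_NN by (simp only: fe)
  then have N: "setmul (nabla (ideal_of e)) (nabla (ideal_of e)) \<inter> ?I = NN"
    using I NN_not_ge(2) by blast
  have Qe_iff: "a \<in> Q \<longleftrightarrow> e * a = a \<and> a * e = a" for a using Q_iff[of a] by (simp only: fe)
  have mQ: "e * m * n * e \<in> Q" "e * m * e * n * e \<in> Q" for m n
    unfolding Qe_iff by (simp_all add: mult.assoc e assoc_ext[OF e])
  have mn: "\<not> ge e (e * m * n * e)" "\<not> ge e (e * m * e * n * e)" if "\<not> ge e (m * n)" for m n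
    using that by (auto simp: ge_mult_iff[OF e])
  have mI: "e * m * n * e \<in> ?I" "e * m * e * n * e \<in> ?I" if "\<not> ge e (m * n)" for m n
    using mQ mn[OF that] unfolding I by blast+
  have R: "{(e * m * n * e, e * m * e * n * e) | m n. \<not> ideal_of e \<subseteq> sigma (m * n)} \<inter> (?I \<times> ?I) = diagrel"
    unfolding subset_sigma_iff[OF e] diagrel_def using mI by blast
  show ?thesis unfolding Vdiag_def Let_def Qe N R relset_def vsp_def unfolding rel_span_eq ..
qed

lemma VXY_computes_ext:
  assumes card: "(of_nat (card (Gunits e)) :: 'k) \<noteq> 0"
    and c: "ideal_of e = ideal_of f \<longrightarrow> e = f" "ideal_of e \<subset> ideal_of f \<longrightarrow> e * f = e \<and> f * e = e"
      "ideal_of f \<subset> ideal_of e \<longrightarrow> f * e = f \<and> e * f = f"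
  shows "computes_ext (fst (VXY e f)) (snd (VXY e f))"
proof -
  consider "ideal_of e = ideal_of f" | "ideal_of e \<subset> ideal_of f" | "ideal_of f \<subset> ideal_of e"
    | "\<not> ideal_of e \<subseteq> ideal_of f" "\<not> ideal_of f \<subseteq> ideal_of e" by blast
  then show ?thesis
  proof cases
    case 1
    then have fe: "f = e" using c by simp
    have V: "(VXY e f :: ('m \<Rightarrow> 'k) set \<times> _) = Vdiag e" unfolding VXY_def if_P[OF 1] ..
    show ?thesis using computes_ext_diag[OF fe card] unfolding V Vdiag_eq[OF fe] fst_conv snd_conv .
  next
    case 2
    then have V: "(VXY e f :: ('m \<Rightarrow> 'k) set \<times> _) = Vlt e f" unfolding VXY_def by auto
    have "\<not> ge f e" using 2 unfolding ideal_subset_iff[symmetric] by blast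
    then show ?thesis using computes_ext_lt c(2) 2 unfolding V Vlt_eq fst_conv snd_conv by blast
  next
    case 3
    then have V: "(VXY e f :: ('m \<Rightarrow> 'k) set \<times> _) = Vgt e f" unfolding VXY_def by auto
    have "\<not> ge e f" using 3 unfolding ideal_subset_iff[symmetric] by blast
    then show ?thesis using computes_ext_gt c(3) 3 unfolding V Vgt_eq fst_conv snd_conv by blast
  next
    case 4
    then have V: "(VXY e f :: ('m \<Rightarrow> 'k) set \<times> _) = Vinc e f" unfolding VXY_def by auto
    show ?thesis using computes_ext_inc 4 unfolding V Vinc_eq ideal_subset_iff fst_conv snd_conv by blast
  qed
qed

end

text \<open>Post-composition on Hom(U, V), a linear map being its matrix with rows in
  \<open>J\<close> and columns in \<open>I\<close>; \<open>ract\<close> is pre-composition. Cutting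
  off outside \<open>J\<close> and \<open>I\<close> keeps the result in \<open>vsp\<close>.\<close>

definition lact :: "'v set \<Rightarrow> 'u set \<Rightarrow> ('m \<Rightarrow> 'v \<Rightarrow> 'v \<Rightarrow> 'k::field) \<Rightarrow> 'm \<Rightarrow> ('v \<times> 'u \<Rightarrow> 'k) \<Rightarrow> 'v \<times> 'u \<Rightarrow> 'k" where
  "lact J I \<tau> m x = (\<lambda>(t, s). if t \<in> J \<and> s \<in> I then (\<Sum>t'\<in>J. \<tau> m t t' * x (t', s)) else 0)"

definition ract :: "'v set \<Rightarrow> 'u set \<Rightarrow> ('m \<Rightarrow> 'u \<Rightarrow> 'u \<Rightarrow> 'k::field) \<Rightarrow> 'm \<Rightarrow> ('v \<times> 'u \<Rightarrow> 'k) \<Rightarrow> 'v \<times> 'u \<Rightarrow> 'k" where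
  "ract J I \<tau> n x = (\<lambda>(t, s). if t \<in> J \<and> s \<in> I then (\<Sum>s'\<in>I. x (t, s') * \<tau> n s' s) else 0)"

lemma flin_lact: "flin (lact J I \<tau> m)"
  by (rule flinI) (auto simp: lact_def fun_eq_iff distrib_left sum.distrib sum_distrib_left mult.left_commute)

lemma flin_ract: "flin (ract J I \<tau> m)"
  by (rule flinI) (auto simp: ract_def fun_eq_iff distrib_right sum.distrib sum_distrib_left mult.assoc)

lemma lact_in_vsp: "lact J I \<tau> m x \<in> vsp (J \<times> I)"
  by (auto simp: lact_def vsp_def)

lemma ract_in_vsp: "ract J I \<tau> m x \<in> vsp (J \<times> I)"
  by (auto simp: ract_def vsp_def)

lemma lact_mult:
  assumes "is_rep UNIV (*) 1 J \<tau>" shows "lact J I \<tau> (m * n) x = lact J I \<tau> m (lact J I \<tau> n x)"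
proof (rule ext, clarify)
  fix t s
  show "lact J I \<tau> (m * n) x (t, s) = lact J I \<tau> m (lact J I \<tau> n x) (t, s)"
  proof (cases "t \<in> J \<and> s \<in> I")
    case True
    have "(\<Sum>t'\<in>J. \<tau> (m * n) t t' * x (t', s)) = (\<Sum>t'\<in>J. \<Sum>l\<in>J. \<tau> m t l * \<tau> n l t' * x (t', s))"
      using assms True by (intro sum.cong) (auto simp: is_rep_def sum_distrib_right)
    also have "\<dots> = (\<Sum>l\<in>J. \<tau> m t l * (\<Sum>t'\<in>J. \<tau> n l t' * x (t', s)))"
      by (subst sum.swap) (simp add: sum_distrib_left mult.assoc)
    finally show ?thesis using True by (simp add: lact_def)
  qed (auto simp: lact_def)
qed

lemma ract_mult:
  assumes "is_rep UNIV (*) 1 I \<tau>" shows "ract J I \<tau> (m * n) x = ract J I \<tau> n (ract J I \<tau> m x)"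
proof (rule ext, clarify)
  fix t s
  show "ract J I \<tau> (m * n) x (t, s) = ract J I \<tau> n (ract J I \<tau> m x) (t, s)"
  proof (cases "t \<in> J \<and> s \<in> I")
    case True
    have "(\<Sum>s'\<in>I. x (t, s') * \<tau> (m * n) s' s) = (\<Sum>s'\<in>I. \<Sum>l\<in>I. x (t, s') * (\<tau> m s' l * \<tau> n l s))"
      using assms True by (intro sum.cong) (auto simp: is_rep_def sum_distrib_left)
    also have "\<dots> = (\<Sum>l\<in>I. (\<Sum>s'\<in>I. x (t, s') * \<tau> m s' l) * \<tau> n l s)"
      by (subst sum.swap) (simp add: sum_distrib_right mult.assoc)
    finally show ?thesis using True by (simp add: ract_def)
  qed (auto simp: ract_def)
qed

lemma lact_ract: "lact J I \<tau> m (ract J I \<tau>' n x) = ract J I \<tau>' n (lact J I \<tau> m x)"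
proof (rule ext, clarify)
  fix t s
  show "lact J I \<tau> m (ract J I \<tau>' n x) (t, s) = ract J I \<tau>' n (lact J I \<tau> m x) (t, s)"
  proof (cases "t \<in> J \<and> s \<in> I")
    case True
    have "(\<Sum>t'\<in>J. \<tau> m t t' * (\<Sum>s'\<in>I. x (t', s') * \<tau>' n s' s)) = (\<Sum>s'\<in>I. (\<Sum>t'\<in>J. \<tau> m t t' * x (t', s')) * \<tau>' n s' s)"
      unfolding sum_distrib_left sum_distrib_right by (subst sum.swap) (simp add: mult.assoc)
    then show ?thesis using True by (simp add: lact_def ract_def)
  qed (auto simp: lact_def ract_def)
qed

lemma lact_id:
  assumes "finite J" "\<And>t t'. t \<in> J \<Longrightarrow> t' \<in> J \<Longrightarrow> \<tau> m t t' = (if t = t' then 1 else 0)" "x \<in> vsp (J \<times> I)"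
  shows "lact J I \<tau> m x = x"
proof (rule ext, clarify)
  fix t s
  have "(\<Sum>t'\<in>J. \<tau> m t t' * x (t', s)) = (\<Sum>t'\<in>J. if t = t' then x (t', s) else 0)" if "t \<in> J"
    using assms(2) that by (intro sum.cong) auto
  then show "lact J I \<tau> m x (t, s) = x (t, s)" using assms by (auto simp: lact_def vsp_def)
qed

lemma ract_id:
  assumes "finite I" "\<And>t t'. t \<in> I \<Longrightarrow> t' \<in> I \<Longrightarrow> \<tau> m t t' = (if t = t' then 1 else 0)" "x \<in> vsp (J \<times> I)"
  shows "ract J I \<tau> m x = x"
proof (rule ext, clarify)
  fix t s
  have "(\<Sum>s'\<in>I. x (t, s') * \<tau> m s' s) = (\<Sum>s'\<in>I. if s' = s then x (t, s') else 0)" if "s \<in> I"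
    using assms(2) that by (intro sum.cong) auto
  then show "ract J I \<tau> m x (t, s) = x (t, s)" using assms by (auto simp: ract_def vsp_def)
qed

text \<open>Under the identification of V tensor U^* with Hom(U, V), the pair \<open>(g, h)\<close>
  acts by composing with \<open>g\<close> after and with the inverse of \<open>h\<close> before. So
  \<open>tens\<close> is the group action induced by the bimodule.\<close>

lemma (in rect_monoid) bimodule_ext_Hom:
  fixes \<rho>U :: "'m \<Rightarrow> 'u \<Rightarrow> 'u \<Rightarrow> 'k::field" and \<rho>V :: "'m \<Rightarrow> 'v \<Rightarrow> 'v \<Rightarrow> 'k" and e f :: 'm
  assumes e: "e * e = e" and f: "f * f = f"
    and U: "is_rep (Gunits e) (*) e I \<rho>U" and V: "is_rep (Gunits f) (*) f J \<rho>V"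
  shows "bimodule_ext e f (J \<times> I) (lact J I (infl f \<rho>V)) (ract J I (infl e \<rho>U)) (tens e \<rho>V \<rho>U)"
proof -
  have fin: "finite I" "finite J" using U V by (auto simp: is_rep_def)
  have gu: "infl e \<rho>U g i j = \<rho>U g i j" if "g \<in> Gunits e" for g i j
    using corner_gunit[OF e that] Gunits_geD[OF e that] by (simp add: infl_eq[OF e])
  have gv: "infl f \<rho>V g i j = \<rho>V g i j" if "g \<in> Gunits f" for g i j
    using corner_gunit[OF f that] Gunits_geD[OF f that] by (simp add: infl_eq[OF f])
  have ue: "e \<in> Gunits e" and uf: "f \<in> Gunits f" using fin_group.u[OF fin_group_Gunits] e f by blast+
  interpret E: fin_group "Gunits e" "(*)" e "ginv e" by (rule fin_group_Gunits[OF e])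
  interpret A: Vector_Spaces.linear vsmul vsmul "lact J I (infl f \<rho>V) m" for m by (rule flin_lact)
  interpret B: Vector_Spaces.linear vsmul vsmul "ract J I (infl e \<rho>U) m" for m by (rule flin_ract)
  show ?thesis
  proof unfold_locales
    show "e * e = e" "f * f = f" by (rule e, rule f)
    show "lact J I (infl f \<rho>V) f x = x" if "x \<in> vsp (J \<times> I)" for x
      by (rule lact_id[OF fin(2) _ that]) (use V in \<open>simp add: gv[OF uf] is_rep_def\<close>)
    show "ract J I (infl e \<rho>U) e x = x" if "x \<in> vsp (J \<times> I)" for x
      by (rule ract_id[OF fin(1) _ that]) (use U in \<open>simp add: gu[OF ue] is_rep_def\<close>)
    show "lact J I (infl f \<rho>V) m x = 0" if "\<not> ge f m" for m x
      using that by (auto simp: lact_def fun_eq_iff infl_eq[OF f])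
    show "ract J I (infl e \<rho>U) m x = 0" if "\<not> ge e m" for m x
      using that by (auto simp: ract_def fun_eq_iff infl_eq[OF e])
    show "mact (J \<times> I) (tens e \<rho>V \<rho>U) (g, h) x = lact J I (infl f \<rho>V) g (ract J I (infl e \<rho>U) (ginv e h) x)"
      if g: "g \<in> Gunits f" and h: "h \<in> Gunits e" for g h x
    proof (rule ext, clarify)
      fix t s
      show "mact (J \<times> I) (tens e \<rho>V \<rho>U) (g, h) x (t, s) = lact J I (infl f \<rho>V) g (ract J I (infl e \<rho>U) (ginv e h) x) (t, s)"
      proof (cases "t \<in> J \<and> s \<in> I")
        case True
        have "(\<Sum>p\<in>J \<times> I. tens e \<rho>V \<rho>U (g, h) (t, s) p * x p) = (\<Sum>t'\<in>J. \<Sum>s'\<in>I. tens e \<rho>V \<rho>U (g, h) (t, s) (t', s') * x (t', s'))"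
          unfolding sum.cartesian_product by (simp add: case_prod_beta)
        also have "\<dots> = (\<Sum>t'\<in>J. \<rho>V g t t' * (\<Sum>s'\<in>I. x (t', s') * \<rho>U (ginv e h) s' s))"
          unfolding sum_distrib_left by (simp add: tens_def ac_simps)
        finally show ?thesis using True by (simp add: mact_def lact_def ract_def gv[OF g] gu[OF E.inv[OF h]])
      qed (auto simp: mact_def lact_def)
    qed
  qed (rule lact_in_vsp ract_in_vsp lact_mult[OF infl_rep[OF f V]] ract_mult[OF infl_rep[OF e U]] lact_ract)+
qed

lemma Hom_cocycles:
  fixes e f :: "'m::{monoid_mult,finite}"
  assumes b: "bimodule_ext e f (J \<times> I) (lact J I \<tau>V) (ract J I \<tau>U) \<sigma>"
  shows "cocycles I \<tau>U J \<tau>V = bimodule_ext.coc (J \<times> I) (lact J I \<tau>V) (ract J I \<tau>U)"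
proof -
  interpret B: bimodule_ext "TYPE('m)" e f "J \<times> I" "lact J I \<tau>V" "ract J I \<tau>U" \<sigma> by (rule b)
  have "c \<in> cocycles I \<tau>U J \<tau>V \<longleftrightarrow> c \<in> B.coc" for c
  proof -
    have sl: "(\<forall>m. (\<lambda>x. c (m, x)) \<in> vsp (J \<times> I)) \<longleftrightarrow> (\<forall>m t s. t \<notin> J \<or> s \<notin> I \<longrightarrow> c (m, t, s) = 0)"
      unfolding vsp_def by auto
    have eq: "(\<lambda>x. c (m * n, x)) = lact J I \<tau>V m (\<lambda>x. c (n, x)) + ract J I \<tau>U n (\<lambda>x. c (m, x)) \<longleftrightarrow>
        (\<forall>t\<in>J. \<forall>s\<in>I. c (m * n, t, s) = (\<Sum>t'\<in>J. \<tau>V m t t' * c (n, t', s)) + (\<Sum>s'\<in>I. c (m, t, s') * \<tau>U n s' s))"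
      if z: "\<forall>m t s. t \<notin> J \<or> s \<notin> I \<longrightarrow> c (m, t, s) = 0" for m n
    proof
      assume h: "(\<lambda>x. c (m * n, x)) = lact J I \<tau>V m (\<lambda>x. c (n, x)) + ract J I \<tau>U n (\<lambda>x. c (m, x))"
      show "\<forall>t\<in>J. \<forall>s\<in>I. c (m * n, t, s) = (\<Sum>t'\<in>J. \<tau>V m t t' * c (n, t', s)) + (\<Sum>s'\<in>I. c (m, t, s') * \<tau>U n s' s)"
      proof (intro ballI)
        fix t s assume "t \<in> J" "s \<in> I"
        then show "c (m * n, t, s) = (\<Sum>t'\<in>J. \<tau>V m t t' * c (n, t', s)) + (\<Sum>s'\<in>I. c (m, t, s') * \<tau>U n s' s)"
          using fun_cong[OF h, of "(t, s)"] by (simp add: lact_def ract_def)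
      qed
    next
      assume h: "\<forall>t\<in>J. \<forall>s\<in>I. c (m * n, t, s) = (\<Sum>t'\<in>J. \<tau>V m t t' * c (n, t', s)) + (\<Sum>s'\<in>I. c (m, t, s') * \<tau>U n s' s)"
      show "(\<lambda>x. c (m * n, x)) = lact J I \<tau>V m (\<lambda>x. c (n, x)) + ract J I \<tau>U n (\<lambda>x. c (m, x))"
      proof (rule ext, clarify)
        fix t s
        show "c (m * n, t, s) = (lact J I \<tau>V m (\<lambda>x. c (n, x)) + ract J I \<tau>U n (\<lambda>x. c (m, x))) (t, s)"
          using h z by (auto simp: lact_def ract_def)
      qed
    qed
    show ?thesis unfolding cocycles_def B.coc_def B.is_coc_def mem_Collect_eq sl using eq by blast
  qed
  then show ?thesis by blast
qed

lemma Hom_coboundaries: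
  fixes e f :: "'m::{monoid_mult,finite}"
  assumes b: "bimodule_ext e f (J \<times> I) (lact J I \<tau>V) (ract J I \<tau>U) \<sigma>"
  shows "coboundaries I \<tau>U J \<tau>V = bimodule_ext.cob (J \<times> I) (lact J I \<tau>V) (ract J I \<tau>U)"
proof -
  interpret B: bimodule_ext "TYPE('m)" e f "J \<times> I" "lact J I \<tau>V" "ract J I \<tau>U" \<sigma> by (rule b)
  have "c \<in> B.cob" if "c \<in> coboundaries I \<tau>U J \<tau>V" for c
  proof -
    obtain X where c: "c = (\<lambda>(m, t, s). if t \<in> J \<and> s \<in> I then (\<Sum>t'\<in>J. \<tau>V m t t' * X t' s) - (\<Sum>s'\<in>I. X t s' * \<tau>U m s' s) else 0)"
      using \<open>c \<in> coboundaries I \<tau>U J \<tau>V\<close> unfolding coboundaries_def by blast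
    define x where "x = (\<lambda>(t, s). if t \<in> J \<and> s \<in> I then X t s else 0)"
    have "x \<in> vsp (J \<times> I)" by (auto simp: x_def vsp_def)
    moreover have "(\<lambda>y. c (m, y)) = lact J I \<tau>V m x - ract J I \<tau>U m x" for m
      by (rule ext, clarify) (auto simp: c x_def lact_def ract_def intro!: sum.cong)
    ultimately show ?thesis unfolding B.cob_def by blast
  qed
  moreover have "c \<in> coboundaries I \<tau>U J \<tau>V" if "c \<in> B.cob" for c
  proof -
    obtain x where c: "\<And>m. (\<lambda>y. c (m, y)) = lact J I \<tau>V m x - ract J I \<tau>U m x"
      using \<open>c \<in> B.cob\<close> unfolding B.cob_def by blast
    have "c = (\<lambda>(m, t, s). if t \<in> J \<and> s \<in> I then (\<Sum>t'\<in>J. \<tau>V m t t' * x (t', s)) - (\<Sum>s'\<in>I. x (t, s') * \<tau>U m s' s) else 0)"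
    proof (rule ext, clarify)
      fix m t s
      show "c (m, t, s) = (if t \<in> J \<and> s \<in> I then (\<Sum>t'\<in>J. \<tau>V m t t' * x (t', s)) - (\<Sum>s'\<in>I. x (t, s') * \<tau>U m s' s) else 0)"
        using fun_cong[OF c[of m], of "(t, s)"] by (simp add: lact_def ract_def)
    qed
    then show ?thesis unfolding coboundaries_def by (intro CollectI exI[of _ "\<lambda>t s. x (t, s)"])
  qed
  ultimately show ?thesis by blast
qed

lemma (in rect_monoid) simple_Gunits_dens:
  fixes \<rho> :: "'m \<Rightarrow> 'i \<Rightarrow> 'i \<Rightarrow> 'k::field" and e :: 'm
  assumes split: "splitting_field TYPE('m) TYPE('k)" and e: "e * e = e"
    and s: "simple_mod (Gunits e) (*) e I \<rho>"
  shows "dens (Gunits e) I \<rho>"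
  by (rule dens_Gunits[OF e splitting_dens[OF split infl_simple[OF e s]]])

text \<open>Density for U and V passes to the tensor product and yields both its simplicity and its
  scalar endomorphisms. Maschke applies because the order of the product group is a product of two
  invertible numbers.\<close>

lemma (in rect_monoid) ext_multiplicity:
  fixes \<rho>U :: "'m \<Rightarrow> 'u \<Rightarrow> 'u \<Rightarrow> 'k::field" and \<rho>V :: "'m \<Rightarrow> 'v \<Rightarrow> 'v \<Rightarrow> 'k" and e f :: 'm
  assumes split: "splitting_field TYPE('m) TYPE('k)"
    and e: "e * e = e" and f: "f * f = f"
    and ce: "(of_nat (card (Gunits e)) :: 'k) \<noteq> 0" and cf: "(of_nat (card (Gunits f)) :: 'k) \<noteq> 0"
    and c: "ideal_of e = ideal_of f \<longrightarrow> e = f" "ideal_of e \<subset> ideal_of f \<longrightarrow> e * f = e \<and> f * e = e"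
      "ideal_of f \<subset> ideal_of e \<longrightarrow> f * e = f \<and> e * f = f"
    and U: "simple_mod (Gunits e) (*) e I \<rho>U" and V: "simple_mod (Gunits f) (*) f J \<rho>V"
  shows "has_mult (GG f e) pmul (f, e) (corner f e) (prep e) (fst (VXY e f)) (snd (VXY e f))
      (J \<times> I) (tens e \<rho>V \<rho>U) (ext1_dim I (infl e \<rho>U) J (infl f \<rho>V))"
proof -
  note rU = simple_modD(1)[OF U] and rV = simple_modD(1)[OF V]
  have fin: "finite I" "finite J" using rU rV by (auto simp: is_rep_def)
  note b = bimodule_ext_Hom[OF e f rU rV]
  interpret B: bimodule_ext "TYPE('m)" e f "J \<times> I" "lact J I (infl f \<rho>V)" "ract J I (infl e \<rho>U)" "tens e \<rho>V \<rho>U" by (rule b)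
  interpret G: fin_group "GG f e" pmul "(f, e)" "\<lambda>(g, h). (ginv f g, ginv e h)" by (rule fin_group_GG[OF e f])
  have d: "dens (GG f e) (J \<times> I) (tens e \<rho>V \<rho>U)"
    by (rule dens_tens[OF e simple_Gunits_dens[OF split f V] simple_Gunits_dens[OF split e U] fin(2)])
  have "I \<noteq> {}" "J \<noteq> {}" using simple_modD(2)[OF U] simple_modD(2)[OF V] by (auto simp: vsp_def)
  then have ne: "J \<times> I \<noteq> {}" by blast
  have S: "simple_mod (GG f e) pmul (f, e) (J \<times> I) (tens e \<rho>V \<rho>U)"
    by (rule dens_simple[OF d tens_rep[OF e rV rU] ne G.fin])
  have sc: "scalar_end (GG f e) (J \<times> I) (tens e \<rho>V \<rho>U)"
    by (rule dens_scalar_end[OF d _ G.fin]) (use fin in simp)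
  have card: "(of_nat (card (GG f e)) :: 'k) \<noteq> 0"
    using ce cf by (simp add: GG_def card_cartesian_product)
  have computes_ext: "B.computes_ext (fst (VXY e f)) (snd (VXY e f))" by (rule B.VXY_computes_ext[OF ce c])
  then have "section_ok (GG f e) pmul (f, e) (corner f e) (prep e) (fst (VXY e f)) (snd (VXY e f) :: ('m \<Rightarrow> 'k) set)"
    unfolding B.computes_ext_def by blast
  from G.has_mult_qdim[OF card S sc this] show ?thesis
    using computes_ext unfolding B.computes_ext_def ext1_dim_def Hom_cocycles[OF b] Hom_coboundaries[OF b] by (simp only:)
qed

text \<open>The vertex set is expressed by three conjuncts that make inflation a bijection on
  isomorphism classes. The last conjunct quantifies \<open>e\<close> and \<open>f\<close> afresh for
  each pair of ideals, since comparable ideals call for comparable idempotents chosen for that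
  pair.\<close>

theorem mainTheorem1:
  fixes eX :: "'m::{monoid_mult,finite} set \<Rightarrow> 'm"
  assumes rect: "rectangular TYPE('m)"
    and split: "splitting_field TYPE('m) TYPE('k::field)"
    and char: "\<forall>e\<in>(idems::'m set). \<not> CHAR('k) dvd card (Gunits e)"
    and choice: "\<forall>X\<in>Lam. eX X \<in> idems \<and> ideal_of (eX X) = X"
  shows
    "(\<forall>X\<in>Lam. \<forall>(I::'a set) (\<rho>::'m \<Rightarrow> 'a \<Rightarrow> 'a \<Rightarrow> 'k).
        simple_mod (Gunits (eX X)) (*) (eX X) I \<rho> \<longrightarrow> simple_mod UNIV (*) 1 I (infl (eX X) \<rho>))
   \<and> (\<forall>(I::'a set) (\<rho>::'m \<Rightarrow> 'a \<Rightarrow> 'a \<Rightarrow> 'k). simple_mod UNIV (*) 1 I \<rho> \<longrightarrow>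
        (\<exists>X\<in>Lam. \<exists>\<rho>U. simple_mod (Gunits (eX X)) (*) (eX X) I \<rho>U \<and>
                      iso_mod UNIV I \<rho> I (infl (eX X) \<rho>U)))
   \<and> (\<forall>X\<in>Lam. \<forall>Y\<in>Lam. \<forall>(I::'a set) (\<rho>U::'m \<Rightarrow> 'a \<Rightarrow> 'a \<Rightarrow> 'k) (J::'b set) (\<rho>V::'m \<Rightarrow> 'b \<Rightarrow> 'b \<Rightarrow> 'k).
        simple_mod (Gunits (eX X)) (*) (eX X) I \<rho>U \<and> simple_mod (Gunits (eX Y)) (*) (eX Y) J \<rho>V \<and>
        iso_mod UNIV I (infl (eX X) \<rho>U) J (infl (eX Y) \<rho>V) \<longrightarrow>
          X = Y \<and> iso_mod (Gunits (eX X)) I \<rho>U J \<rho>V)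
   \<and> (\<forall>X\<in>Lam. \<forall>Y\<in>Lam. \<forall>e f. e \<in> idems \<and> f \<in> idems \<and> ideal_of e = X \<and> ideal_of f = Y \<and>
        (X = Y \<longrightarrow> e = f) \<and> (X \<subset> Y \<longrightarrow> e * f = e \<and> f * e = e) \<and> (Y \<subset> X \<longrightarrow> f * e = f \<and> e * f = f) \<longrightarrow>
        (\<forall>(I::'u set) (\<rho>U::'m \<Rightarrow> 'u \<Rightarrow> 'u \<Rightarrow> 'k) (J::'v set) (\<rho>V::'m \<Rightarrow> 'v \<Rightarrow> 'v \<Rightarrow> 'k).
           simple_mod (Gunits e) (*) e I \<rho>U \<and> simple_mod (Gunits f) (*) f J \<rho>V \<longrightarrow>
           has_mult (GG f e) pmul (f, e) (corner f e) (prep e) (fst (VXY e f)) (snd (VXY e f))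
             (J \<times> I) (tens e \<rho>V \<rho>U) (ext1_dim I (infl e \<rho>U) J (infl f \<rho>V))))"
proof -
  interpret rect_monoid "TYPE('m)" by unfold_locales (rule rect)
  have card: "(of_nat (card (Gunits e)) :: 'k) \<noteq> 0" if "e * e = e" for e :: 'm
    using char that by (auto simp: idems_iff of_nat_eq_0_iff_char_dvd)
  have eX: "eX X * eX X = eX X" "ideal_of (eX X) = X" if "X \<in> Lam" for X
    using choice that by (auto simp: idems_iff)
  have apex: "\<exists>X\<in>Lam. simple_mod (Gunits (eX X)) (*) (eX X) I \<rho> \<and> iso_mod UNIV I \<rho> I (infl (eX X) \<rho>)"
    if s: "simple_mod UNIV (*) 1 I \<rho>" for I :: "'a set" and \<rho> :: "'m \<Rightarrow> 'a \<Rightarrow> 'a \<Rightarrow> 'k"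
  proof -
    obtain e0 :: 'm where e0: "e0 * e0 = e0" "\<And>e. e * e = e \<Longrightarrow> ge e e0 \<Longrightarrow> ge e0 e \<Longrightarrow>
       simple_mod (Gunits e) (*) e I \<rho> \<and> (\<forall>m v. mact I \<rho> m v = mact I (infl e \<rho>) m v)"
      using simple_is_infl[OF s] by blast
    have L: "ideal_of e0 \<in> Lam" unfolding Lam_def idems_iff using e0(1) by blast
    \<comment> \<open>The apex \<open>e0\<close> is one of several idempotents with its ideal; the
      chosen one generates the same ideal, which is all that \<open>simple_is_infl\<close>
      asks.\<close>
    have "ge (eX (ideal_of e0)) e0" "ge e0 (eX (ideal_of e0))" using eX(2)[OF L] by (auto simp: ideal_eq_iff)
    note h = e0(2)[OF eX(1)[OF L] this]
    have "iso_mod UNIV I \<rho> I (infl (eX (ideal_of e0)) \<rho>)"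
      by (rule iso_modI_same_action) (rule h[THEN conjunct2, rule_format])
    then show ?thesis by (intro bexI[OF _ L] conjI h[THEN conjunct1])
  qed
  have uniq: "X = Y \<and> iso_mod (Gunits (eX X)) I \<rho>U J \<rho>V"
    if XY: "X \<in> Lam" "Y \<in> Lam" and s: "simple_mod (Gunits (eX X)) (*) (eX X) I \<rho>U"
      "simple_mod (Gunits (eX Y)) (*) (eX Y) J \<rho>V" "iso_mod UNIV I (infl (eX X) \<rho>U) J (infl (eX Y) \<rho>V)"
    for X Y and I :: "'a set" and \<rho>U :: "'m \<Rightarrow> 'a \<Rightarrow> 'a \<Rightarrow> 'k" and J :: "'b set" and \<rho>V :: "'m \<Rightarrow> 'b \<Rightarrow> 'b \<Rightarrow> 'k"
  proof -
    note i = iso_infl[OF eX(1)[OF XY(1)] eX(1)[OF XY(2)] s]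
    have "ideal_of (eX X) = ideal_of (eX Y)" unfolding ideal_eq_iff using i(1,2) by blast
    then have "X = Y" using eX(2) XY by simp
    then show ?thesis using i(3) by blast
  qed
  show ?thesis
  proof (intro conjI, goal_cases)
    case 1
    show ?case using infl_simple eX(1) by blast
  next
    case 2
    show ?case using apex by blast
  next
    case 3
    show ?case by (intro ballI allI impI uniq) (elim conjE, assumption)+
  next
    case 4
    show ?case
    proof (intro ballI allI impI, elim conjE, goal_cases)
      case (1 X Y e f I \<rho>U J \<rho>V)
      then have ef: "e * e = e" "f * f = f" by (simp_all add: idems_iff)
      show ?case by (rule ext_multiplicity[OF split ef card[OF ef(1)] card[OF ef(2)]]) (use 1 in simp_all)
    qed
  qed
qed

end
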